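(* Let $D\ge1$. The subalgebra of $\mathcal{H}_{NCK}^{\mathcal{D}}$ generated by the elements $Y_w^i$ ($1\le i\le D$, $w\in W$) is a Hopf subalgebra. Its abelianization can be identified (via the Hopf algebra morphism $\mathcal{H}_{NCK}^{\mathcal{D}}\to\mathcal{H}_{CK}^{\mathcal{D}}$ forgetting the planar structure) with a subalgebra of $\mathcal{H}_{CK}^{\mathcal{D}}$, and it is isomorphic, as a Hopf algebra, to the free Faà di Bruno Hopf algebra $\mathcal{H}_{FdB,D}$ on $D$ variables.
   Context: $K$ is a field of characteristic zero, $D\ge1$ is an integer, and $W$ is the set of non-empty words in the letters $\{1,\ldots,D\}$. Let $\mathcal{D}=\{1,\ldots,D\}^3$, with elements written $i,(u_1,u_2)$. $\mathcal{H}_{NCK}^{\mathcal{D}}$ (resp. $\mathcal{H}_{CK}^{\mathcal{D}}$) is, as an algebra, the free associative (resp. free commutative associative) unital $K$-algebra generated by planar rooted trees (resp. rooted trees) whose vertices are decorated by elements of $\mathcal{D}$. For $d\in\mathcal{D}$, $B^+_d$ is the linear endomorphism sending a forest to the tree obtained by grafting all its trees (in order, in the planar case) on a common new root decorated by $d$. The coproduct $\Delta$ is the unique algebra morphism such that $\Delta(B^+_d(x))=B^+_d(x)\otimes1+(\mathrm{Id}\otimes B^+_d)\circ\Delta(x)$ for all $d\in\mathcal{D}$ and all $x$; both algebras are then Hopf algebras graded by the number of vertices. For $i\in\{1,\ldots,D\}$ and $w\in W$ of length $n$, $Y_w^i\in\mathcal{H}^{\mathcal{D}}_{NCK}$ is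 defined inductively by: $Y_w^i=\delta_{i,w}$ if $n=1$, and $Y_w^i=\sum_{1\le\alpha,\beta\le D}\sum_{w_1,w_2\in W,\ w_1w_2=w}B^+_{i,(\alpha,\beta)}(Y_{w_1}^\alpha Y_{w_2}^\beta)$ if $n\ge2$. $\mathcal{H}_{FdB,D}$ is the Hopf algebra of functions on the opposite of the group $G_D=\{(\sum_{w\in W}a_w^{(i)}h^w)_{1\le i\le D}\ :\ a_j^{(i)}=\delta_{i,j}\}$ of $D$-tuples of non-commutative formal series in $K\langle\langle h_1,\ldots,h_D\rangle\rangle$ tangent to the identity, under composition, where $h^{u_1\cdots u_k}=h_{u_1}\cdots h_{u_k}$. Explicitly, it is the commutative polynomial ring in variables $y_w^i$ ($1\le i\le D$, $w\in W$ of length at least $2$), where $y_w^i$ is the function sending an element of $G_D$ to its coefficient $a_w^{(i)}$, with the convention $y_j^i=\delta_{i,j}$ for one-letter words, and with coproduct determined by $\Delta(f)(P\otimes Q)=f(Q\circ P)$, i.e. $\Delta(y_w^i)=\sum_{k\geq 1}\sum_{1\le u_1,\ldots,u_k\le D}\sum_{w_1\cdots w_k=w}y_{w_1}^{u_1}\cdots y_{w_k}^{u_k}\otimes y^i_{u_1\cdots u_k}$, the inner sum over factorizations into non-empty words. *)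

theory Defs
  imports
    "HOL-Algebra.Algebraic_Closure_Type"
    "HOL-Algebra.QuotRing"
    "HOL-Algebra.Subrings"
    "HOL-Library.Poly_Mapping"
    "HOL-Library.Product_Plus"
    "HOL-Library.Multiset"
begin

section \<open>Formal linear combinations\<close>

definition scale :: "'k \<Rightarrow> ('x \<Rightarrow>\<^sub>0 'k) \<Rightarrow> ('x \<Rightarrow>\<^sub>0 'k::comm_ring_1)" where
  "scale c p = Poly_Mapping.map ((*) c) p"

abbreviation basis :: "'x \<Rightarrow> ('x \<Rightarrow>\<^sub>0 'k::comm_ring_1)" where
  "basis x \<equiv> Poly_Mapping.single x 1"

text \<open>Linear extension of a map given on basis elements.\<close>

definition lin_ext :: "('x \<Rightarrow> ('y \<Rightarrow>\<^sub>0 'k)) \<Rightarrow> ('x \<Rightarrow>\<^sub>0 'k) \<Rightarrow> ('y \<Rightarrow>\<^sub>0 'k::comm_ring_1)" where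
  "lin_ext f p = (\<Sum>x\<in>Poly_Mapping.keys p. scale (Poly_Mapping.lookup p x) (f x))"

lemma update_eq_plus:
  assumes "a \<notin> Poly_Mapping.keys f"
  shows "Poly_Mapping.update a b f = Poly_Mapping.single a b + f"
  using assms
  by (intro poly_mapping_eqI) (auto simp: lookup_update lookup_add lookup_single when_def in_keys_iff)

lemma lookup_scale [simp]: "Poly_Mapping.lookup (scale c p) x = c * Poly_Mapping.lookup p x"
  by (simp add: scale_def Poly_Mapping.map.rep_eq when_def)

lemma scale_add: "scale c (p + q) = scale c p + scale c q"
  and scale_left_add: "scale (c + d) p = scale c p + scale d p"
  and scale_scale: "scale c (scale d p) = scale (c * d) p"
  and scale_0 [simp]: "scale 0 p = 0" "scale c 0 = 0"
  and scale_1 [simp]: "scale 1 p = p"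
  by (rule poly_mapping_eqI, simp add: lookup_add algebra_simps)+

lemma scale_sum: "scale c (sum f I) = (\<Sum>i\<in>I. scale c (f i))"
  by (induction I rule: infinite_finite_induct) (simp_all add: scale_add)

lemma scale_single: "scale c (Poly_Mapping.single x d) = Poly_Mapping.single x (c * d)"
  by (rule poly_mapping_eqI) (simp add: lookup_single when_def)

lemma scale_mult: "scale c p * q = scale c (p * q)" "p * scale c q = scale c (p * q)"
  for p q :: "'m::monoid_add \<Rightarrow>\<^sub>0 'k::comm_ring_1"
proof -
  have *: "Poly_Mapping.single 0 c * r = scale c r" "r * Poly_Mapping.single 0 c = scale c r"
    for r :: "'m \<Rightarrow>\<^sub>0 'k"
    by (induction r rule: update_induct)
      (simp_all add: update_eq_plus algebra_simps mult_single scale_add scale_single)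
  show "scale c p * q = scale c (p * q)"
    by (metis *(1) mult.assoc)
  show "p * scale c q = scale c (p * q)"
    by (metis *(2) mult.assoc)
qed

lemma lin_ext_0 [simp]: "lin_ext f 0 = 0"
  by (simp add: lin_ext_def)

lemma lin_ext_add: "lin_ext f (p + q) = lin_ext f p + lin_ext f q"
  unfolding lin_ext_def
  by (rule setsum_keys_plus_distrib[where f = "\<lambda>x c. scale c (f x)"]) (simp_all add: scale_left_add)

lemma lin_ext_single [simp]: "lin_ext f (Poly_Mapping.single x c) = scale c (f x)"
  by (cases "c = 0") (simp_all add: lin_ext_def)

lemma lin_combination_induct [case_names zero add]:
  fixes p :: "'x \<Rightarrow>\<^sub>0 'k::comm_ring_1"
  assumes "P 0" and "\<And>x c p. P p \<Longrightarrow> P (Poly_Mapping.single x c + p)"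
  shows "P p"
  by (induction p rule: update_induct) (simp_all add: assms update_eq_plus)

lemma lin_ext_scale: "lin_ext f (scale c p) = scale c (lin_ext f p)"
  by (induction p rule: lin_combination_induct)
    (simp_all add: scale_add lin_ext_add scale_scale scale_single)

lemma lin_ext_lin_ext: "lin_ext f (lin_ext g p) = lin_ext (\<lambda>x. lin_ext f (g x)) p"
  by (induction p rule: lin_combination_induct) (simp_all add: lin_ext_add lin_ext_scale)

lemma lin_ext_plus: "lin_ext (\<lambda>x. f x + g x) p = lin_ext f p + lin_ext g p"
  by (induction p rule: lin_combination_induct) (simp_all add: lin_ext_add scale_add)

lemma lin_ext_mult:
  assumes "\<And>m n. f (m + n) = f m * f n"
  shows "lin_ext f (p * q) = lin_ext f p * lin_ext f q"
proof (induction p rule: lin_combination_induct)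
  case (add m c p)
  have "lin_ext f (Poly_Mapping.single m c * q) = scale c (f m) * lin_ext f q"
  proof (induction q rule: lin_combination_induct)
    case (add n d q)
    then show ?case
      by (simp add: distrib_left mult_single lin_ext_add assms scale_mult scale_scale mult.commute)
  qed simp
  with add show ?case
    by (simp add: distrib_right lin_ext_add)
qed simp


section \<open>Hopf algebras\<close>

text \<open>
  An element of \<open>H \<otimes> H\<close> is represented by a formal linear combination of pairs of elements of the
  carrier of \<open>H\<close>; two of these are the same tensor iff they differ by an element of the span of the
  bilinearity relations (\<open>teq2\<close>). Similarly for \<open>H \<otimes> H \<otimes> H\<close> and triples (\<open>teq3\<close>). The field
  \<open>comult\<close> returns a representative of the coproduct, so it is only ever compared by \<open>teq2\<close>.
\<close>

record (overloaded) ('k::zero, 'a) bialg = "('k, 'a) module" +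
  comult :: "'a \<Rightarrow> ('a \<times> 'a \<Rightarrow>\<^sub>0 'k)"
  counit :: "'a \<Rightarrow> 'k"

text \<open>The relations which make \<open>\<iota>\<close> linear on the carrier of \<open>H\<close>.\<close>

definition lin_rels :: "('k::field, 'a, 'm) module_scheme \<Rightarrow> ('a \<Rightarrow> 'x) \<Rightarrow> ('x \<Rightarrow>\<^sub>0 'k) set" where
  "lin_rels H \<iota> =
     {basis (\<iota> (a \<oplus>\<^bsub>H\<^esub> b)) - basis (\<iota> a) - basis (\<iota> b) | a b. a \<in> carrier H \<and> b \<in> carrier H}
   \<union> {basis (\<iota> (c \<odot>\<^bsub>H\<^esub> a)) - Poly_Mapping.single (\<iota> a) c | c a. a \<in> carrier H}"

definition teq2 ::
  "('k::field, 'a, 'm) module_scheme \<Rightarrow> ('a \<times> 'a \<Rightarrow>\<^sub>0 'k) \<Rightarrow> ('a \<times> 'a \<Rightarrow>\<^sub>0 'k) \<Rightarrow> bool" where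
  "teq2 H s t \<longleftrightarrow> s - t \<in> Modules.module.span scale
     (\<Union>b\<in>carrier H. lin_rels H (\<lambda>a. (a, b)) \<union> lin_rels H (\<lambda>a. (b, a)))"

definition teq3 ::
  "('k::field, 'a, 'm) module_scheme \<Rightarrow> ('a \<times> 'a \<times> 'a \<Rightarrow>\<^sub>0 'k) \<Rightarrow> ('a \<times> 'a \<times> 'a \<Rightarrow>\<^sub>0 'k) \<Rightarrow> bool"
  where
  "teq3 H s t \<longleftrightarrow> s - t \<in> Modules.module.span scale
     (\<Union>b\<in>carrier H. \<Union>c\<in>carrier H.
        lin_rels H (\<lambda>a. (a, b, c)) \<union> lin_rels H (\<lambda>a. (b, a, c)) \<union> lin_rels H (\<lambda>a. (b, c, a)))"

text \<open>The map \<open>f \<otimes> g\<close>, the product of \<open>H \<otimes> H\<close>, and the linear map \<open>H \<otimes> H \<rightarrow> H\<close> induced by a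
  bilinear map \<open>f\<close>.\<close>

definition tmap :: "('a \<Rightarrow> 'b) \<Rightarrow> ('a \<Rightarrow> 'c) \<Rightarrow> ('a \<times> 'a \<Rightarrow>\<^sub>0 'k) \<Rightarrow> ('b \<times> 'c \<Rightarrow>\<^sub>0 'k::comm_ring_1)" where
  "tmap f g t = lin_ext (\<lambda>(a, b). basis (f a, g b)) t"

definition tmult :: "('a, 'm) monoid_scheme \<Rightarrow> ('a \<times> 'a \<Rightarrow>\<^sub>0 'k) \<Rightarrow> ('a \<times> 'a \<Rightarrow>\<^sub>0 'k)
    \<Rightarrow> ('a \<times> 'a \<Rightarrow>\<^sub>0 'k::comm_ring_1)" where
  "tmult H s t =
     lin_ext (\<lambda>(a, b). lin_ext (\<lambda>(c, d). basis (a \<otimes>\<^bsub>H\<^esub> c, b \<otimes>\<^bsub>H\<^esub> d)) t) s"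

definition contract :: "('k::field, 'a, 'm) module_scheme \<Rightarrow> ('a \<Rightarrow> 'a \<Rightarrow> 'a)
    \<Rightarrow> ('a \<times> 'a \<Rightarrow>\<^sub>0 'k) \<Rightarrow> 'a" where
  "contract H f t =
     finsum H (\<lambda>(a, b). Poly_Mapping.lookup t (a, b) \<odot>\<^bsub>H\<^esub> f a b) (Poly_Mapping.keys t)"

text \<open>The locale \<open>algebra\<close> of HOL-Algebra is restricted to commutative algebras.\<close>

locale k_algebra = ring H for H :: "('k::field, 'a, 'm) module_scheme" (structure) +
  assumes module: "Module.module (ring_of_type_algebra :: 'k ring) H"
    and smult_mult: "\<lbrakk>x \<in> carrier H; y \<in> carrier H\<rbrakk> \<Longrightarrow> (c \<odot> x) \<otimes> y = c \<odot> (x \<otimes> y)"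
    and mult_smult: "\<lbrakk>x \<in> carrier H; y \<in> carrier H\<rbrakk> \<Longrightarrow> x \<otimes> (c \<odot> y) = c \<odot> (x \<otimes> y)"

locale bialgebra = k_algebra H for H :: "('k::field, 'a, 'm) bialg_scheme" (structure) +
  assumes comult_closed:
      "x \<in> carrier H \<Longrightarrow> Poly_Mapping.keys (comult H x) \<subseteq> carrier H \<times> carrier H"
    and comult_add: "\<lbrakk>x \<in> carrier H; y \<in> carrier H\<rbrakk>
      \<Longrightarrow> teq2 H (comult H (x \<oplus> y)) (comult H x + comult H y)"
    and comult_smult: "x \<in> carrier H \<Longrightarrow> teq2 H (comult H (c \<odot> x)) (scale c (comult H x))"
    and comult_mult: "\<lbrakk>x \<in> carrier H; y \<in> carrier H\<rbrakk>
      \<Longrightarrow> teq2 H (comult H (x \<otimes> y)) (tmult H (comult H x) (comult H y))"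
    and comult_one: "teq2 H (comult H \<one>) (basis (\<one>, \<one>))"
    and counit_add: "\<lbrakk>x \<in> carrier H; y \<in> carrier H\<rbrakk>
      \<Longrightarrow> counit H (x \<oplus> y) = counit H x + counit H y"
    and counit_smult: "x \<in> carrier H \<Longrightarrow> counit H (c \<odot> x) = c * counit H x"
    and counit_mult: "\<lbrakk>x \<in> carrier H; y \<in> carrier H\<rbrakk>
      \<Longrightarrow> counit H (x \<otimes> y) = counit H x * counit H y"
    and counit_one: "counit H \<one> = 1"
    and coassoc: "x \<in> carrier H \<Longrightarrow> teq3 H
      (lin_ext (\<lambda>(a, b). lin_ext (\<lambda>(a', a''). basis (a', a'', b)) (comult H a)) (comult H x))
      (lin_ext (\<lambda>(a, b). lin_ext (\<lambda>(b', b''). basis (a, b', b'')) (comult H b)) (comult H x))"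
    and counit_left: "x \<in> carrier H \<Longrightarrow> contract H (\<lambda>a b. counit H a \<odot> b) (comult H x) = x"
    and counit_right: "x \<in> carrier H \<Longrightarrow> contract H (\<lambda>a b. counit H b \<odot> a) (comult H x) = x"

definition is_antipode :: "('k::field, 'a, 'm) bialg_scheme \<Rightarrow> ('a \<Rightarrow> 'a) \<Rightarrow> bool" where
  "is_antipode H S \<longleftrightarrow>
     S \<in> carrier H \<rightarrow> carrier H \<and>
     (\<forall>x\<in>carrier H. \<forall>y\<in>carrier H. S (x \<oplus>\<^bsub>H\<^esub> y) = S x \<oplus>\<^bsub>H\<^esub> S y) \<and>
     (\<forall>c. \<forall>x\<in>carrier H. S (c \<odot>\<^bsub>H\<^esub> x) = c \<odot>\<^bsub>H\<^esub> S x) \<and>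
     (\<forall>x\<in>carrier H.
        contract H (\<lambda>a b. S a \<otimes>\<^bsub>H\<^esub> b) (comult H x) = counit H x \<odot>\<^bsub>H\<^esub> \<one>\<^bsub>H\<^esub> \<and>
        contract H (\<lambda>a b. a \<otimes>\<^bsub>H\<^esub> S b) (comult H x) = counit H x \<odot>\<^bsub>H\<^esub> \<one>\<^bsub>H\<^esub>)"

locale hopf_algebra = bialgebra +
  assumes antipode_exists: "\<exists>S. is_antipode H S"

definition k_subalgebra :: "('k::field, 'a, 'm) module_scheme \<Rightarrow> 'a set \<Rightarrow> bool" where
  "k_subalgebra H A \<longleftrightarrow> subring A H \<and> (\<forall>c. \<forall>a\<in>A. c \<odot>\<^bsub>H\<^esub> a \<in> A)"

definition generated_subalgebra :: "('k::field, 'a, 'm) module_scheme \<Rightarrow> 'a set \<Rightarrow> 'a set" where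
  "generated_subalgebra H G = \<Inter>{A. k_subalgebra H A \<and> G \<subseteq> A}"

definition hopf_subalgebra :: "('k::field, 'a, 'm) bialg_scheme \<Rightarrow> 'a set \<Rightarrow> bool" where
  "hopf_subalgebra H A \<longleftrightarrow>
     hopf_algebra H \<and> k_subalgebra H A \<and>
     (\<forall>a\<in>A. \<exists>t. Poly_Mapping.keys t \<subseteq> A \<times> A \<and> teq2 H (comult H a) t) \<and>
     (\<exists>S. is_antipode H S \<and> S ` A \<subseteq> A)"

text \<open>The structure carried by a Hopf subalgebra \<open>A\<close>: the coproduct has to be represented by
  elements of \<open>A \<otimes> A\<close>.\<close>

definition sub_bialg :: "('k::field, 'a, 'm) bialg_scheme \<Rightarrow> 'a set \<Rightarrow> ('k, 'a, 'm) bialg_scheme" where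
  "sub_bialg H A = H\<lparr>carrier := A,
     comult := (\<lambda>a. SOME t. Poly_Mapping.keys t \<subseteq> A \<times> A \<and> teq2 H (comult H a) t)\<rparr>"

text \<open>The structure carried by the quotient by a Hopf ideal \<open>I\<close>, whose elements are the cosets of
  \<open>I\<close>; the choice of representatives of cosets is immaterial.\<close>

definition quotient_bialg :: "('k::field, 'a, 'm) bialg_scheme \<Rightarrow> 'a set \<Rightarrow> ('k, 'a set) bialg" where
  "quotient_bialg H I =
    \<lparr>carrier = carrier (H Quot I), monoid.mult = monoid.mult (H Quot I), monoid.one = monoid.one (H Quot I),
     ring.zero = ring.zero (H Quot I), ring.add = ring.add (H Quot I),
     module.smult = (\<lambda>c Z. I +>\<^bsub>H\<^esub> (c \<odot>\<^bsub>H\<^esub> (SOME x. x \<in> Z))),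
     comult = (\<lambda>Z. tmap (\<lambda>a. I +>\<^bsub>H\<^esub> a) (\<lambda>a. I +>\<^bsub>H\<^esub> a) (comult H (SOME x. x \<in> Z))),
     counit = (\<lambda>Z. counit H (SOME x. x \<in> Z))\<rparr>"

definition commutator_ideal :: "('a, 'm) ring_scheme \<Rightarrow> 'a set" where
  "commutator_ideal H =
     Idl\<^bsub>H\<^esub> {x \<otimes>\<^bsub>H\<^esub> y \<ominus>\<^bsub>H\<^esub> y \<otimes>\<^bsub>H\<^esub> x | x y. x \<in> carrier H \<and> y \<in> carrier H}"

definition abelianization :: "('k::field, 'a, 'm) bialg_scheme \<Rightarrow> ('k, 'a set) bialg" where
  "abelianization H = quotient_bialg H (commutator_ideal H)"

definition hopf_hom :: "('k::field, 'a, 'm) bialg_scheme \<Rightarrow> ('k, 'b, 'n) bialg_scheme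
    \<Rightarrow> ('a \<Rightarrow> 'b) \<Rightarrow> bool" where
  "hopf_hom H H' f \<longleftrightarrow>
     hopf_algebra H \<and> hopf_algebra H' \<and> f \<in> ring_hom H H' \<and>
     (\<forall>c. \<forall>x\<in>carrier H. f (c \<odot>\<^bsub>H\<^esub> x) = c \<odot>\<^bsub>H'\<^esub> f x) \<and>
     (\<forall>x\<in>carrier H. teq2 H' (comult H' (f x)) (tmap f f (comult H x))) \<and>
     (\<forall>x\<in>carrier H. counit H' (f x) = counit H x) \<and>
     (\<forall>S S'. is_antipode H S \<longrightarrow> is_antipode H' S' \<longrightarrow> (\<forall>x\<in>carrier H. f (S x) = S' (f x)))"

definition hopf_isomorphic ::
  "('k::field, 'a, 'm) bialg_scheme \<Rightarrow> ('k, 'b, 'n) bialg_scheme \<Rightarrow> bool" where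
  "hopf_isomorphic H H' \<longleftrightarrow> (\<exists>f. hopf_hom H H' f \<and> bij_betw f (carrier H) (carrier H'))"


section \<open>Free algebras as monoid algebras\<close>

text \<open>
  The free associative algebra on \<open>'x\<close> is the monoid algebra of \<open>'x list\<close>, and the free commutative
  algebra on \<open>'x\<close> that of \<open>'x multiset\<close>. For a monoid \<open>'m\<close>, the tensor square of the monoid algebra
  of \<open>'m\<close> is the monoid algebra of \<open>'m \<times> 'm\<close>, in which the coproducts below are defined.
\<close>

instantiation list :: (type) monoid_add
begin

definition zero_list :: "'a list" where "0 = []"
definition plus_list :: "'a list \<Rightarrow> 'a list \<Rightarrow> 'a list" where "xs + ys = xs @ ys"

instance by standard (simp_all add: zero_list_def plus_list_def)

end

definition tensor :: "('m \<Rightarrow>\<^sub>0 'k) \<Rightarrow> ('m \<Rightarrow>\<^sub>0 'k) \<Rightarrow> ('m \<times> 'm \<Rightarrow>\<^sub>0 'k::comm_ring_1)" where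
  "tensor p q = lin_ext (\<lambda>m. lin_ext (\<lambda>n. basis (m, n)) q) p"

lemma tensor_one: "tensor p 1 = lin_ext (\<lambda>m. basis (m, 0)) p"
  by (simp add: tensor_def flip: single_one)

text \<open>The bialgebra with carrier \<open>C\<close>, coproduct \<open>\<Delta>\<close>, and as counit the coefficient of the neutral
  element of \<open>'m\<close>.\<close>

definition monoid_bialg :: "('m \<Rightarrow>\<^sub>0 'k) set \<Rightarrow> (('m \<Rightarrow>\<^sub>0 'k) \<Rightarrow> ('m \<times> 'm \<Rightarrow>\<^sub>0 'k))
    \<Rightarrow> ('k::field, 'm::monoid_add \<Rightarrow>\<^sub>0 'k) bialg" where
  "monoid_bialg C \<Delta> =
    \<lparr>carrier = C, monoid.mult = (*), monoid.one = 1, ring.zero = 0, ring.add = (+), module.smult = scale,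
     comult = (\<lambda>x. lin_ext (\<lambda>(m, n). basis (basis m, basis n)) (\<Delta> x)),
     counit = (\<lambda>x. Poly_Mapping.lookup x 0)\<rparr>"


section \<open>The Hopf algebra of planar decorated rooted trees\<close>

datatype 'd ptree = PNode 'd "'d ptree list"

definition Bplus :: "'d \<Rightarrow> ('d ptree list \<Rightarrow>\<^sub>0 'k) \<Rightarrow> ('d ptree list \<Rightarrow>\<^sub>0 'k::comm_ring_1)" where
  "Bplus d x = lin_ext (\<lambda>F. basis [PNode d F]) x"

text \<open>\<open>Id \<otimes> B\<close> for the operator \<open>B\<close> which maps each basis element \<open>n\<close> to the basis element \<open>b n\<close>.\<close>

definition id_tensor :: "('m \<Rightarrow> 'm) \<Rightarrow> ('m \<times> 'm \<Rightarrow>\<^sub>0 'k) \<Rightarrow> ('m \<times> 'm \<Rightarrow>\<^sub>0 'k::comm_ring_1)" where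
  "id_tensor b t = lin_ext (\<lambda>(m, n). basis (m, b n)) t"

primrec nck_coprod_tree :: "'d ptree \<Rightarrow> ('d ptree list \<times> 'd ptree list \<Rightarrow>\<^sub>0 'k::comm_ring_1)" where
  "nck_coprod_tree (PNode d F) =
     basis ([PNode d F], []) + id_tensor (\<lambda>G. [PNode d G]) (prod_list (map nck_coprod_tree F))"

definition nck_coprod ::
  "('d ptree list \<Rightarrow>\<^sub>0 'k) \<Rightarrow> ('d ptree list \<times> 'd ptree list \<Rightarrow>\<^sub>0 'k::comm_ring_1)" where
  "nck_coprod x = lin_ext (\<lambda>F. prod_list (map nck_coprod_tree F)) x"

text \<open>The two properties which characterize the coproduct; similarly below.\<close>

lemma nck_coprod_mult: "nck_coprod 1 = 1" "nck_coprod (x * y) = nck_coprod x * nck_coprod y"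
  by (simp_all add: nck_coprod_def lin_ext_mult plus_list_def flip: single_one)
     (simp add: zero_list_def)

lemma nck_coprod_Bplus:
  "nck_coprod (Bplus d x) = tensor (Bplus d x) 1 + id_tensor (\<lambda>G. [PNode d G]) (nck_coprod x)"
  by (simp add: nck_coprod_def Bplus_def tensor_one id_tensor_def lin_ext_lin_ext lin_ext_plus
      zero_list_def)

lemma id_tensor_Bplus: "id_tensor (\<lambda>G. [PNode d G]) (tensor x y) = tensor x (Bplus d y)"
  by (simp add: Bplus_def tensor_def id_tensor_def lin_ext_lin_ext)

definition H_NCK :: "('k::field, 'd ptree list \<Rightarrow>\<^sub>0 'k) bialg" where
  "H_NCK = monoid_bialg UNIV nck_coprod"


section \<open>The Hopf algebra of decorated rooted trees\<close>

datatype 'd rtree = RNode 'd "'d rtree multiset"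

definition Bplus_c ::
  "'d \<Rightarrow> ('d rtree multiset \<Rightarrow>\<^sub>0 'k) \<Rightarrow> ('d rtree multiset \<Rightarrow>\<^sub>0 'k::comm_ring_1)" where
  "Bplus_c d x = lin_ext (\<lambda>F. basis {#RNode d F#}) x"

primrec ck_coprod_tree ::
  "'d rtree \<Rightarrow> ('d rtree multiset \<times> 'd rtree multiset \<Rightarrow>\<^sub>0 'k::comm_ring_1)" where
  "ck_coprod_tree (RNode d F) =
     basis ({#RNode d F#}, {#})
     + id_tensor (\<lambda>G. {#RNode d G#}) (prod_mset (image_mset ck_coprod_tree F))"

definition ck_coprod ::
  "('d rtree multiset \<Rightarrow>\<^sub>0 'k) \<Rightarrow> ('d rtree multiset \<times> 'd rtree multiset \<Rightarrow>\<^sub>0 'k::comm_ring_1)" where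
  "ck_coprod x = lin_ext (\<lambda>F. prod_mset (image_mset ck_coprod_tree F)) x"

lemma ck_coprod_mult: "ck_coprod 1 = 1" "ck_coprod (x * y) = ck_coprod x * ck_coprod y"
  by (simp_all add: ck_coprod_def lin_ext_mult flip: single_one)

lemma ck_coprod_Bplus:
  "ck_coprod (Bplus_c d x) = tensor (Bplus_c d x) 1 + id_tensor (\<lambda>G. {#RNode d G#}) (ck_coprod x)"
  by (simp add: ck_coprod_def Bplus_c_def tensor_one id_tensor_def lin_ext_lin_ext lin_ext_plus)

lemma id_tensor_Bplus_c: "id_tensor (\<lambda>G. {#RNode d G#}) (tensor x y) = tensor x (Bplus_c d y)"
  by (simp add: Bplus_c_def tensor_def id_tensor_def lin_ext_lin_ext)

definition H_CK :: "('k::field, 'd rtree multiset \<Rightarrow>\<^sub>0 'k) bialg" where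
  "H_CK = monoid_bialg UNIV ck_coprod"

primrec forget_tree :: "'d ptree \<Rightarrow> 'd rtree" where
  "forget_tree (PNode d F) = RNode d (mset (map forget_tree F))"

definition forget_planar ::
  "('d ptree list \<Rightarrow>\<^sub>0 'k) \<Rightarrow> ('d rtree multiset \<Rightarrow>\<^sub>0 'k::comm_ring_1)" where
  "forget_planar x = lin_ext (\<lambda>F. basis (mset (map forget_tree F))) x"


section \<open>The elements \<open>Y\<close>\<close>

text \<open>The letters are the elements of a finite type \<open>'n\<close> with \<open>CARD('n) = D\<close>; the decoration
  \<open>i, (\<alpha>, \<beta>)\<close> is the triple \<open>(i, \<alpha>, \<beta>)\<close>. The value on the empty word, which is not in \<open>W\<close>, is
  irrelevant.\<close>

function Y :: "'n::finite \<Rightarrow> 'n list \<Rightarrow> (('n \<times> 'n \<times> 'n) ptree list \<Rightarrow>\<^sub>0 'k::comm_ring_1)" where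
  "Y i w = (if length w \<le> 1 then (if w = [i] then 1 else 0)
     else \<Sum>\<alpha>\<in>UNIV. \<Sum>\<beta>\<in>UNIV. \<Sum>(w1, w2)\<in>{(w1, w2). w1 \<noteq> [] \<and> w2 \<noteq> [] \<and> w1 @ w2 = w}.
       Bplus (i, \<alpha>, \<beta>) (Y \<alpha> w1 * Y \<beta> w2))"
  by auto
termination
  by (relation "measure (\<lambda>(i, w). length w)") auto

declare Y.simps [simp del]


section \<open>The free Faa di Bruno Hopf algebra\<close>

text \<open>The variable \<open>y\<^sub>w\<^sup>i\<close> is encoded as \<open>(i, w)\<close>.\<close>

definition fdb_carrier :: "(('n \<times> 'n list) multiset \<Rightarrow>\<^sub>0 'k::comm_ring_1) set" where
  "fdb_carrier = {x. \<forall>m\<in>Poly_Mapping.keys x. \<forall>(i, w)\<in>set_mset m. 2 \<le> length w}"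

definition fdb_y :: "'n \<Rightarrow> 'n list \<Rightarrow> (('n \<times> 'n list) multiset \<Rightarrow>\<^sub>0 'k::comm_ring_1)" where
  "fdb_y i w = (if length w = 1 then (if w = [i] then 1 else 0) else basis {#(i, w)#})"

text \<open>The factorizations \<open>w\<^sub>1 \<dots> w\<^sub>k = w\<close> are lists \<open>ws\<close> of words, and \<open>u\<close> is the word
  \<open>u\<^sub>1 \<dots> u\<^sub>k\<close>. On variables the coproduct is dual to the composition \<open>(P, Q) \<mapsto> Q \<circ> P\<close> of \<open>D\<close>-tuples of
  non-commutative series tangent to the identity: evaluating the left factors at \<open>P\<close> and the right
  factors at \<open>Q\<close> gives the coefficient of \<open>h\<^sup>w\<close> in the \<open>i\<close>-th component of \<open>Q \<circ> P\<close>.\<close>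

definition fdb_coprod_var :: "'n::finite \<times> 'n list
    \<Rightarrow> (('n \<times> 'n list) multiset \<times> ('n \<times> 'n list) multiset \<Rightarrow>\<^sub>0 'k::comm_ring_1)" where
  "fdb_coprod_var = (\<lambda>(i, w).
     \<Sum>ws\<in>{ws. [] \<notin> set ws \<and> concat ws = w}. \<Sum>u\<in>{u. length u = length ws}.
       tensor (\<Prod>j<length ws. fdb_y (u ! j) (ws ! j)) (fdb_y i u))"

definition fdb_coprod :: "(('n::finite \<times> 'n list) multiset \<Rightarrow>\<^sub>0 'k)
    \<Rightarrow> (('n \<times> 'n list) multiset \<times> ('n \<times> 'n list) multiset \<Rightarrow>\<^sub>0 'k::comm_ring_1)" where
  "fdb_coprod x = lin_ext (\<lambda>m. prod_mset (image_mset fdb_coprod_var m)) x"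

lemma fdb_coprod_mult: "fdb_coprod 1 = 1" "fdb_coprod (x * y) = fdb_coprod x * fdb_coprod y"
  by (simp_all add: fdb_coprod_def lin_ext_mult flip: single_one)

definition H_FdB :: "('k::field, ('n::finite \<times> 'n list) multiset \<Rightarrow>\<^sub>0 'k) bialg" where
  "H_FdB = monoid_bialg fdb_carrier fdb_coprod"

end

theory Submission
  imports Defs
begin

text \<open>
  The recursion for \<open>Y\<close> and the cocycle property of the grafting operators
  show by induction on \<open>w\<close> that the coproduct of \<open>Y i w\<close> is the sum of
  \<open>Y u\<^sub>1 w\<^sub>1 \<cdots> Y u\<^sub>k w\<^sub>k \<otimes> Y i (u\<^sub>1 \<dots> u\<^sub>k)\<close> over all factorizations \<open>w = w\<^sub>1 \<dots> w\<^sub>k\<close> and all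
  words \<open>u\<^sub>1 \<dots> u\<^sub>k\<close> (\<open>nck_coprod_Y\<close>). This is the coproduct of the variables of the Faa di Bruno
  algebra, except that the factors do not commute. So the generated subalgebra is stable under the
  coproduct, and an induction on the length of \<open>w\<close> shows that it is stable under the antipode
  (\<open>nck_antipode_Y\<close>).

  In the commutative algebra of rooted trees, the images of the elements
  \<open>Y i w\<close> with at least two letters are linear combinations of single trees, and a certain tree
  without branching has a nonzero coefficient in exactly one of them (\<open>lookup_Yc_ladder\<close>). Sending
  these trees to variables and all other trees to zero gives a left inverse of the polynomial map
  \<open>y \<mapsto> Yc\<close> from the Faa di Bruno algebra to the algebra of rooted trees (\<open>read_Yc_prod\<close>). Hence
  the Faa di Bruno algebra is a subalgebra of the latter, stable under the coproduct by the formula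
  above, and the axioms of a Hopf algebra hold for it (\<open>fdb_filtered_bialg\<close>).

  Modulo commutators an element of the subalgebra is a commutative polynomial
  in the generators, and by independence this polynomial can be read off from the image of the
  element under forgetting the planar structure. So the kernel of the forgetful map on the subalgebra
  is exactly the commutator ideal (\<open>ideal_iff_forget_planar\<close>), and the polynomial serves as a
  coordinate on the abelianization which identifies it with the Faa di Bruno algebra
  (\<open>Y_ab_coordinates\<close>).

  All Hopf algebras involved are treated through coordinates in a monoid algebra, where tensors modulo
  bilinearity relations become honest elements and all axioms can be checked on monomials. Antipodes
  exist because the coproduct of a monomial \<open>m\<close> is \<open>m \<otimes> 1\<close> up to terms with a left factor of
  smaller weight, and morphisms are compatible with them by uniqueness of convolution inverses.
\<close>

section \<open>Linear extensions and tensors\<close>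

abbreviation keys :: "('x \<Rightarrow>\<^sub>0 'k::zero) \<Rightarrow> 'x set" where "keys \<equiv> Poly_Mapping.keys"
abbreviation lookup :: "('x \<Rightarrow>\<^sub>0 'k::zero) \<Rightarrow> 'x \<Rightarrow> 'k" where "lookup \<equiv> Poly_Mapping.lookup"

type_synonym ('n, 'k) planar = "('n \<times> 'n \<times> 'n) ptree list \<Rightarrow>\<^sub>0 'k"
type_synonym ('n, 'k) nonplanar = "('n \<times> 'n \<times> 'n) rtree multiset \<Rightarrow>\<^sub>0 'k"

interpretation lc: Modules.module "scale :: 'k::comm_ring_1 \<Rightarrow> ('x \<Rightarrow>\<^sub>0 'k) \<Rightarrow> ('x \<Rightarrow>\<^sub>0 'k)"
  by standard (simp_all add: scale_add scale_left_add scale_scale)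

lemma lin_ext_neg: "lin_ext f (- p) = - lin_ext f p"
  by (metis lin_ext_0 lin_ext_add add_eq_0_iff2 add.right_inverse)

lemma lin_ext_diff: "lin_ext f (p - q) = lin_ext f p - lin_ext f q"
  using lin_ext_add[of f p "- q"] by (simp add: lin_ext_neg)

lemma lin_ext_sum: "lin_ext f (sum g I) = (\<Sum>i\<in>I. lin_ext f (g i))"
  by (induction I rule: infinite_finite_induct) (simp_all add: lin_ext_add)

lemma lin_ext_cong: "(\<And>x. x \<in> keys p \<Longrightarrow> f x = g x) \<Longrightarrow> lin_ext f p = lin_ext g p"
  unfolding lin_ext_def by (rule sum.cong) simp_all

lemma lin_ext_basis: "lin_ext basis p = p"
  by (induction p rule: lin_combination_induct) (simp_all add: lin_ext_add scale_single)

lemma lin_ext_id_on: "(\<And>x. x \<in> keys p \<Longrightarrow> f x = basis x) \<Longrightarrow> lin_ext f p = p"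
  using lin_ext_cong[of p f basis] by (simp add: lin_ext_basis)

lemma lin_ext_zero_fun [simp]: "lin_ext (\<lambda>x. 0) p = 0"
  by (simp add: lin_ext_def)

lemma lin_ext_scale_fun: "lin_ext (\<lambda>x. scale c (f x)) p = scale c (lin_ext f p)"
  by (induction p rule: lin_combination_induct) (simp_all add: lin_ext_add scale_add scale_scale mult.commute)

lemma lin_ext_minus_fun: "lin_ext (\<lambda>x. f x - g x) p = lin_ext f p - lin_ext g p"
  using lin_ext_plus[of "\<lambda>x. f x - g x" g p] by (simp add: algebra_simps)

lemma lin_ext_swap:
  "lin_ext (\<lambda>m. lin_ext (\<lambda>n. f m n) q) p = lin_ext (\<lambda>n. lin_ext (\<lambda>m. f m n) p) q"
  by (induction p rule: lin_combination_induct) (simp_all add: lin_ext_add lin_ext_plus lin_ext_scale_fun)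

lemma basis_induct [case_names zero add]:
  fixes p :: "'x \<Rightarrow>\<^sub>0 'k::comm_ring_1"
  assumes "P 0" and "\<And>x c p. P p \<Longrightarrow> P (scale c (basis x) + p)"
  shows "P p"
  by (induction p rule: lin_combination_induct) (use assms in \<open>simp_all add: scale_single\<close>)

lemma lin_ext_mult_split:
  fixes p q :: "'m::monoid_add \<Rightarrow>\<^sub>0 'k::comm_ring_1"
  assumes "\<And>m n. f (m + n) = g m * h n"
  shows "lin_ext f (p * q) = lin_ext g p * lin_ext h q"
proof (induction p rule: basis_induct)
  case (add m c p)
  have "lin_ext f (basis m * q) = g m * lin_ext h q"
    by (induction q rule: basis_induct)
      (simp_all add: distrib_left lin_ext_add lin_ext_scale assms scale_mult mult_single)
  with add show ?case
    by (simp add: distrib_right lin_ext_add lin_ext_scale scale_mult)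
qed simp

lemma lin_ext_mult_right: "lin_ext (\<lambda>x. f x * c) p = lin_ext f p * c"
  for c :: "'m::monoid_add \<Rightarrow>\<^sub>0 'k::comm_ring_1"
  by (induction p rule: lin_combination_induct) (simp_all add: lin_ext_add distrib_right scale_mult)

lemma lin_ext_mult_left: "lin_ext (\<lambda>x. c * f x) p = c * lin_ext f p"
  for c :: "'m::monoid_add \<Rightarrow>\<^sub>0 'k::comm_ring_1"
  by (induction p rule: lin_combination_induct) (simp_all add: lin_ext_add distrib_left scale_mult)

lemma lin_ext_one [simp]: "lin_ext f 1 = f 0"
  by (simp flip: single_one)

lemma lin_ext_prod_list:
  assumes "\<And>m n. f (m + n) = f m * f n" "f 0 = 1"
  shows "lin_ext f (prod_list xs) = prod_list (map (lin_ext f) xs)"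
  by (induction xs) (simp_all add: lin_ext_mult assms flip: single_one)

lemma keys_scale: "keys (scale c p) \<subseteq> keys p"
  by (auto simp: in_keys_iff)

lemma keys_lin_ext: "keys (lin_ext f p) \<subseteq> (\<Union>x\<in>keys p. keys (f x))"
  unfolding lin_ext_def using keys_sum keys_scale by fastforce

lemma keys_lin_ext_subset:
  "(\<And>x. x \<in> keys p \<Longrightarrow> keys (f x) \<subseteq> N) \<Longrightarrow> keys (lin_ext f p) \<subseteq> N"
  using keys_lin_ext[of f p] by blast

lemma keys_add_subset:
  "keys p \<subseteq> N \<Longrightarrow> keys q \<subseteq> N \<Longrightarrow> keys (p + q) \<subseteq> N"
  using keys_add[of p q] by blast

lemma keys_mult_subset:
  "keys p \<subseteq> N \<Longrightarrow> keys q \<subseteq> N \<Longrightarrow> (\<And>a b. a \<in> N \<Longrightarrow> b \<in> N \<Longrightarrow> a + b \<in> N) \<Longrightarrow>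
   keys (p * q) \<subseteq> N"
  using keys_mult[of p q] by blast

lemma keys_sum_subset:
  "(\<And>i. i \<in> I \<Longrightarrow> keys (f i) \<subseteq> N) \<Longrightarrow> keys (sum f I) \<subseteq> N"
  using keys_sum[of f I] by blast

lemma lin_combination_induct_on [consumes 1, case_names zero add]:
  fixes p :: "'x \<Rightarrow>\<^sub>0 'k::comm_ring_1"
  assumes "keys p \<subseteq> N" and "P 0"
    and "\<And>x c p. x \<in> N \<Longrightarrow> keys p \<subseteq> N \<Longrightarrow> P p \<Longrightarrow> P (Poly_Mapping.single x c + p)"
  shows "P p"
  using assms(1)
proof (induction p rule: update_induct)
  case const
  show ?case by (rule assms(2))
next
  case (update f a b)
  then have "a \<in> N" "keys f \<subseteq> N"
    by (auto simp: keys_update)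
  with update show ?case
    by (simp add: update_eq_plus assms(3))
qed

lemma lin_ext_diff_in_span:
  assumes "\<And>x. x \<in> keys p \<Longrightarrow> f x - g x \<in> lc.span V"
  shows "lin_ext f p - lin_ext g p \<in> lc.span V"
proof -
  have "lin_ext (\<lambda>x. f x - g x) p \<in> lc.span V"
    unfolding lin_ext_def by (intro lc.span_sum lc.span_scale assms)
  then show ?thesis
    by (simp add: lin_ext_minus_fun)
qed

text \<open>As \<open>tensor\<close>, but the two factors may live over different monoids, so that it can be iterated.\<close>

definition tens :: "('a \<Rightarrow>\<^sub>0 'k) \<Rightarrow> ('b \<Rightarrow>\<^sub>0 'k) \<Rightarrow> ('a \<times> 'b \<Rightarrow>\<^sub>0 'k::comm_ring_1)" where
  "tens p q = lin_ext (\<lambda>m. lin_ext (\<lambda>n. basis (m, n)) q) p"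

lemma tensor_eq_tens: "tensor p q = tens p q"
  by (simp add: tensor_def tens_def)

lemma tens_basis [simp]: "tens (basis m) (basis n) = basis (m, n)"
  by (simp add: tens_def)

lemma tens_simps:
  "tens 0 q = 0" "tens p 0 = 0"
  "tens (p + p') q = tens p q + tens p' q"
  "tens p (q + q') = tens p q + tens p q'"
  "tens (scale c p) q = scale c (tens p q)"
  "tens p (scale c q) = scale c (tens p q)"
  by (simp_all add: tens_def lin_ext_add lin_ext_plus lin_ext_scale lin_ext_scale_fun)

lemma tens_sum: "tens (sum f I) q = (\<Sum>i\<in>I. tens (f i) q)" "tens p (sum f I) = (\<Sum>i\<in>I. tens p (f i))"
  by (induction I rule: infinite_finite_induct) (simp_all add: tens_simps)

lemma tens_lin_ext:
  "tens (lin_ext f p) q = lin_ext (\<lambda>m. tens (f m) q) p"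
  "tens p (lin_ext g q) = lin_ext (\<lambda>n. tens p (g n)) q"
  by (simp_all add: tens_def lin_ext_lin_ext) (subst lin_ext_swap, simp)

lemma lin_ext_tens: "lin_ext f (tens p q) = lin_ext (\<lambda>m. lin_ext (\<lambda>n. f (m, n)) q) p"
  by (simp add: tens_def lin_ext_lin_ext)

lemma tens_mult: "tens p q * tens p' q' = tens (p * p') (q * q')"
  for p p' :: "'a::monoid_add \<Rightarrow>\<^sub>0 'k::comm_ring_1" and q q' :: "'b::monoid_add \<Rightarrow>\<^sub>0 'k"
proof -
  have *: "basis (m, n) * tens p' q' = tens (basis m * p') (basis n * q')" for m :: 'a and n :: 'b
  proof (induction p' rule: basis_induct)
    case (add m' c p')
    have "basis (m, n) * tens (basis m') q' = tens (basis m * basis m') (basis n * q')"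
      by (induction q' rule: basis_induct) (simp_all add: tens_simps distrib_left mult_single scale_mult)
    with add show ?case
      by (simp add: tens_simps distrib_left scale_mult)
  qed (simp add: tens_simps)
  show ?thesis
  proof (induction p rule: basis_induct)
    case (add m c p)
    have "tens (basis m) q * tens p' q' = tens (basis m * p') (q * q')"
      by (induction q rule: basis_induct) (simp_all add: tens_simps distrib_right scale_mult *)
    with add show ?case
      by (simp add: tens_simps distrib_right scale_mult)
  qed (simp add: tens_simps)
qed

lemma tens_one: "tens 1 1 = 1"
  by (simp flip: single_one add: zero_prod_def)

lemma keys_tens: "keys (tens p q) \<subseteq> keys p \<times> keys q"
  unfolding tens_def by (intro keys_lin_ext_subset) auto

lemma lin_ext_cong_tens:
  assumes "\<And>a b. (a, b) \<in> keys t \<Longrightarrow> f a b = g a b"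
  shows "lin_ext (\<lambda>(a, b). f a b) t = lin_ext (\<lambda>(a, b). g a b) t"
  using assms by (intro lin_ext_cong) auto

text \<open>The linear map \<open>\<phi> \<otimes> \<psi>\<close>, where \<open>\<phi>\<close> and \<open>\<psi>\<close> are given by their values on basis elements.\<close>

definition map_tens :: "('a \<Rightarrow> ('c \<Rightarrow>\<^sub>0 'k)) \<Rightarrow> ('b \<Rightarrow> ('d \<Rightarrow>\<^sub>0 'k)) \<Rightarrow> ('a \<times> 'b \<Rightarrow>\<^sub>0 'k) \<Rightarrow> ('c \<times> 'd \<Rightarrow>\<^sub>0 'k::comm_ring_1)"
  where "map_tens \<phi> \<psi> t = lin_ext (\<lambda>(a, b). tens (\<phi> a) (\<psi> b)) t"

lemma map_tens_tens: "map_tens \<phi> \<psi> (tens p q) = tens (lin_ext \<phi> p) (lin_ext \<psi> q)"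
  by (simp add: map_tens_def lin_ext_tens tens_lin_ext, subst lin_ext_swap, rule refl)

lemma map_tens_add: "map_tens \<phi> \<psi> (s + t) = map_tens \<phi> \<psi> s + map_tens \<phi> \<psi> t"
  by (simp add: map_tens_def lin_ext_add)

lemma map_tens_sum: "map_tens \<phi> \<psi> (sum f I) = (\<Sum>i\<in>I. map_tens \<phi> \<psi> (f i))"
  by (simp add: map_tens_def lin_ext_sum)

lemma map_tens_basis [simp]: "map_tens \<phi> \<psi> (basis (a, b)) = tens (\<phi> a) (\<psi> b)"
  by (simp add: map_tens_def)

lemma map_tens_mult:
  fixes \<phi> :: "'a::monoid_add \<Rightarrow> ('c::monoid_add \<Rightarrow>\<^sub>0 'k::comm_ring_1)"
    and \<psi> :: "'b::monoid_add \<Rightarrow> ('d::monoid_add \<Rightarrow>\<^sub>0 'k)"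
  assumes "\<And>m n. \<phi> (m + n) = \<phi> m * \<phi> n" "\<And>m n. \<psi> (m + n) = \<psi> m * \<psi> n"
  shows "map_tens \<phi> \<psi> (s * t) = map_tens \<phi> \<psi> s * map_tens \<phi> \<psi> t"
  unfolding map_tens_def by (rule lin_ext_mult) (auto simp: assms tens_mult)

lemma map_tens_map_tens:
  "map_tens \<phi> \<psi> (map_tens \<phi>' \<psi>' t) = map_tens (\<lambda>a. lin_ext \<phi> (\<phi>' a)) (\<lambda>b. lin_ext \<psi> (\<psi>' b)) t"
  unfolding map_tens_def[of \<phi>' \<psi>'] map_tens_def[of "\<lambda>a. lin_ext \<phi> (\<phi>' a)"]
  by (simp add: map_tens_def lin_ext_lin_ext lin_ext_tens tens_lin_ext case_prod_unfold,
      subst lin_ext_swap, rule refl)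

lemma map_tens_id_on:
  assumes "\<And>a b. (a, b) \<in> keys t \<Longrightarrow> \<phi> a = basis a \<and> \<psi> b = basis b"
  shows "map_tens \<phi> \<psi> t = t"
  unfolding map_tens_def using assms by (intro lin_ext_id_on) auto

lemma lin_ext_map_tens:
  "lin_ext (\<lambda>(c, d). f c d) (map_tens \<phi> \<psi> t) = lin_ext (\<lambda>(a, b). lin_ext (\<lambda>c. lin_ext (\<lambda>d. f c d) (\<psi> b)) (\<phi> a)) t"
  by (simp add: map_tens_def lin_ext_lin_ext lin_ext_tens case_prod_unfold)

section \<open>Convolution and antipodes\<close>

lemma lin_ext_unit: "lin_ext (\<lambda>m. if m = 0 then 1 else 0) x = scale (lookup x 0) 1"
proof (induction x rule: basis_induct)
  case (add m c p)
  then show ?case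
    by (simp add: lin_ext_add lin_ext_scale lookup_add lookup_single when_def scale_left_add)
qed simp

lemma lin_ext_counit_left:
  fixes p :: "'m::monoid_add \<Rightarrow>\<^sub>0 'k::comm_ring_1"
  shows "lin_ext (\<lambda>m. lin_ext (\<lambda>n. if m = 0 then basis n else 0) q) p = scale (lookup p 0) q"
proof (induction p rule: basis_induct)
  case (add m c p)
  then show ?case
    by (cases "m = 0") (simp_all add: lin_ext_add lin_ext_scale lookup_add lookup_single lookup_one scale_left_add lin_ext_basis)
qed simp

lemma lin_ext_counit_right:
  fixes q :: "'m::monoid_add \<Rightarrow>\<^sub>0 'k::comm_ring_1"
  shows "lin_ext (\<lambda>m. lin_ext (\<lambda>n. if n = 0 then basis m else 0) q) p = scale (lookup q 0) p"
  by (subst lin_ext_swap) (rule lin_ext_counit_left)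

lemma lookup_zero_mult:
  fixes p q :: "'m::monoid_add \<Rightarrow>\<^sub>0 'k::comm_ring_1"
  assumes "\<And>m n :: 'm. m + n = 0 \<Longrightarrow> m = 0 \<and> n = 0"
  shows "lookup (p * q) 0 = lookup p 0 * lookup q 0"
proof (induction p rule: basis_induct)
  case (add m c p)
  have "lookup (basis m * q) 0 = lookup (basis m) 0 * lookup q 0"
  proof (induction q rule: basis_induct)
    case (add n d q)
    then show ?case
      using assms[of m n]
      by (auto simp: distrib_left lookup_add lookup_single when_def scale_mult mult_single split: if_splits)
  qed simp
  with add show ?case
    by (simp add: distrib_right lookup_add scale_mult)
qed simp

abbreviation "comult_left c x \<equiv> lin_ext (\<lambda>(a, b). lin_ext (\<lambda>(a', a''). basis (a', a'', b)) (c a)) (c x)"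
abbreviation "comult_right c x \<equiv> lin_ext (\<lambda>(a, b). lin_ext (\<lambda>(b', b''). basis (a, b', b'')) (c b)) (c x)"

text \<open>A bialgebra structure, with coproduct \<open>\<delta>\<close> on monomials, on the span of a submonoid \<open>M\<close> of \<open>'m\<close>.
  By the last assumption the coproduct of \<open>m\<close> is \<open>m \<otimes> 1\<close> plus terms whose left factor has smaller
  weight. This form of connectedness makes recursion in the left factor possible, and it yields the
  antipode.\<close>

locale filtered_bialg =
  fixes M :: "'m::monoid_add set"
    and \<delta> :: "'m \<Rightarrow> ('m \<times> 'm \<Rightarrow>\<^sub>0 'k::field)"
    and wt :: "'m \<Rightarrow> nat"
  assumes zero_in: "0 \<in> M"
    and add_in: "\<lbrakk>m \<in> M; n \<in> M\<rbrakk> \<Longrightarrow> m + n \<in> M"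
    and zero_sum: "m + n = (0::'m) \<Longrightarrow> m = 0 \<and> n = 0"
    and coprod_zero: "\<delta> 0 = 1"
    and coprod_add: "\<delta> (m + n) = \<delta> m * \<delta> n"
    and coprod_keys: "m \<in> M \<Longrightarrow> keys (\<delta> m) \<subseteq> M \<times> M"
    and coprod_coassoc: "m \<in> M \<Longrightarrow>
      comult_left \<delta> m =
      comult_right \<delta> m"
    and coprod_counit_left: "m \<in> M \<Longrightarrow> lin_ext (\<lambda>(a, b). if a = 0 then basis b else 0) (\<delta> m) = basis m"
    and coprod_counit_right: "m \<in> M \<Longrightarrow> lin_ext (\<lambda>(a, b). if b = 0 then basis a else 0) (\<delta> m) = basis m"
    and coprod_low: "\<lbrakk>m \<in> M; (a, b) \<in> keys (\<delta> m - basis (m, 0))\<rbrakk> \<Longrightarrow> wt a < wt m"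
begin

text \<open>The convolution product of two linear maps from the bialgebra to an algebra; linear maps are given
  by their values on monomials.\<close>

definition conv :: "('m \<Rightarrow> ('x::monoid_add \<Rightarrow>\<^sub>0 'k)) \<Rightarrow> ('m \<Rightarrow> ('x \<Rightarrow>\<^sub>0 'k)) \<Rightarrow> 'm \<Rightarrow> ('x \<Rightarrow>\<^sub>0 'k)" where
  "conv p q m = lin_ext (\<lambda>(a, b). p a * q b) (\<delta> m)"

definition conv_unit :: "'m \<Rightarrow> ('x::monoid_add \<Rightarrow>\<^sub>0 'k)" where
  "conv_unit m = (if m = 0 then 1 else 0)"

lemma conv_cong:
  assumes "m \<in> M" "\<And>a. a \<in> M \<Longrightarrow> p a = p' a" "\<And>a. a \<in> M \<Longrightarrow> q a = q' a"
  shows "conv p q m = conv p' q' m"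
  unfolding conv_def using coprod_keys[OF assms(1)] assms(2,3)
  by (intro lin_ext_cong_tens) (auto simp: subset_iff)

lemma conv_assoc:
  assumes "m \<in> M"
  shows "conv (conv p q) r m = conv p (conv q r) m"
proof -
  have "conv (conv p q) r m = lin_ext (\<lambda>(a, b, c). p a * q b * r c)
      (comult_left \<delta> m)"
    by (simp add: conv_def lin_ext_lin_ext case_prod_unfold lin_ext_mult_right)
  also have "\<dots> = conv p (conv q r) m"
    unfolding coprod_coassoc[OF assms]
    by (simp add: conv_def lin_ext_lin_ext case_prod_unfold lin_ext_mult_left mult.assoc)
  finally show ?thesis .
qed

lemma conv_unit_left:
  assumes "m \<in> M"
  shows "conv conv_unit q m = q m"
proof -
  have "conv conv_unit q m = lin_ext q (lin_ext (\<lambda>(a, b). if a = 0 then basis b else 0) (\<delta> m))"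
    unfolding conv_def lin_ext_lin_ext by (intro lin_ext_cong) (auto simp: conv_unit_def)
  then show ?thesis
    by (simp add: coprod_counit_left[OF assms])
qed

lemma conv_unit_right:
  assumes "m \<in> M"
  shows "conv p conv_unit m = p m"
proof -
  have "conv p conv_unit m = lin_ext p (lin_ext (\<lambda>(a, b). if b = 0 then basis a else 0) (\<delta> m))"
    unfolding conv_def lin_ext_lin_ext by (intro lin_ext_cong) (auto simp: conv_unit_def)
  then show ?thesis
    by (simp add: coprod_counit_right[OF assms])
qed

text \<open>As in any monoid, \<open>p = p * (q * r) = (p * q) * r = r\<close>.\<close>

lemma conv_inverse_unique:
  assumes "\<And>m. m \<in> M \<Longrightarrow> conv p q m = conv_unit m" "\<And>m. m \<in> M \<Longrightarrow> conv q r m = conv_unit m" "m \<in> M"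
  shows "p m = r m"
proof -
  have "p m = conv p (conv q r) m"
    using conv_cong[of m p p "conv q r" conv_unit] assms by (simp add: conv_unit_right)
  also have "\<dots> = conv (conv p q) r m"
    using assms by (simp add: conv_assoc)
  also have "\<dots> = r m"
    using conv_cong[of m "conv p q" conv_unit r r] assms by (simp add: conv_unit_left)
  finally show ?thesis .
qed

lemma coprod_eq: "\<delta> m = basis (m, 0) + (\<delta> m - basis (m, 0))"
  by simp

lemma keys_coprod_cases:
  assumes "m \<in> M" "(a, b) \<in> keys (\<delta> m)"
  shows "a = m \<and> b = 0 \<or> wt a < wt m"
proof -
  have "(a, b) \<in> keys (basis (m, 0) :: _ \<Rightarrow>\<^sub>0 'k) \<union> keys (\<delta> m - basis (m, 0))"
    using assms(2) keys_add[of "basis (m, 0)" "\<delta> m - basis (m, 0)"] by auto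
  then show ?thesis
    using coprod_low[OF assms(1)] by auto
qed

text \<open>For inductions on the weight, where all terms of the coproduct but \<open>m \<otimes> 1\<close> vanish.\<close>

lemma lin_ext_coprod_low:
  assumes "m \<in> M" "\<And>a b. (a, b) \<in> keys (\<delta> m) \<Longrightarrow> wt a < wt m \<Longrightarrow> g a b = 0"
  shows "lin_ext (\<lambda>(a, b). g a b) (\<delta> m) = g m 0"
proof -
  let ?R = "\<delta> m - basis (m, 0)"
  have low: "(a, b) \<in> keys (\<delta> m) \<and> wt a < wt m" if "(a, b) \<in> keys ?R" for a b
  proof -
    have *: "wt a < wt m"
      using coprod_low[OF assms(1) that] .
    then have "(a, b) \<noteq> (m, 0)" by auto
    with that have "(a, b) \<in> keys (\<delta> m)"
      by (auto simp: in_keys_iff lookup_minus lookup_single when_def)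
    with * show ?thesis by simp
  qed
  have "lin_ext (\<lambda>(a, b). g a b) (\<delta> m) = g m 0 + lin_ext (\<lambda>(a, b). g a b) ?R"
    by (subst coprod_eq) (simp only: lin_ext_add lin_ext_single scale_1 prod.case)
  also have "lin_ext (\<lambda>(a, b). g a b) ?R = lin_ext (\<lambda>_. 0) ?R"
    using low assms(2) by (intro lin_ext_cong) auto
  finally show ?thesis by simp
qed

text \<open>A left convolution inverse of \<open>q\<close> if \<open>q 0 = 1\<close>. The term \<open>m \<otimes> 1\<close> of the coproduct contributes \<open>p m\<close> to
  \<open>conv p q m\<close>, and all other terms only involve values of \<open>p\<close> in smaller weight; so the equation
  \<open>conv p q m = 0\<close> for \<open>m \<noteq> 0\<close> can be solved for \<open>p m\<close>.\<close>

function conv_linv :: "('m \<Rightarrow> ('x::monoid_add \<Rightarrow>\<^sub>0 'k)) \<Rightarrow> 'm \<Rightarrow> ('x \<Rightarrow>\<^sub>0 'k)" where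
  "conv_linv q m = (if m = 0 then 1 else
     - (\<Sum>z\<in>{z \<in> keys (\<delta> m). wt (fst z) < wt m}.
         scale (lookup (\<delta> m) z) (conv_linv q (fst z) * q (snd z))))"
  by auto
termination
  by (relation "measure (\<lambda>(q, m). wt m)") auto

declare conv_linv.simps [simp del]

lemma conv_linv_zero [simp]: "conv_linv q 0 = 1"
  by (simp add: conv_linv.simps)

lemma conv_linv:
  assumes "q 0 = 1" "m \<in> M"
  shows "conv (conv_linv q) q m = conv_unit m"
proof (cases "m = 0")
  case True
  then show ?thesis
    by (simp add: conv_def conv_unit_def coprod_zero assms mult_single zero_prod_def flip: single_one)
next
  case False
  let ?g = "\<lambda>a b. if wt a < wt m then conv_linv q a * q b else 0"
  let ?h = "\<lambda>a b. if wt a < wt m then 0 else conv_linv q a * q b"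
  have "conv (conv_linv q) q m = lin_ext (\<lambda>z. (\<lambda>(a, b). ?g a b) z + (\<lambda>(a, b). ?h a b) z) (\<delta> m)"
    unfolding conv_def by (rule lin_ext_cong) auto
  also have "\<dots> = lin_ext (\<lambda>(a, b). ?g a b) (\<delta> m) + lin_ext (\<lambda>(a, b). ?h a b) (\<delta> m)"
    by (rule lin_ext_plus)
  also have "lin_ext (\<lambda>(a, b). ?h a b) (\<delta> m) = conv_linv q m"
    using lin_ext_coprod_low[OF assms(2), of ?h] assms(1) by simp
  also have "lin_ext (\<lambda>(a, b). ?g a b) (\<delta> m) = - conv_linv q m"
    unfolding lin_ext_def conv_linv.simps[of q m] using False
    by (auto simp: case_prod_unfold split: if_splits intro!: sum.mono_neutral_cong_right)
  finally show ?thesis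
    using False by (simp add: conv_unit_def)
qed

lemma conv_linv_keys:
  assumes "0 \<in> N" "\<And>a b. \<lbrakk>a \<in> N; b \<in> N\<rbrakk> \<Longrightarrow> a + b \<in> N" "\<And>m. m \<in> M \<Longrightarrow> keys (q m) \<subseteq> N" "m \<in> M"
  shows "keys (conv_linv q m) \<subseteq> N"
  using assms(4)
proof (induction "wt m" arbitrary: m rule: less_induct)
  case less
  have "keys (\<Sum>z\<in>{z \<in> keys (\<delta> m). wt (fst z) < wt m}.
         scale (lookup (\<delta> m) z) (conv_linv q (fst z) * q (snd z))) \<subseteq> N"
  proof (intro keys_sum_subset order.trans[OF keys_scale] keys_mult_subset assms(2))
    fix z assume z: "z \<in> {z \<in> keys (\<delta> m). wt (fst z) < wt m}"
    then have "fst z \<in> M" "snd z \<in> M"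
      using coprod_keys[OF less.prems] by auto
    then show "keys (conv_linv q (fst z)) \<subseteq> N" "keys (q (snd z)) \<subseteq> N"
      using less.hyps[of "fst z"] z assms(3) by auto
  qed
  then show ?case
    using assms(1) by (subst conv_linv.simps) auto
qed

definition antipode :: "'m \<Rightarrow> ('m \<Rightarrow>\<^sub>0 'k)" where
  "antipode = conv_linv basis"

lemma antipode_left: "m \<in> M \<Longrightarrow> conv antipode basis m = conv_unit m"
  unfolding antipode_def by (rule conv_linv) simp_all

text \<open>The antipode \<open>S\<close> is a left inverse of the identity and has itself a left inverse \<open>T\<close>. Uniqueness
  of inverses, applied to \<open>T\<close>, \<open>S\<close> and the identity, shows that \<open>T\<close> is the identity.\<close>

lemma antipode_right:
  assumes "m \<in> M"
  shows "conv basis antipode m = conv_unit m"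
proof -
  have T: "conv (conv_linv antipode) antipode m = conv_unit m" if "m \<in> M" for m
    using that by (intro conv_linv) (simp_all add: antipode_def)
  have "conv_linv antipode m = basis m" if "m \<in> M" for m
    using conv_inverse_unique[OF T antipode_left that] .
  then show ?thesis
    using T[OF assms] conv_cong[OF assms, of "conv_linv antipode" basis antipode antipode] by simp
qed

lemma antipode_zero: "antipode 0 = 1"
  by (simp add: antipode_def)

lemma antipode_keys: "m \<in> M \<Longrightarrow> keys (antipode m) \<subseteq> M"
  unfolding antipode_def by (rule conv_linv_keys) (auto simp: zero_in add_in)

text \<open>The antipode \<open>S\<close> reverses products. The defect \<open>D a c = S (a c) - S c S a\<close> vanishes in smaller
  weight by induction, so the sum of \<open>D a c b d\<close> over the terms \<open>a \<otimes> b\<close> of \<open>\<Delta> m\<close> and \<open>c \<otimes> d\<close> of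
  \<open>\<Delta> n\<close> is \<open>D m n\<close>. On the other hand \<open>S\<close> is a left convolution inverse of the identity, so this
  sum is \<open>\<epsilon> (m n) - \<epsilon> m \<epsilon> n = 0\<close>.\<close>

lemma antipode_add:
  assumes "m \<in> M" "n \<in> M"
  shows "antipode (m + n) = antipode n * antipode m"
  using assms
proof (induction "wt m + wt n" arbitrary: m n rule: less_induct)
  case less
  define D where "D a c = antipode (a + c) - antipode c * antipode a" for a c
  have keys: "a \<in> M \<and> wt a \<le> wt m" if "(a, b) \<in> keys (\<delta> m)" for a b
    using that coprod_keys[OF less.prems(1)] keys_coprod_cases[OF less.prems(1) that] by auto
  have keys': "c \<in> M \<and> wt c \<le> wt n" if "(c, d) \<in> keys (\<delta> n)" for c d
    using that coprod_keys[OF less.prems(2)] keys_coprod_cases[OF less.prems(2) that] by auto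
  have D0: "D a c = 0" if "wt a + wt c < wt m + wt n" "a \<in> M" "c \<in> M" for a c
    using less.hyps[OF that] by (simp add: D_def)
  have "lin_ext (\<lambda>(a, b). lin_ext (\<lambda>(c, d). D a c * basis (b + d)) (\<delta> n)) (\<delta> m) =
      lin_ext (\<lambda>(c, d). D m c * basis (0 + d)) (\<delta> n)"
  proof (rule lin_ext_coprod_low[OF less.prems(1)])
    fix a b assume ab: "(a, b) \<in> keys (\<delta> m)" "wt a < wt m"
    have "D a c = 0" if "(c, d) \<in> keys (\<delta> n)" for c d
      using keys[OF ab(1)] keys'[OF that] ab(2) by (intro D0) auto
    then have "lin_ext (\<lambda>(c, d). D a c * basis (b + d)) (\<delta> n) = lin_ext (\<lambda>_. 0) (\<delta> n)"
      by (intro lin_ext_cong) auto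
    then show "lin_ext (\<lambda>(c, d). D a c * basis (b + d)) (\<delta> n) = 0"
      by simp
  qed
  also have "\<dots> = D m n * basis (0 + 0)"
  proof (rule lin_ext_coprod_low[OF less.prems(2)])
    fix c d assume cd: "(c, d) \<in> keys (\<delta> n)" "wt c < wt n"
    then have "D m c = 0"
      using less.prems keys'[OF cd(1)] by (intro D0) auto
    then show "D m c * basis (0 + d) = 0" by simp
  qed
  also have "\<dots> = D m n"
    by (simp only: add_0 single_one mult_1_right)
  finally have D: "D m n = lin_ext (\<lambda>(a, b). lin_ext (\<lambda>(c, d). D a c * basis (b + d)) (\<delta> n)) (\<delta> m)" ..
  have *: "D a c * basis (b + d) = antipode (a + c) * basis (b + d) - antipode c * (antipode a * basis b) * basis d"
    for a b c d
    by (simp add: D_def left_diff_distrib mult.assoc mult_single)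
  have "D m n = lin_ext (\<lambda>(a, b). lin_ext (\<lambda>(c, d). antipode (a + c) * basis (b + d)) (\<delta> n)) (\<delta> m)
     - lin_ext (\<lambda>(a, b). lin_ext (\<lambda>(c, d). antipode c * (antipode a * basis b) * basis d) (\<delta> n)) (\<delta> m)"
    unfolding D * by (simp add: case_prod_unfold lin_ext_minus_fun)
  also have "lin_ext (\<lambda>(a, b). lin_ext (\<lambda>(c, d). antipode (a + c) * basis (b + d)) (\<delta> n)) (\<delta> m)
     = lin_ext (\<lambda>(x, y). antipode x * basis y) (\<delta> m * \<delta> n)"
  proof -
    have "lin_ext g (s * t) = lin_ext (\<lambda>z. lin_ext (\<lambda>z'. g (z + z')) t) s"
      for g :: "'m \<times> 'm \<Rightarrow> ('m \<Rightarrow>\<^sub>0 'k)" and s t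
    proof (induction s rule: basis_induct)
      case (add z c s)
      have "lin_ext g (basis z * t) = lin_ext (\<lambda>z'. g (z + z')) t"
        by (induction t rule: basis_induct) (simp_all add: distrib_left lin_ext_add lin_ext_scale scale_mult mult_single)
      with add show ?case
        by (simp add: distrib_right lin_ext_add lin_ext_scale scale_mult)
    qed simp
    then show ?thesis
      by (simp add: case_prod_unfold)
  qed
  also have "\<dots> = conv_unit (m + n)"
    using antipode_left[of "m + n"] less.prems by (simp add: conv_def coprod_add add_in)
  also have "lin_ext (\<lambda>(a, b). lin_ext (\<lambda>(c, d). antipode c * (antipode a * basis b) * basis d) (\<delta> n)) (\<delta> m)
     = lin_ext (\<lambda>(c, d). antipode c * lin_ext (\<lambda>(a, b). antipode a * basis b) (\<delta> m) * basis d) (\<delta> n)"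
    by (simp add: case_prod_unfold) (subst lin_ext_swap, simp add: lin_ext_mult_left lin_ext_mult_right)
  also have "\<dots> = conv_unit m * conv_unit n"
    using antipode_left[OF less.prems(1)] antipode_left[OF less.prems(2)]
    by (cases "m = 0") (simp_all add: conv_def conv_unit_def case_prod_unfold)
  finally have "D m n = conv_unit (m + n) - conv_unit m * conv_unit n" .
  also have "\<dots> = 0"
    using zero_sum[of m n] by (auto simp: conv_unit_def)
  finally show ?case
    by (simp add: D_def)
qed

lemma lin_ext_antipode:
  assumes "\<And>m. m \<in> M \<Longrightarrow> conv p q m = conv_unit m" "keys x \<subseteq> M"
  shows "lin_ext (\<lambda>(a, b). p a * q b) (lin_ext \<delta> x) = scale (lookup x 0) 1"
proof -
  have "lin_ext (\<lambda>(a, b). p a * q b) (lin_ext \<delta> x) = lin_ext (conv p q) x"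
    unfolding lin_ext_lin_ext by (simp add: conv_def[abs_def])
  also have "\<dots> = lin_ext conv_unit x"
    using assms by (intro lin_ext_cong) auto
  also have "\<dots> = scale (lookup x 0) 1"
    unfolding conv_unit_def[abs_def] by (rule lin_ext_unit)
  finally show ?thesis .
qed

end

text \<open>A bialgebra morphism \<open>G\<close> commutes with antipodes \<open>s\<close> and \<open>s'\<close>, because \<open>G \<circ> s\<close> is a left and
  \<open>s' \<circ> G\<close> a right convolution inverse of \<open>G\<close>.\<close>

lemma antipode_hom:
  fixes G :: "'m::monoid_add \<Rightarrow> ('n::monoid_add \<Rightarrow>\<^sub>0 'k::field)" and wt :: "'m \<Rightarrow> nat" and wt' :: "'n \<Rightarrow> nat"
  assumes "filtered_bialg M \<delta> wt" "filtered_bialg M' \<delta>' wt'"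
    and add: "\<And>m n. G (m + n) = G m * G n" and zero: "G 0 = 1"
    and keys: "\<And>m. m \<in> M \<Longrightarrow> keys (G m) \<subseteq> M'"
    and coprod: "\<And>m. m \<in> M \<Longrightarrow> map_tens G G (\<delta> m) = lin_ext \<delta>' (G m)"
    and counit: "\<And>m. m \<in> M \<Longrightarrow> lookup (G m) 0 = (if m = 0 then 1 else 0)"
    and s: "\<And>m. m \<in> M \<Longrightarrow> filtered_bialg.conv \<delta> s basis m = filtered_bialg.conv_unit m"
    and s': "\<And>m. m \<in> M' \<Longrightarrow> filtered_bialg.conv \<delta>' basis s' m = filtered_bialg.conv_unit m"
    and m: "m \<in> M"
  shows "lin_ext G (s m) = lin_ext s' (G m)"
proof -
  interpret A: filtered_bialg M \<delta> wt by fact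
  interpret B: filtered_bialg M' \<delta>' wt' by fact
  have "A.conv (\<lambda>m. lin_ext G (s m)) G m = A.conv_unit m" if "m \<in> M" for m
  proof -
    have "A.conv (\<lambda>m. lin_ext G (s m)) G m = lin_ext G (A.conv s basis m)"
      by (simp add: A.conv_def lin_ext_lin_ext case_prod_unfold lin_ext_mult[of G, OF add])
    then show ?thesis
      using s[OF that] zero by (simp add: A.conv_unit_def flip: single_one)
  qed
  moreover have "A.conv G (\<lambda>m. lin_ext s' (G m)) m = A.conv_unit m" if "m \<in> M" for m
  proof -
    have "A.conv G (\<lambda>m. lin_ext s' (G m)) m = lin_ext (\<lambda>(a, b). basis a * s' b) (map_tens G G (\<delta> m))"
      unfolding lin_ext_map_tens
      by (simp add: A.conv_def lin_ext_mult_left lin_ext_mult_right lin_ext_basis case_prod_unfold)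
    also have "\<dots> = scale (lookup (G m) 0) 1"
      unfolding coprod[OF that] using s' keys[OF that] by (rule B.lin_ext_antipode)
    finally show ?thesis
      using counit[OF that] by (simp add: A.conv_unit_def)
  qed
  ultimately show ?thesis
    using A.conv_inverse_unique[OF _ _ m, of "\<lambda>m. lin_ext G (s m)" G "\<lambda>m. lin_ext s' (G m)"] by simp
qed

section \<open>Hopf algebras in coordinates\<close>

text \<open>If \<open>f\<close> intertwines the coproducts \<open>c\<close> and \<open>d\<close>, then coassociativity of \<open>d\<close> gives coassociativity
  of \<open>c\<close> after application of \<open>f \<otimes> f \<otimes> f\<close>. It is used both to check coassociativity in
  coordinates and, with an injective \<open>f\<close>, to restrict it to a subalgebra.\<close>

lemma coassoc_transport:
  fixes c :: "'a \<Rightarrow> ('a \<times> 'a \<Rightarrow>\<^sub>0 'k::comm_ring_1)" and f :: "'a \<Rightarrow> ('m \<Rightarrow>\<^sub>0 'k)"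
    and d :: "'m \<Rightarrow> ('m \<times> 'm \<Rightarrow>\<^sub>0 'k)"
  assumes c_keys: "\<And>a. a \<in> A \<Longrightarrow> keys (c a) \<subseteq> A \<times> A"
    and f_c: "\<And>a. a \<in> A \<Longrightarrow> lin_ext (\<lambda>(b, c). tens (f b) (f c)) (c a) = lin_ext d (f a)"
    and f_keys: "\<And>a. a \<in> A \<Longrightarrow> keys (f a) \<subseteq> M"
    and coassoc: "\<And>m. m \<in> M \<Longrightarrow>
      comult_left d m =
      comult_right d m"
    and x: "x \<in> A"
  shows "lin_ext (\<lambda>(a, b, c). tens (f a) (tens (f b) (f c)))
      (comult_left c x) =
    lin_ext (\<lambda>(a, b, c). tens (f a) (tens (f b) (f c)))
      (comult_right c x)"
proof -
  let ?ev = "lin_ext (\<lambda>(b, c). tens (f b) (f c))"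
  have ev: "lin_ext (\<lambda>(m, n). \<gamma> m n) (?ev s) = lin_ext (\<lambda>(a, b). lin_ext (\<lambda>m. lin_ext (\<lambda>n. \<gamma> m n) (f b)) (f a)) s"
    for s and \<gamma> :: "'m \<Rightarrow> 'm \<Rightarrow> ('m \<times> 'm \<times> 'm \<Rightarrow>\<^sub>0 'k)"
    by (simp add: lin_ext_lin_ext lin_ext_tens case_prod_unfold)
  have l: "lin_ext (\<lambda>(a', a''). tens (f a') (tens (f a'') (f b))) (c a) =
     lin_ext (\<lambda>m. lin_ext (\<lambda>n. lin_ext (\<lambda>(m', m''). basis (m', m'', n)) (d m)) (f b)) (f a)"
    if "a \<in> A" for a b
  proof -
    let ?F = "\<lambda>(m', m''). lin_ext (\<lambda>n. basis (m', m'', n)) (f b)"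
    have swap: "lin_ext ?F t = lin_ext (\<lambda>n. lin_ext (\<lambda>(m', m''). basis (m', m'', n)) t) (f b)" for t
      by (simp add: case_prod_unfold) (rule lin_ext_swap)
    have "lin_ext (\<lambda>(a', a''). tens (f a') (tens (f a'') (f b))) (c a) = lin_ext ?F (?ev (c a))"
      unfolding ev by (simp add: tens_def lin_ext_lin_ext)
    also have "\<dots> = lin_ext (\<lambda>m. lin_ext ?F (d m)) (f a)"
      by (simp add: f_c that lin_ext_lin_ext)
    finally show ?thesis
      by (simp add: swap)
  qed
  have r: "lin_ext (\<lambda>(b', b''). tens (f a) (tens (f b') (f b''))) (c b) =
     lin_ext (\<lambda>m. lin_ext (\<lambda>n. lin_ext (\<lambda>(n', n''). basis (m, n', n'')) (d n)) (f b)) (f a)"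
    if "b \<in> A" for a b
  proof -
    have "lin_ext (\<lambda>(b', b''). tens (f a) (tens (f b') (f b''))) (c b) = tens (f a) (?ev (c b))"
      by (simp add: tens_lin_ext case_prod_unfold)
    also have "\<dots> = lin_ext (\<lambda>m. lin_ext (\<lambda>n. lin_ext (\<lambda>(n', n''). basis (m, n', n'')) (d n)) (f b)) (f a)"
      unfolding f_c[OF that] by (simp add: lin_ext_lin_ext case_prod_unfold tens_def)
    finally show ?thesis .
  qed
  have "lin_ext (\<lambda>(a, b, c). tens (f a) (tens (f b) (f c)))
      (comult_left c x) =
    lin_ext (\<lambda>(a, b). lin_ext (\<lambda>(a', a''). tens (f a') (tens (f a'') (f b))) (c a)) (c x)"
    by (simp add: lin_ext_lin_ext case_prod_unfold)
  also have "\<dots> = lin_ext (\<lambda>(a, b). lin_ext (\<lambda>m. lin_ext (\<lambda>n. lin_ext (\<lambda>(m', m''). basis (m', m'', n)) (d m)) (f b)) (f a)) (c x)"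
    using c_keys[OF x] by (intro lin_ext_cong_tens l) auto
  also have "\<dots> = lin_ext (\<lambda>(m, n). lin_ext (\<lambda>(m', m''). basis (m', m'', n)) (d m)) (lin_ext d (f x))"
    by (simp add: ev[symmetric] f_c x)
  also have "\<dots> = lin_ext (\<lambda>(m, n). lin_ext (\<lambda>(n', n''). basis (m, n', n'')) (d n)) (lin_ext d (f x))"
    unfolding lin_ext_lin_ext using f_keys[OF x] by (intro lin_ext_cong coassoc) auto
  also have "\<dots> = lin_ext (\<lambda>(a, b). lin_ext (\<lambda>m. lin_ext (\<lambda>n. lin_ext (\<lambda>(n', n''). basis (m, n', n'')) (d n)) (f b)) (f a)) (c x)"
    by (simp add: ev[symmetric] f_c x)
  also have "\<dots> = lin_ext (\<lambda>(a, b). lin_ext (\<lambda>(b', b''). tens (f a) (tens (f b') (f b''))) (c b)) (c x)"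
    using c_keys[OF x] by (intro lin_ext_cong_tens r[symmetric]) auto
  also have "\<dots> = lin_ext (\<lambda>(a, b, c). tens (f a) (tens (f b) (f c)))
      (comult_right c x)"
    by (simp add: lin_ext_lin_ext case_prod_unfold)
  finally show ?thesis .
qed

text \<open>An algebra \<open>H\<close> together with an isomorphism \<open>f\<close> onto the span of \<open>M\<close> which takes its coproduct to
  \<open>\<delta>\<close> and its counit to the coefficient of \<open>0\<close>. The tensors of \<open>H\<close>, which are formal
  combinations of pairs modulo the bilinearity relations, then become elements of the monoid algebra
  of \<open>M \<times> M\<close>, where equality is plain equality. The locale covers the three Hopf algebras given on
  monoid algebras, with \<open>f\<close> the identity, as well as the abelianization, whose elements are cosets.\<close>

locale coordinates = filtered_bialg M \<delta> wt
  for M :: "'m::monoid_add set" and \<delta> :: "'m \<Rightarrow> ('m \<times> 'm \<Rightarrow>\<^sub>0 'k::field)" and wt :: "'m \<Rightarrow> nat" +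
  fixes H :: "('k, 'a, 'z) bialg_scheme" (structure) and f :: "'a \<Rightarrow> ('m \<Rightarrow>\<^sub>0 'k)"
  assumes f_bij: "bij_betw f (carrier H) {x. keys x \<subseteq> M}"
    and zero_closed: "\<zero> \<in> carrier H" and f_zero: "f \<zero> = 0"
    and one_closed: "\<one> \<in> carrier H" and f_one: "f \<one> = 1"
    and add_closed: "\<lbrakk>a \<in> carrier H; b \<in> carrier H\<rbrakk> \<Longrightarrow> a \<oplus> b \<in> carrier H"
    and f_add: "\<lbrakk>a \<in> carrier H; b \<in> carrier H\<rbrakk> \<Longrightarrow> f (a \<oplus> b) = f a + f b"
    and mult_closed: "\<lbrakk>a \<in> carrier H; b \<in> carrier H\<rbrakk> \<Longrightarrow> a \<otimes> b \<in> carrier H"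
    and f_mult: "\<lbrakk>a \<in> carrier H; b \<in> carrier H\<rbrakk> \<Longrightarrow> f (a \<otimes> b) = f a * f b"
    and smult_closed: "a \<in> carrier H \<Longrightarrow> c \<odot> a \<in> carrier H"
    and f_smult: "a \<in> carrier H \<Longrightarrow> f (c \<odot> a) = scale c (f a)"
    and comult_keys: "a \<in> carrier H \<Longrightarrow> keys (comult H a) \<subseteq> carrier H \<times> carrier H"
    and f_comult: "a \<in> carrier H \<Longrightarrow> lin_ext (\<lambda>(b, c). tens (f b) (f c)) (comult H a) = lin_ext \<delta> (f a)"
    and f_counit: "a \<in> carrier H \<Longrightarrow> counit H a = lookup (f a) 0"
begin

lemma comult_keysD:
  "\<lbrakk>(b, c) \<in> keys (comult H a); a \<in> carrier H\<rbrakk> \<Longrightarrow> b \<in> carrier H"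
  "\<lbrakk>(b, c) \<in> keys (comult H a); a \<in> carrier H\<rbrakk> \<Longrightarrow> c \<in> carrier H"
  using comult_keys[of a] by auto

definition h :: "('m \<Rightarrow>\<^sub>0 'k) \<Rightarrow> 'a" where "h = inv_into (carrier H) f"

lemma f_keys: "a \<in> carrier H \<Longrightarrow> keys (f a) \<subseteq> M"
  using bij_betwE[OF f_bij] by auto

lemma h_closed: "keys x \<subseteq> M \<Longrightarrow> h x \<in> carrier H"
  and f_h: "keys x \<subseteq> M \<Longrightarrow> f (h x) = x"
  using f_bij by (auto simp: h_def bij_betw_def intro!: inv_into_into f_inv_into_f)

lemma f_inj: "\<lbrakk>f a = f b; a \<in> carrier H; b \<in> carrier H\<rbrakk> \<Longrightarrow> a = b"
  using f_bij by (auto simp: bij_betw_def dest: inj_onD)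

lemma h_f: "a \<in> carrier H \<Longrightarrow> h (f a) = a"
  by (simp add: f_inj f_h f_keys h_closed)

lemma h_eqI: "\<lbrakk>a \<in> carrier H; f a = x\<rbrakk> \<Longrightarrow> h x = a"
  using h_f by auto

lemma keys_basis: "m \<in> M \<Longrightarrow> keys (basis m :: 'm \<Rightarrow>\<^sub>0 'k) \<subseteq> M"
  by simp

text \<open>The map \<open>f \<otimes> f\<close>, from formal combinations of pairs.\<close>

definition ev2 :: "('a \<times> 'a \<Rightarrow>\<^sub>0 'k) \<Rightarrow> ('m \<times> 'm \<Rightarrow>\<^sub>0 'k)" where
  "ev2 = lin_ext (\<lambda>(a, b). tens (f a) (f b))"

lemma lin_ext_ev2: "lin_ext (\<lambda>(m, n). \<gamma> m n) (ev2 s) =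
    lin_ext (\<lambda>(a, b). lin_ext (\<lambda>m. lin_ext (\<lambda>n. \<gamma> m n) (f b)) (f a)) s"
  by (simp add: ev2_def lin_ext_lin_ext lin_ext_tens case_prod_unfold)

text \<open>In each slot \<open>\<iota>\<close> of a tensor, the relations allow an element to be expanded in the basis of \<open>H\<close> that
  corresponds to the monomials.\<close>

lemma rels_coordinates:
  assumes "keys x \<subseteq> M"
  shows "basis (\<iota> (h x)) - lin_ext (\<lambda>m. basis (\<iota> (h (basis m)))) x \<in> lc.span (lin_rels H \<iota>)"
  using assms
proof (induction x rule: lin_combination_induct_on)
  case zero
  have 1: "h 0 = \<zero>"
    by (rule h_eqI) (simp_all add: zero_closed f_zero)
  have 2: "0 \<odot> \<zero> = \<zero>"
    by (rule f_inj) (simp_all add: zero_closed smult_closed f_zero f_smult)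
  have "basis (\<iota> (0 \<odot> \<zero>)) - Poly_Mapping.single (\<iota> \<zero>) 0 \<in> lin_rels H \<iota>"
    unfolding lin_rels_def using zero_closed by blast
  then show ?case
    using 1 2 by (simp add: lc.span_base)
next
  case (add m c p)
  let ?u = "h (basis m)" and ?v = "h p"
  have u: "?u \<in> carrier H" and v: "?v \<in> carrier H"
    using add by (auto intro: h_closed)
  have eq: "h (Poly_Mapping.single m c + p) = (c \<odot> ?u) \<oplus> ?v"
    using u v add by (intro h_eqI) (simp_all add: add_closed smult_closed f_add f_smult f_h scale_single)
  have "basis (\<iota> (c \<odot> ?u \<oplus> ?v)) - basis (\<iota> (c \<odot> ?u)) - basis (\<iota> ?v) \<in> lc.span (lin_rels H \<iota>)"
    using u v smult_closed by (intro lc.span_base) (unfold lin_rels_def, blast)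
  moreover have "basis (\<iota> (c \<odot> ?u)) - Poly_Mapping.single (\<iota> ?u) c \<in> lc.span (lin_rels H \<iota>)"
    using u by (intro lc.span_base) (unfold lin_rels_def, blast)
  ultimately have "(basis (\<iota> (c \<odot> ?u \<oplus> ?v)) - basis (\<iota> (c \<odot> ?u)) - basis (\<iota> ?v)) +
      (basis (\<iota> (c \<odot> ?u)) - Poly_Mapping.single (\<iota> ?u) c) +
      (basis (\<iota> ?v) - lin_ext (\<lambda>m. basis (\<iota> (h (basis m)))) p) \<in> lc.span (lin_rels H \<iota>)"
    by (intro lc.span_add add.IH)
  then show ?case
    unfolding eq by (simp add: lin_ext_add scale_single algebra_simps)
qed

abbreviation "rels2 \<equiv> \<Union>b\<in>carrier H. lin_rels H (\<lambda>a. (a, b)) \<union> lin_rels H (\<lambda>a. (b, a))"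

abbreviation "rels3 \<equiv> \<Union>b\<in>carrier H. \<Union>c\<in>carrier H.
        lin_rels H (\<lambda>a. (a, b, c)) \<union> lin_rels H (\<lambda>a. (b, a, c)) \<union> lin_rels H (\<lambda>a. (b, c, a))"

lemma teq2_imp_ev2:
  assumes "teq2 H s t"
  shows "ev2 s = ev2 t"
proof -
  have "ev2 x = 0" if "x \<in> lc.span rels2" for x
    using that
  proof (induction rule: lc.span_induct_alt)
    case (step c x y)
    have "ev2 x = 0"
      using step(1) by (auto simp: lin_rels_def ev2_def lin_ext_diff f_add f_smult tens_simps)
    then show ?case
      using step by (simp add: ev2_def lin_ext_add lin_ext_scale)
  qed (simp add: ev2_def)
  from this[of "s - t"] assms show ?thesis
    by (simp add: teq2_def ev2_def lin_ext_diff)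
qed

text \<open>Expanding both slots, every formal combination \<open>s\<close> becomes equivalent to one that is determined by
  \<open>ev2 s\<close>.\<close>

lemma ev2_imp_teq2:
  assumes "ev2 s = ev2 t"
    and "keys s \<subseteq> carrier H \<times> carrier H" "keys t \<subseteq> carrier H \<times> carrier H"
  shows "teq2 H s t"
proof -
  let ?N = "lin_ext (\<lambda>(m, n). basis (h (basis m), h (basis n)))"
  have "basis (a, b) - ?N (tens (f a) (f b)) \<in> lc.span rels2" if a: "a \<in> carrier H" and b: "b \<in> carrier H" for a b
  proof -
    have "basis (h (f a), b) - lin_ext (\<lambda>m. basis (h (basis m), b)) (f a) \<in> lc.span rels2"
      using rels_coordinates[OF f_keys[OF a], of "\<lambda>a. (a, b)"] b
      by (rule_tac subsetD[OF lc.span_mono]) auto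
    moreover have "lin_ext (\<lambda>m. basis (h (basis m), h (f b))) (f a) -
        lin_ext (\<lambda>m. lin_ext (\<lambda>n. basis (h (basis m), h (basis n))) (f b)) (f a) \<in> lc.span rels2"
    proof (rule lin_ext_diff_in_span)
      fix m assume "m \<in> keys (f a)"
      then have "h (basis m) \<in> carrier H"
        using f_keys[OF a] by (intro h_closed keys_basis) auto
      then show "basis (h (basis m), h (f b)) - lin_ext (\<lambda>n. basis (h (basis m), h (basis n))) (f b) \<in> lc.span rels2"
        using rels_coordinates[OF f_keys[OF b], of "\<lambda>c. (h (basis m), c)"]
        by (rule_tac subsetD[OF lc.span_mono]) auto
    qed
    ultimately have "(basis (h (f a), b) - lin_ext (\<lambda>m. basis (h (basis m), b)) (f a)) +
      (lin_ext (\<lambda>m. basis (h (basis m), h (f b))) (f a) -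
        lin_ext (\<lambda>m. lin_ext (\<lambda>n. basis (h (basis m), h (basis n))) (f b)) (f a)) \<in> lc.span rels2"
      by (rule lc.span_add)
    then show ?thesis
      using a b by (simp add: h_f lin_ext_tens)
  qed
  note * = this
  have *: "s - ?N (ev2 s) \<in> lc.span rels2" if "keys s \<subseteq> carrier H \<times> carrier H" for s
  proof -
    have "lin_ext basis s - lin_ext (\<lambda>(a, b). ?N (tens (f a) (f b))) s \<in> lc.span rels2"
      using that * by (intro lin_ext_diff_in_span) auto
    then show ?thesis
      by (simp add: lin_ext_basis ev2_def lin_ext_lin_ext case_prod_unfold)
  qed
  have "(s - ?N (ev2 s)) - (t - ?N (ev2 t)) \<in> lc.span rels2"
    by (intro lc.span_diff * assms)
  then show ?thesis
    using assms(1) by (simp add: teq2_def)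
qed

definition ev3 :: "('a \<times> 'a \<times> 'a \<Rightarrow>\<^sub>0 'k) \<Rightarrow> ('m \<times> 'm \<times> 'm \<Rightarrow>\<^sub>0 'k)" where
  "ev3 = lin_ext (\<lambda>(a, b, c). tens (f a) (tens (f b) (f c)))"

lemma ev3_imp_teq3:
  assumes "ev3 s = ev3 t"
    and "keys s \<subseteq> carrier H \<times> carrier H \<times> carrier H"
      "keys t \<subseteq> carrier H \<times> carrier H \<times> carrier H"
  shows "teq3 H s t"
proof -
  let ?\<nu> = "\<lambda>m n l. basis (h (basis m), h (basis n), h (basis l))"
  let ?N = "lin_ext (\<lambda>(m, n, l). ?\<nu> m n l)"
  have "basis (a, b, c) - ?N (tens (f a) (tens (f b) (f c))) \<in> lc.span rels3"
    if a: "a \<in> carrier H" and b: "b \<in> carrier H" and c: "c \<in> carrier H" for a b c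
  proof -
    have "basis (h (f a), b, c) - lin_ext (\<lambda>m. basis (h (basis m), b, c)) (f a) \<in> lc.span rels3"
      using rels_coordinates[OF f_keys[OF a], of "\<lambda>a. (a, b, c)"] b c
      by (rule_tac subsetD[OF lc.span_mono]) auto
    moreover have "lin_ext (\<lambda>m. basis (h (basis m), h (f b), c)) (f a) -
        lin_ext (\<lambda>m. lin_ext (\<lambda>n. basis (h (basis m), h (basis n), c)) (f b)) (f a) \<in> lc.span rels3"
    proof (rule lin_ext_diff_in_span)
      fix m assume "m \<in> keys (f a)"
      then have "h (basis m) \<in> carrier H"
        using f_keys[OF a] by (intro h_closed keys_basis) auto
      then show "basis (h (basis m), h (f b), c) - lin_ext (\<lambda>n. basis (h (basis m), h (basis n), c)) (f b) \<in> lc.span rels3"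
        using rels_coordinates[OF f_keys[OF b], of "\<lambda>d. (h (basis m), d, c)"] c
        by (rule_tac subsetD[OF lc.span_mono]) auto
    qed
    moreover have "lin_ext (\<lambda>m. lin_ext (\<lambda>n. basis (h (basis m), h (basis n), h (f c))) (f b)) (f a) -
        lin_ext (\<lambda>m. lin_ext (\<lambda>n. lin_ext (\<lambda>l. ?\<nu> m n l) (f c)) (f b)) (f a) \<in> lc.span rels3"
    proof (intro lin_ext_diff_in_span)
      fix m n assume "m \<in> keys (f a)" "n \<in> keys (f b)"
      then have "h (basis m) \<in> carrier H" "h (basis n) \<in> carrier H"
        using f_keys[OF a] f_keys[OF b] by (auto intro!: h_closed keys_basis simp del: keys_single)
      then show "basis (h (basis m), h (basis n), h (f c)) - lin_ext (\<lambda>l. ?\<nu> m n l) (f c) \<in> lc.span rels3"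
        using rels_coordinates[OF f_keys[OF c], of "\<lambda>d. (h (basis m), h (basis n), d)"]
        by (rule_tac subsetD[OF lc.span_mono]) auto
    qed
    ultimately have "((basis (h (f a), b, c) - lin_ext (\<lambda>m. basis (h (basis m), b, c)) (f a)) +
      (lin_ext (\<lambda>m. basis (h (basis m), h (f b), c)) (f a) -
        lin_ext (\<lambda>m. lin_ext (\<lambda>n. basis (h (basis m), h (basis n), c)) (f b)) (f a))) +
      (lin_ext (\<lambda>m. lin_ext (\<lambda>n. basis (h (basis m), h (basis n), h (f c))) (f b)) (f a) -
        lin_ext (\<lambda>m. lin_ext (\<lambda>n. lin_ext (\<lambda>l. ?\<nu> m n l) (f c)) (f b)) (f a)) \<in> lc.span rels3"
      by (intro lc.span_add)
    then show ?thesis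
      using a b c by (simp add: h_f lin_ext_tens)
  qed
  note * = this
  have *: "s - ?N (ev3 s) \<in> lc.span rels3" if "keys s \<subseteq> carrier H \<times> carrier H \<times> carrier H" for s
  proof -
    have "lin_ext basis s - lin_ext (\<lambda>(a, b, c). ?N (tens (f a) (tens (f b) (f c)))) s \<in> lc.span rels3"
      using that * by (intro lin_ext_diff_in_span) auto
    then show ?thesis
      by (simp add: lin_ext_basis ev3_def lin_ext_lin_ext case_prod_unfold)
  qed
  have "(s - ?N (ev3 s)) - (t - ?N (ev3 t)) \<in> lc.span rels3"
    by (intro lc.span_diff * assms)
  then show ?thesis
    using assms(1) by (simp add: teq3_def)
qed

lemma ring_H: "ring H"
proof (rule ringI)
  show "abelian_group H"
  proof (rule abelian_groupI)
    fix x assume x: "x \<in> carrier H"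
    show "\<exists>y\<in>carrier H. y \<oplus> x = \<zero>"
      using x by (intro bexI[of _ "(- 1) \<odot> x"] f_inj poly_mapping_eqI)
        (simp_all add: f_add f_smult f_zero zero_closed add_closed smult_closed lookup_add)
  qed (auto intro!: f_inj simp: f_add f_zero zero_closed add_closed ac_simps)
  show "monoid H"
    by (rule monoidI) (auto intro!: f_inj simp: f_mult f_one one_closed mult_closed mult.assoc)
qed (auto intro!: f_inj simp: f_add f_mult add_closed mult_closed algebra_simps)

sublocale ring: ring H by (rule ring_H)

lemma k_algebra_H: "k_algebra H"
proof (intro k_algebra.intro k_algebra_axioms.intro ring_H)
  have "cring (ring_of_type_algebra :: 'k ring)"
    by (rule cring_from_type_algebra)
  then show "Module.module (ring_of_type_algebra :: 'k ring) H"
    by (intro Module.module.intro Module.module_axioms.intro ring.is_abelian_group)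
      (auto simp: ring_of_type_algebra_def smult_closed add_closed f_add f_smult
         scale_add scale_left_add scale_scale intro!: f_inj)
qed (auto intro!: f_inj simp: f_mult f_smult mult_closed smult_closed scale_mult)

lemma f_finsum:
  assumes "finite J" "g \<in> J \<rightarrow> carrier H"
  shows "f (finsum H g J) = (\<Sum>x\<in>J. f (g x))"
  using assms by (induction J rule: finite_induct) (auto simp: f_zero f_add ring.finsum_closed Pi_iff)

lemma
  assumes "\<And>a b. \<lbrakk>a \<in> carrier H; b \<in> carrier H\<rbrakk> \<Longrightarrow> \<phi> a b \<in> carrier H"
    and "keys t \<subseteq> carrier H \<times> carrier H"
  shows contract_closed: "contract H \<phi> t \<in> carrier H"
    and f_contract: "f (contract H \<phi> t) = lin_ext (\<lambda>(a, b). f (\<phi> a b)) t"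
proof -
  have *: "(\<lambda>(a, b). lookup t (a, b) \<odot> \<phi> a b) \<in> keys t \<rightarrow> carrier H"
    using assms by (auto intro!: smult_closed)
  show "contract H \<phi> t \<in> carrier H"
    unfolding contract_def using * by (rule ring.finsum_closed)
  show "f (contract H \<phi> t) = lin_ext (\<lambda>(a, b). f (\<phi> a b)) t"
    unfolding contract_def lin_ext_def
    using assms * by (subst f_finsum) (auto simp: f_smult case_prod_unfold intro!: sum.cong)
qed

text \<open>The axioms about the counit and the antipode contract the coproduct by a bilinear map \<open>\<phi>\<close>; such a
  contraction is determined by the values \<open>\<gamma>\<close> of \<open>\<phi>\<close> on monomials.\<close>

lemma f_contract_bilinear:
  assumes "\<And>a b. \<lbrakk>a \<in> carrier H; b \<in> carrier H\<rbrakk> \<Longrightarrow> \<phi> a b \<in> carrier H"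
    and "\<And>a b. \<lbrakk>a \<in> carrier H; b \<in> carrier H\<rbrakk> \<Longrightarrow> f (\<phi> a b) = lin_ext (\<lambda>m. lin_ext (\<lambda>n. \<gamma> m n) (f b)) (f a)"
    and "x \<in> carrier H"
  shows "f (contract H \<phi> (comult H x)) = lin_ext (\<lambda>(m, n). \<gamma> m n) (lin_ext \<delta> (f x))"
proof -
  have "f (contract H \<phi> (comult H x)) = lin_ext (\<lambda>(a, b). f (\<phi> a b)) (comult H x)"
    using assms comult_keys by (intro f_contract) auto
  also have "\<dots> = lin_ext (\<lambda>(a, b). lin_ext (\<lambda>m. lin_ext (\<lambda>n. \<gamma> m n) (f b)) (f a)) (comult H x)"
    using comult_keys[OF assms(3)] assms(2) by (intro lin_ext_cong_tens) auto
  also have "\<dots> = lin_ext (\<lambda>(m, n). \<gamma> m n) (lin_ext \<delta> (f x))"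
    unfolding lin_ext_ev2[symmetric] using f_comult[OF assms(3)] by (simp add: ev2_def)
  finally show ?thesis .
qed

lemma ev2_comult: "a \<in> carrier H \<Longrightarrow> ev2 (comult H a) = lin_ext \<delta> (f a)"
  by (simp add: ev2_def f_comult)

lemma ev2_tmult:
  assumes "keys s \<subseteq> carrier H \<times> carrier H" "keys t \<subseteq> carrier H \<times> carrier H"
  shows "ev2 (tmult H s t) = ev2 s * ev2 t"
proof -
  have "ev2 (tmult H s t) = lin_ext (\<lambda>(a, b). lin_ext (\<lambda>(c, d). tens (f (a \<otimes> c)) (f (b \<otimes> d))) t) s"
    by (simp add: tmult_def ev2_def lin_ext_lin_ext case_prod_unfold)
  also have "\<dots> = lin_ext (\<lambda>(a, b). lin_ext (\<lambda>(c, d). tens (f a) (f b) * tens (f c) (f d)) t) s"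
  proof (intro lin_ext_cong_tens)
    fix a b c d assume "(a, b) \<in> keys s" "(c, d) \<in> keys t"
    then have "a \<in> carrier H" "b \<in> carrier H" "c \<in> carrier H" "d \<in> carrier H"
      using assms by auto
    then show "tens (f (a \<otimes> c)) (f (b \<otimes> d)) = tens (f a) (f b) * tens (f c) (f d)"
      by (simp add: f_mult tens_mult)
  qed
  also have "\<dots> = ev2 s * ev2 t"
    by (simp add: ev2_def case_prod_unfold lin_ext_mult_left lin_ext_mult_right)
  finally show ?thesis .
qed

lemma tmult_keys:
  assumes "keys s \<subseteq> carrier H \<times> carrier H" "keys t \<subseteq> carrier H \<times> carrier H"
  shows "keys (tmult H s t) \<subseteq> carrier H \<times> carrier H"
proof -
  have "a \<otimes> c \<in> carrier H" "b \<otimes> d \<in> carrier H"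
    if "(a, b) \<in> keys s" "(c, d) \<in> keys t" for a b c d
    using that assms by (blast intro: mult_closed)+
  then show ?thesis
    unfolding tmult_def by (intro keys_lin_ext_subset) (auto dest!: subsetD[OF keys_lin_ext])
qed

lemma coassoc_H:
  assumes x: "x \<in> carrier H"
  shows "teq3 H
      (comult_left (comult H) x)
      (comult_right (comult H) x)"
    (is "teq3 H ?l ?r")
proof (rule ev3_imp_teq3)
  show "ev3 ?l = ev3 ?r"
    unfolding ev3_def using coassoc_transport[of "carrier H" "comult H" f \<delta> M] comult_keys f_comult f_keys coprod_coassoc x
    by blast
  show "keys ?l \<subseteq> carrier H \<times> carrier H \<times> carrier H"
    "keys ?r \<subseteq> carrier H \<times> carrier H \<times> carrier H"
    using comult_keys[OF x] comult_keys
    by (auto intro!: keys_lin_ext_subset split: if_splits) blast+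
qed

lemma bialgebra_H: "bialgebra H"
proof -
  interpret k_algebra H by (rule k_algebra_H)
  show ?thesis
  proof
    fix x assume x: "x \<in> carrier H"
    show "contract H (\<lambda>a b. counit H a \<odot> b) (comult H x) = x"
    proof (rule f_inj)
      have "f (contract H (\<lambda>a b. counit H a \<odot> b) (comult H x)) =
          lin_ext (\<lambda>(m, n). if m = 0 then basis n else 0) (lin_ext \<delta> (f x))"
      proof (rule f_contract_bilinear)
        fix a b assume ab: "a \<in> carrier H" "b \<in> carrier H"
        with ab show "f (counit H a \<odot> b) = lin_ext (\<lambda>m. lin_ext (\<lambda>n. if m = 0 then basis n else 0) (f b)) (f a)"
          by (simp only: lin_ext_counit_left f_smult f_counit)
      qed (simp_all add: x smult_closed)
      also have "\<dots> = f x"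
        unfolding lin_ext_lin_ext using f_keys[OF x] by (intro lin_ext_id_on coprod_counit_left) auto
      finally show "f (contract H (\<lambda>a b. counit H a \<odot> b) (comult H x)) = f x" .
    qed (auto intro!: contract_closed smult_closed simp: x dest: comult_keysD)
    show "contract H (\<lambda>a b. counit H b \<odot> a) (comult H x) = x"
    proof (rule f_inj)
      have "f (contract H (\<lambda>a b. counit H b \<odot> a) (comult H x)) =
          lin_ext (\<lambda>(m, n). if n = 0 then basis m else 0) (lin_ext \<delta> (f x))"
      proof (rule f_contract_bilinear)
        fix a b assume ab: "a \<in> carrier H" "b \<in> carrier H"
        with ab show "f (counit H b \<odot> a) = lin_ext (\<lambda>m. lin_ext (\<lambda>n. if n = 0 then basis m else 0) (f b)) (f a)"
          by (simp only: lin_ext_counit_right f_smult f_counit)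
      qed (simp_all add: x smult_closed)
      also have "\<dots> = f x"
        unfolding lin_ext_lin_ext using f_keys[OF x] by (intro lin_ext_id_on coprod_counit_right) auto
      finally show "f (contract H (\<lambda>a b. counit H b \<odot> a) (comult H x)) = f x" .
    qed (auto intro!: contract_closed smult_closed simp: x dest: comult_keysD)
    fix y assume y: "y \<in> carrier H"
    show "teq2 H (comult H (x \<otimes> y)) (tmult H (comult H x) (comult H y))"
      using x y
      by (intro ev2_imp_teq2 tmult_keys comult_keys)
        (auto simp: ev2_tmult comult_keys ev2_comult f_mult coprod_add lin_ext_mult)
    have "keys (comult H x + comult H y) \<subseteq> carrier H \<times> carrier H"
      using x y by (intro keys_add_subset comult_keys)
    then show "teq2 H (comult H (x \<oplus> y)) (comult H x + comult H y)"
      using x y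
      by (intro ev2_imp_teq2 comult_keys) (auto simp: ev2_def lin_ext_add f_comult f_add)
    show "counit H (x \<otimes> y) = counit H x * counit H y"
      using x y lookup_zero_mult[OF zero_sum] by (simp add: f_counit f_mult mult_closed)
  next
    fix x c assume x: "x \<in> carrier H"
    show "teq2 H (comult H (c \<odot> x)) (scale c (comult H x))"
      using x keys_scale[of c "comult H x"]
      by (intro ev2_imp_teq2 comult_keys order.trans[OF keys_scale])
        (auto simp: ev2_def lin_ext_scale f_comult f_smult smult_closed)
  next
    show "teq2 H (comult H \<one>) (basis (\<one>, \<one>))"
    proof (intro ev2_imp_teq2 comult_keys)
      have "lin_ext \<delta> 1 = 1"
        by (simp flip: single_one add: coprod_zero)
      then show "ev2 (comult H \<one>) = ev2 (basis (\<one>, \<one>))"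
        by (simp add: ev2_comult f_one) (simp add: ev2_def f_one tens_one)
    qed simp_all
  qed (auto simp: comult_keys f_counit f_add f_smult f_one add_closed smult_closed lookup_add
      lookup_one coassoc_H)
qed

text \<open>Conversely to the existence of the antipode: every antipode of \<open>H\<close> is in coordinates a two-sided
  convolution inverse of the identity, and therefore subject to \<open>antipode_hom\<close>.\<close>

lemma antipode_coordinates:
  assumes S: "is_antipode H S"
  defines "s \<equiv> \<lambda>m. f (S (h (basis m)))"
  shows "x \<in> carrier H \<Longrightarrow> f (S x) = lin_ext s (f x)"
    and "m \<in> M \<Longrightarrow> conv s basis m = conv_unit m"
    and "m \<in> M \<Longrightarrow> conv basis s m = conv_unit m"
proof -
  have Scl: "S x \<in> carrier H" if "x \<in> carrier H" for x
    using S that by (auto simp: is_antipode_def)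
  have *: "f (S (h y)) = lin_ext s y" if "keys y \<subseteq> M" for y
    using that
  proof (induction y rule: lin_combination_induct_on)
    case zero
    have 1: "h 0 = \<zero>"
      by (rule h_eqI) (simp_all add: f_zero)
    have 2: "0 \<odot> \<zero> = \<zero>"
      by (rule f_inj) (simp_all add: smult_closed f_zero f_smult)
    have "S (0 \<odot> \<zero>) = 0 \<odot> S \<zero>"
      using S zero_closed unfolding is_antipode_def by blast
    then have "f (S \<zero>) = scale 0 (f (S \<zero>))"
      using 2 Scl by (metis f_smult zero_closed)
    then show ?case
      using 1 by simp
  next
    case (add m c p)
    let ?u = "h (basis m)" and ?v = "h p"
    have u: "?u \<in> carrier H" and v: "?v \<in> carrier H"
      using add by (auto intro: h_closed)
    have eq: "h (Poly_Mapping.single m c + p) = (c \<odot> ?u) \<oplus> ?v"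
      using u v add by (intro h_eqI) (simp_all add: add_closed smult_closed f_add f_smult f_h scale_single)
    have "S ((c \<odot> ?u) \<oplus> ?v) = (c \<odot> S ?u) \<oplus> S ?v"
      using S u v smult_closed[OF u] by (simp add: is_antipode_def)
    then show ?case
      using add u v by (simp add: eq f_add f_smult Scl smult_closed lin_ext_add s_def)
  qed
  show 1: "f (S x) = lin_ext s (f x)" if "x \<in> carrier H" for x
    using *[OF f_keys[OF that]] that by (simp add: h_f)
  have m1: "f (counit H x \<odot> \<one>) = conv_unit m" if "x = h (basis m)" "m \<in> M" for x m
    using that by (simp add: f_smult f_one f_counit h_closed f_h lookup_single conv_unit_def when_def)
  assume m: "m \<in> M"
  then have x: "h (basis m) \<in> carrier H" and fx: "f (h (basis m)) = basis m"
    by (simp_all add: h_closed f_h)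
  have "conv s basis m = f (contract H (\<lambda>a b. S a \<otimes> b) (comult H (h (basis m))))"
    using x fx
    by (subst f_contract_bilinear[where \<gamma> = "\<lambda>m n. s m * basis n"])
      (auto simp: conv_def mult_closed Scl f_mult 1 lin_ext_mult_left lin_ext_mult_right lin_ext_basis)
  also have "\<dots> = conv_unit m"
    using S x m m1[OF refl] by (simp add: is_antipode_def)
  finally show "conv s basis m = conv_unit m" .
  have "conv basis s m = f (contract H (\<lambda>a b. a \<otimes> S b) (comult H (h (basis m))))"
    using x fx
    by (subst f_contract_bilinear[where \<gamma> = "\<lambda>m n. basis m * s n"])
      (auto simp: conv_def mult_closed Scl f_mult 1 lin_ext_mult_left lin_ext_mult_right lin_ext_basis)
  also have "\<dots> = conv_unit m"
    using S x m m1[OF refl] by (simp add: is_antipode_def)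
  finally show "conv basis s m = conv_unit m" .
qed

lemma is_antipode_H: "is_antipode H (\<lambda>x. h (lin_ext antipode (f x)))"
proof -
  have keys: "keys (lin_ext antipode (f x)) \<subseteq> M" if "x \<in> carrier H" for x
    using f_keys[OF that] antipode_keys by (intro keys_lin_ext_subset) auto
  define S where "S x = h (lin_ext antipode (f x))" for x
  have Scl: "S x \<in> carrier H" and fS: "f (S x) = lin_ext antipode (f x)" if "x \<in> carrier H" for x
    using keys[OF that] by (simp_all add: h_closed f_h S_def)
  have "contract H (\<lambda>a b. S a \<otimes> b) (comult H x) = counit H x \<odot> \<one>" if x: "x \<in> carrier H" for x
  proof (rule f_inj)
    have "f (contract H (\<lambda>a b. S a \<otimes> b) (comult H x)) =
        lin_ext (\<lambda>(m, n). antipode m * basis n) (lin_ext \<delta> (f x))"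
      using x by (intro f_contract_bilinear)
        (auto simp: Scl mult_closed f_mult fS lin_ext_mult_left lin_ext_mult_right lin_ext_basis)
    also have "\<dots> = f (counit H x \<odot> \<one>)"
      using lin_ext_antipode[OF antipode_left f_keys[OF x]] x by (simp add: f_smult f_one f_counit)
    finally show "f (contract H (\<lambda>a b. S a \<otimes> b) (comult H x)) = f (counit H x \<odot> \<one>)" .
  qed (auto intro!: contract_closed mult_closed smult_closed Scl simp: x dest: comult_keysD)
  moreover have "contract H (\<lambda>a b. a \<otimes> S b) (comult H x) = counit H x \<odot> \<one>" if x: "x \<in> carrier H" for x
  proof (rule f_inj)
    have "f (contract H (\<lambda>a b. a \<otimes> S b) (comult H x)) =
        lin_ext (\<lambda>(m, n). basis m * antipode n) (lin_ext \<delta> (f x))"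
      using x by (intro f_contract_bilinear)
        (auto simp: Scl mult_closed f_mult fS lin_ext_mult_left lin_ext_mult_right lin_ext_basis)
    also have "\<dots> = f (counit H x \<odot> \<one>)"
      using lin_ext_antipode[OF antipode_right f_keys[OF x]] x by (simp add: f_smult f_one f_counit)
    finally show "f (contract H (\<lambda>a b. a \<otimes> S b) (comult H x)) = f (counit H x \<odot> \<one>)" .
  qed (auto intro!: contract_closed mult_closed smult_closed Scl simp: x dest: comult_keysD)
  ultimately have "is_antipode H S"
    unfolding is_antipode_def
    by (auto intro!: f_inj simp: Scl fS f_add f_smult add_closed smult_closed lin_ext_add lin_ext_scale)
  then show ?thesis
    by (simp add: S_def[abs_def])
qed

lemma hopf_algebra_H: "hopf_algebra H"
  using bialgebra_H is_antipode_H by (auto simp: hopf_algebra_def hopf_algebra_axioms_def)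

end

text \<open>To recognize a morphism of Hopf algebras it suffices to look at its expression \<open>G\<close> in coordinates,
  on monomials. The condition on antipodes need not be checked, by uniqueness of convolution inverses.\<close>

lemma hopf_hom_coordinates:
  fixes G :: "'m::monoid_add \<Rightarrow> ('n::monoid_add \<Rightarrow>\<^sub>0 'k::field)"
    and H :: "('k, 'a, 'z) bialg_scheme" and H' :: "('k, 'b, 'y) bialg_scheme"
  assumes "coordinates M \<delta> wt H f" "coordinates M' \<delta>' wt' H' f'"
    and G_add: "\<And>m n. G (m + n) = G m * G n" and G_zero: "G 0 = 1"
    and keys: "\<And>m. m \<in> M \<Longrightarrow> keys (G m) \<subseteq> M'"
    and coprod: "\<And>m. m \<in> M \<Longrightarrow> map_tens G G (\<delta> m) = lin_ext \<delta>' (G m)"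
    and counit: "\<And>m. m \<in> M \<Longrightarrow> lookup (G m) 0 = (if m = 0 then 1 else 0)"
    and \<Phi>: "\<And>x. x \<in> carrier H \<Longrightarrow> \<Phi> x \<in> carrier H'"
    and f'\<Phi>: "\<And>x. x \<in> carrier H \<Longrightarrow> f' (\<Phi> x) = lin_ext G (f x)"
  shows "hopf_hom H H' \<Phi>"
proof -
  interpret A: coordinates M \<delta> wt H f by fact
  interpret B: coordinates M' \<delta>' wt' H' f' by fact
  have one: "lin_ext G 1 = 1"
    by (simp only: lin_ext_one G_zero)
  have "\<Phi> \<in> ring_hom H H'"
    by (rule ring_hom_memI)
      (auto intro!: B.f_inj simp: \<Phi> f'\<Phi> A.mult_closed B.mult_closed A.add_closed B.add_closed
        A.f_mult B.f_mult A.f_add B.f_add A.f_one B.f_one lin_ext_mult G_add lin_ext_add one A.one_closed B.one_closed G_zero)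
  moreover have "\<Phi> (c \<odot>\<^bsub>H\<^esub> x) = c \<odot>\<^bsub>H'\<^esub> \<Phi> x" if "x \<in> carrier H" for c x
    using that by (auto intro!: B.f_inj simp: \<Phi> f'\<Phi> A.smult_closed B.smult_closed A.f_smult B.f_smult lin_ext_scale)
  moreover have "teq2 H' (comult H' (\<Phi> x)) (tmap \<Phi> \<Phi> (comult H x))" if x: "x \<in> carrier H" for x
  proof (rule B.ev2_imp_teq2)
    have "B.ev2 (comult H' (\<Phi> x)) = lin_ext \<delta>' (lin_ext G (f x))"
      by (simp add: B.ev2_comult \<Phi> f'\<Phi> x)
    also have "\<dots> = map_tens G G (A.ev2 (comult H x))"
      using A.f_keys[OF x] coprod
      by (auto simp: lin_ext_lin_ext A.ev2_comult x map_tens_def intro!: lin_ext_cong)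
    also have "\<dots> = lin_ext (\<lambda>(a, b). tens (lin_ext G (f a)) (lin_ext G (f b))) (comult H x)"
      unfolding A.ev2_def by (simp add: map_tens_def lin_ext_lin_ext lin_ext_tens tens_lin_ext case_prod_unfold,
        subst lin_ext_swap, rule refl)
    also have "\<dots> = lin_ext (\<lambda>(a, b). tens (f' (\<Phi> a)) (f' (\<Phi> b))) (comult H x)"
      using A.comult_keys[OF x] f'\<Phi> by (intro lin_ext_cong_tens) auto
    also have "\<dots> = B.ev2 (tmap \<Phi> \<Phi> (comult H x))"
      by (simp add: B.ev2_def tmap_def lin_ext_lin_ext case_prod_unfold)
    finally show "B.ev2 (comult H' (\<Phi> x)) = B.ev2 (tmap \<Phi> \<Phi> (comult H x))" .
    show "keys (tmap \<Phi> \<Phi> (comult H x)) \<subseteq> carrier H' \<times> carrier H'"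
      unfolding tmap_def using A.comult_keys[OF x] \<Phi> by (intro keys_lin_ext_subset) auto
  qed (auto intro!: B.comult_keys \<Phi> x)
  moreover have "counit H' (\<Phi> x) = counit H x" if x: "x \<in> carrier H" for x
  proof -
    have "lookup (lin_ext G y) 0 = lookup y 0" if "keys y \<subseteq> M" for y
      using that
    proof (induction y rule: lin_combination_induct_on)
      case (add m c p)
      then show ?case
        using counit by (auto simp: lin_ext_add lookup_add lookup_single when_def)
    qed simp
    then show ?thesis
      using A.f_keys[OF x] x by (simp add: A.f_counit B.f_counit \<Phi> f'\<Phi>)
  qed
  moreover have "\<Phi> (S x) = S' (\<Phi> x)" if S: "is_antipode H S" and S': "is_antipode H' S'" and x: "x \<in> carrier H" for S S' x
  proof (rule B.f_inj)
    have cl: "S x \<in> carrier H" "S' (\<Phi> x) \<in> carrier H'"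
      using S S' x \<Phi> by (auto simp: is_antipode_def)
    then show "\<Phi> (S x) \<in> carrier H'" "S' (\<Phi> x) \<in> carrier H'"
      using \<Phi> by auto
    let ?s = "\<lambda>m. f (S (A.h (basis m)))" and ?s' = "\<lambda>m. f' (S' (B.h (basis m)))"
    have "f' (\<Phi> (S x)) = lin_ext (\<lambda>m. lin_ext G (?s m)) (f x)"
      using cl x A.antipode_coordinates(1)[OF S x] by (simp add: f'\<Phi> lin_ext_lin_ext)
    also have "\<dots> = lin_ext (\<lambda>m. lin_ext ?s' (G m)) (f x)"
      using A.f_keys[OF x] A.antipode_coordinates(2)[OF S] B.antipode_coordinates(3)[OF S']
      by (intro lin_ext_cong antipode_hom[OF A.filtered_bialg_axioms B.filtered_bialg_axioms G_add G_zero keys coprod counit])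
         auto
    also have "\<dots> = f' (S' (\<Phi> x))"
      using B.antipode_coordinates(1)[OF S' \<Phi>[OF x]] by (simp add: f'\<Phi> x lin_ext_lin_ext)
    finally show "f' (\<Phi> (S x)) = f' (S' (\<Phi> x))" .
  qed
  ultimately show ?thesis
    unfolding hopf_hom_def using A.hopf_algebra_H B.hopf_algebra_H by blast
qed

lemma monoid_bialg_coordinates:
  assumes "filtered_bialg M \<delta> wt" "C = {x. keys x \<subseteq> M}"
  shows "coordinates M \<delta> wt (monoid_bialg C (lin_ext \<delta>)) (\<lambda>x. x)"
proof -
  interpret filtered_bialg M \<delta> wt by fact
  have *: "m \<in> M" "n \<in> M" if "(m, n) \<in> keys (lin_ext \<delta> x)" "x \<in> C" for x m n
    using that coprod_keys by (auto simp: assms(2) dest!: subsetD[OF keys_lin_ext] subsetD[OF coprod_keys])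
  show ?thesis
  proof
    fix a assume "a \<in> carrier (monoid_bialg C (lin_ext \<delta>))"
    then have "a \<in> C" by (simp add: monoid_bialg_def)
    have "keys (lin_ext (\<lambda>(m, n). basis (basis m, basis n)) (lin_ext \<delta> a)) \<subseteq> C \<times> C"
      using *[OF _ \<open>a \<in> C\<close>] by (intro keys_lin_ext_subset) (auto simp: assms(2))
    then show "keys (comult (monoid_bialg C (lin_ext \<delta>)) a) \<subseteq>
        carrier (monoid_bialg C (lin_ext \<delta>)) \<times> carrier (monoid_bialg C (lin_ext \<delta>))"
      by (simp add: monoid_bialg_def)
  next
    fix a
    have "lin_ext (\<lambda>(b, c). tens b c) (lin_ext (\<lambda>(m, n). basis (basis m, basis n)) t) = t" for t :: "'a \<times> 'a \<Rightarrow>\<^sub>0 'b"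
      by (simp add: lin_ext_lin_ext case_prod_unfold lin_ext_basis)
    then show "lin_ext (\<lambda>(b, c). tens b c) (comult (monoid_bialg C (lin_ext \<delta>)) a) = lin_ext \<delta> a"
      by (simp add: monoid_bialg_def)
  qed (auto simp: monoid_bialg_def assms(2) zero_in bij_betw_def intro: add_in
      dest!: subsetD[OF keys_add] subsetD[OF keys_mult] subsetD[OF keys_scale])
qed

section \<open>The Hopf algebras of rooted trees\<close>

lemma lin_ext_id_tensor: "lin_ext (\<lambda>(a, b). g a b) (id_tensor \<nu> t) = lin_ext (\<lambda>(a, b). g a (\<nu> b)) t"
  by (simp add: id_tensor_def lin_ext_lin_ext case_prod_unfold)

lemma lin_ext_plus_pair:
  "lin_ext (\<lambda>(a, b). f a b + g a b) t = lin_ext (\<lambda>(a, b). f a b) t + lin_ext (\<lambda>(a, b). g a b) t"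
  by (simp add: case_prod_unfold lin_ext_plus)

lemma keys_id_tensor:
  assumes "(a, b) \<in> keys (id_tensor \<nu> t)"
  obtains b' where "(a, b') \<in> keys t" "b = \<nu> b'"
  using assms by (auto simp: id_tensor_def dest!: subsetD[OF keys_lin_ext])

lemma keys_basis_diff:
  "z \<in> keys p \<Longrightarrow> z = y \<or> z \<in> keys (p - basis y)"
  by (auto simp: in_keys_iff lookup_minus lookup_single when_def)

text \<open>The condition \<open>coprod_low\<close> is inherited by products: in \<open>(m \<otimes> 1 + R) (n \<otimes> 1 + R')\<close> every term
  other than \<open>m n \<otimes> 1\<close> has a factor from \<open>R\<close> or \<open>R'\<close>.\<close>

lemma low_mult:
  fixes p q :: "'m::monoid_add \<times> 'm \<Rightarrow>\<^sub>0 'k::comm_ring_1" and wt :: "'m \<Rightarrow> nat"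
  assumes wt_add: "\<And>m n. wt (m + n) = wt m + wt n"
    and p: "\<And>a b. (a, b) \<in> keys (p - basis (m, 0)) \<Longrightarrow> wt a < wt m"
    and q: "\<And>a b. (a, b) \<in> keys (q - basis (n, 0)) \<Longrightarrow> wt a < wt n"
    and ab: "(a, b) \<in> keys (p * q - basis (m + n, 0))"
  shows "wt a < wt (m + n)"
proof -
  let ?R = "p - basis (m, 0)" and ?R' = "q - basis (n, 0)"
  have "p * q - basis (m + n, 0) = (basis (m, 0) + ?R) * (basis (n, 0) + ?R') - basis (m, 0) * basis (n, 0)"
    by (simp add: mult_single)
  also have "\<dots> = basis (m, 0) * ?R' + ?R * q"
    by (simp only: ring_distribs) simp
  finally have "(a, b) \<in> keys (basis (m, 0) * ?R') \<union> keys (?R * q)"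
    using ab keys_add[of "basis (m, 0) * ?R'" "?R * q"] by (simp only: subset_iff)
  then show ?thesis
  proof
    assume "(a, b) \<in> keys (basis (m, 0) * ?R')"
    then obtain r s where *: "r \<in> keys (basis (m, 0) :: _ \<Rightarrow>\<^sub>0 'k)" "s \<in> keys ?R'" "(a, b) = r + s"
      using keys_mult[of "basis (m, 0)" ?R'] by blast
    then have "(fst s, snd s) \<in> keys ?R'" "a = m + fst s"
      by (simp_all add: prod_eq_iff)
    with q[of "fst s" "snd s"] show ?thesis
      by (simp add: wt_add)
  next
    assume "(a, b) \<in> keys (?R * q)"
    then obtain r s where *: "r \<in> keys ?R" "s \<in> keys q" "(a, b) = r + s"
      using keys_mult[of ?R q] by blast
    then have r: "(fst r, snd r) \<in> keys ?R" and a: "a = fst r + fst s"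
      by (simp_all add: prod_eq_iff)
    from keys_basis_diff[OF *(2), of "(n, 0)"] have "wt (fst s) \<le> wt n"
      using q[of "fst s" "snd s"] by (elim disjE) auto
    then show ?thesis
      using p[OF r] by (simp add: a wt_add)
  qed
qed

text \<open>The properties shared by planar and non-planar forests: the coproduct is multiplicative and
  satisfies \<open>\<Delta> \<circ> B = B \<otimes> 1 + (Id \<otimes> B) \<circ> \<Delta>\<close> for the grafting operators \<open>B\<close>, here called \<open>node d\<close>,
  and every forest is obtained from the empty one by grafting and products.\<close>

locale grafting =
  fixes node :: "'d \<Rightarrow> 'm::monoid_add \<Rightarrow> 'm"
    and \<delta> :: "'m \<Rightarrow> ('m \<times> 'm \<Rightarrow>\<^sub>0 'k::field)"
    and wt :: "'m \<Rightarrow> nat"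
  assumes zero_sum: "m + n = (0::'m) \<Longrightarrow> m = 0 \<and> n = 0"
    and coprod_zero: "\<delta> 0 = 1"
    and coprod_add: "\<delta> (m + n) = \<delta> m * \<delta> n"
    and coprod_node: "\<delta> (node d m) = basis (node d m, 0) + id_tensor (node d) (\<delta> m)"
    and wt_add: "wt (m + n) = wt m + wt n"
    and wt_node: "wt (node d m) = Suc (wt m)"
    and node_nonzero: "node d m \<noteq> 0"
    and forest_induct: "P 0 \<Longrightarrow> (\<And>d m. P m \<Longrightarrow> P (node d m)) \<Longrightarrow> (\<And>m n. P m \<Longrightarrow> P n \<Longrightarrow> P (m + n)) \<Longrightarrow> P m"
begin

lemma counit_left: "lin_ext (\<lambda>(a, b). if a = 0 then basis b else 0) (\<delta> m) = basis m"
proof (induction m rule: forest_induct)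
  case (2 d m)
  have "lin_ext (\<lambda>(a, b). if a = 0 then basis (node d b) else 0) (\<delta> m) =
      lin_ext (\<lambda>b. basis (node d b)) (lin_ext (\<lambda>(a, b). if a = 0 then basis b else 0) (\<delta> m))"
    unfolding lin_ext_lin_ext by (rule lin_ext_cong) auto
  with 2 show ?case
    by (simp add: coprod_node lin_ext_add lin_ext_id_tensor node_nonzero)
next
  case (3 m n)
  have "lin_ext (\<lambda>(a, b). if a = 0 then basis b else 0) (\<delta> m * \<delta> n) =
    lin_ext (\<lambda>(a, b). if a = 0 then basis b else 0) (\<delta> m) * lin_ext (\<lambda>(a, b). if a = 0 then basis b else 0) (\<delta> n)"
    by (rule lin_ext_mult) (auto simp: mult_single dest: zero_sum)
  with 3 show ?case
    by (simp add: coprod_add mult_single)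
qed (simp add: coprod_zero zero_prod_def)

lemma counit_right: "lin_ext (\<lambda>(a, b). if b = 0 then basis a else 0) (\<delta> m) = basis m"
proof (induction m rule: forest_induct)
  case (2 d m)
  have "lin_ext (\<lambda>(a, b). if node d b = 0 then basis a else 0) (\<delta> m) = lin_ext (\<lambda>_. 0 :: 'm \<Rightarrow>\<^sub>0 'k) (\<delta> m)"
    by (rule lin_ext_cong) (auto simp: node_nonzero)
  then show ?case
    by (simp add: coprod_node lin_ext_add lin_ext_id_tensor)
next
  case (3 m n)
  have "lin_ext (\<lambda>(a, b). if b = 0 then basis a else 0) (\<delta> m * \<delta> n) =
    lin_ext (\<lambda>(a, b). if b = 0 then basis a else 0) (\<delta> m) * lin_ext (\<lambda>(a, b). if b = 0 then basis a else 0) (\<delta> n)"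
    by (rule lin_ext_mult) (auto simp: mult_single dest: zero_sum)
  with 3 show ?case
    by (simp add: coprod_add mult_single)
qed (simp add: coprod_zero zero_prod_def)

text \<open>Both sides are multiplicative. On \<open>B x\<close> both are equal to
  \<open>B x \<otimes> 1 \<otimes> 1 + (Id \<otimes> B) (\<Delta> x) \<otimes> 1 + (Id \<otimes> Id \<otimes> B) y\<close>, where \<open>y\<close> is the corresponding
  side for \<open>x\<close>.\<close>

lemma coassoc:
  "comult_left \<delta> m =
   comult_right \<delta> m"
    (is "lin_ext ?F (\<delta> m) = lin_ext ?G (\<delta> m)")
proof (induction m rule: forest_induct)
  case 1
  then show ?case by (simp add: coprod_zero zero_prod_def)
next
  case (2 d m)
  let ?\<nu> = "\<lambda>(x, y, z). basis (x, y, node d z)"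
  have "lin_ext ?F (\<delta> (node d m)) = ?F (node d m, 0) +
      lin_ext (\<lambda>(a, b). lin_ext (\<lambda>(a', a''). basis (a', a'', node d b)) (\<delta> a)) (\<delta> m)"
    by (subst coprod_node) (simp only: lin_ext_add lin_ext_id_tensor lin_ext_single scale_1)
  also have "?F (node d m, 0) = basis (node d m, 0, 0) + lin_ext (\<lambda>(a', a''). basis (a', node d a'', 0)) (\<delta> m)"
    by (simp add: coprod_node lin_ext_add lin_ext_id_tensor)
  also have "lin_ext (\<lambda>(a, b). lin_ext (\<lambda>(a', a''). basis (a', a'', node d b)) (\<delta> a)) (\<delta> m) = lin_ext ?\<nu> (lin_ext ?F (\<delta> m))"
    by (simp add: lin_ext_lin_ext case_prod_unfold)
  also have "lin_ext ?F (\<delta> m) = lin_ext ?G (\<delta> m)"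
    by (rule 2)
  also have "lin_ext ?\<nu> (lin_ext ?G (\<delta> m)) = lin_ext (\<lambda>(a, b). lin_ext (\<lambda>(b', b''). basis (a, b', node d b'')) (\<delta> b)) (\<delta> m)"
    by (simp add: lin_ext_lin_ext case_prod_unfold)
  finally have l: "lin_ext ?F (\<delta> (node d m)) =
    basis (node d m, 0, 0) + lin_ext (\<lambda>(a, b). basis (a, node d b, 0)) (\<delta> m) +
    lin_ext (\<lambda>(a, b). lin_ext (\<lambda>(b', b''). basis (a, b', node d b'')) (\<delta> b)) (\<delta> m)" .
  have "lin_ext ?G (\<delta> (node d m)) = ?G (node d m, 0) +
      lin_ext (\<lambda>(a, b). lin_ext (\<lambda>(b', b''). basis (a, b', b'')) (\<delta> (node d b))) (\<delta> m)"
    by (subst coprod_node) (simp only: lin_ext_add lin_ext_id_tensor lin_ext_single scale_1)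
  also have "?G (node d m, 0) = basis (node d m, 0, 0)"
    by (simp add: coprod_zero zero_prod_def)
  also have "lin_ext (\<lambda>(a, b). lin_ext (\<lambda>(b', b''). basis (a, b', b'')) (\<delta> (node d b))) (\<delta> m) =
    lin_ext (\<lambda>(a, b). basis (a, node d b, 0)) (\<delta> m) +
    lin_ext (\<lambda>(a, b). lin_ext (\<lambda>(b', b''). basis (a, b', node d b'')) (\<delta> b)) (\<delta> m)"
  proof -
    have "lin_ext (\<lambda>(b', b''). basis (a, b', b'')) (\<delta> (node d b)) =
        basis (a, node d b, 0) + lin_ext (\<lambda>(b', b''). basis (a, b', node d b'')) (\<delta> b)" for a b
      by (simp add: coprod_node lin_ext_add lin_ext_id_tensor)
    then show ?thesis
      unfolding lin_ext_plus_pair[symmetric] by (rule lin_ext_cong_tens)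
  qed
  finally show ?case
    using l by (simp add: add.assoc)
next
  case (3 m n)
  have "lin_ext (\<lambda>(a', a''). basis (a', a'', b + d)) (\<delta> a * \<delta> c) =
    lin_ext (\<lambda>(a', a''). basis (a', a'', b)) (\<delta> a) * lin_ext (\<lambda>(a', a''). basis (a', a'', d)) (\<delta> c)" for a b c d
    by (rule lin_ext_mult_split) (auto simp: mult_single)
  then have "lin_ext ?F (\<delta> m * \<delta> n) = lin_ext ?F (\<delta> m) * lin_ext ?F (\<delta> n)"
    by (intro lin_ext_mult) (auto simp: coprod_add)
  moreover have "lin_ext (\<lambda>(b', b''). basis (a + c, b', b'')) (\<delta> b * \<delta> d) =
    lin_ext (\<lambda>(b', b''). basis (a, b', b'')) (\<delta> b) * lin_ext (\<lambda>(b', b''). basis (c, b', b'')) (\<delta> d)" for a b c d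
    by (rule lin_ext_mult_split) (auto simp: mult_single)
  then have "lin_ext ?G (\<delta> m * \<delta> n) = lin_ext ?G (\<delta> m) * lin_ext ?G (\<delta> n)"
    by (intro lin_ext_mult) (auto simp: coprod_add)
  ultimately show ?case
    by (simp only: coprod_add 3)
qed

lemma low: "(a, b) \<in> keys (\<delta> m - basis (m, 0)) \<Longrightarrow> wt a < wt m"
proof (induction m arbitrary: a b rule: forest_induct)
  case 1
  then show ?case by (simp add: coprod_zero flip: zero_prod_def)
next
  case (2 d m)
  then have "(a, b) \<in> keys (id_tensor (node d) (\<delta> m))"
    by (simp add: coprod_node)
  then obtain b' where "(a, b') \<in> keys (\<delta> m)"
    by (rule keys_id_tensor)
  from keys_basis_diff[OF this, of "(m, 0)"] have "wt a \<le> wt m"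
    using 2(1)[of a b'] by (elim disjE) auto
  then show ?case
    by (simp add: wt_node)
next
  case (3 m n)
  show ?case
    using low_mult[where wt = wt, OF wt_add 3(1,2)] 3(3) by (simp add: coprod_add)
qed

lemma filtered_bialg: "filtered_bialg UNIV \<delta> wt"
proof
  fix m n :: 'm assume "m + n = 0"
  then show "m = 0 \<and> n = 0" by (rule zero_sum)
next
  fix m a b assume "(a, b) \<in> keys (\<delta> m - basis (m, 0))"
  then show "wt a < wt m" by (rule low)
qed (simp_all only: coprod_zero coprod_add coassoc counit_left counit_right, simp_all)

end

primrec ptree_size :: "'d ptree \<Rightarrow> nat" where
  "ptree_size (PNode d F) = Suc (sum_list (map ptree_size F))"

primrec rtree_size :: "'d rtree \<Rightarrow> nat" where
  "rtree_size (RNode d F) = Suc (sum_mset (image_mset rtree_size F))"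

abbreviation "nck_forest_coprod F \<equiv> prod_list (map nck_coprod_tree F)"
abbreviation "ck_forest_coprod F \<equiv> prod_mset (image_mset ck_coprod_tree F)"

lemma planar_forest_induct [case_names zero node add]:
  assumes "P 0" "\<And>d F. P F \<Longrightarrow> P [PNode d F]" "\<And>F G. P F \<Longrightarrow> P G \<Longrightarrow> P (F + G)"
  shows "P F"
proof -
  have forest: "P F" if "\<And>t. t \<in> set F \<Longrightarrow> P [t]" for F
    using that
  proof (induction F)
    case (Cons t F)
    then have "P ([t] + F)" by (intro assms(3)) auto
    then show ?case by (simp add: plus_list_def)
  qed (use assms(1) in \<open>simp add: zero_list_def\<close>)
  have "P [t]" for t
    by (induction t) (auto intro: assms(2) forest)
  with forest show ?thesis by blast
qed

lemma forest_induct [case_names zero node add]: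
  assumes "P 0" "\<And>d F. P F \<Longrightarrow> P {#RNode d F#}" "\<And>F G. P F \<Longrightarrow> P G \<Longrightarrow> P (F + G)"
  shows "P F"
proof -
  have forest: "P F" if "\<And>t. t \<in># F \<Longrightarrow> P {#t#}" for F
    using that
  proof (induction F)
    case (add t F)
    then have "P ({#t#} + F)" by (intro assms(3)) auto
    then show ?case by simp
  qed (use assms(1) in simp)
  have "P {#t#}" for t
    by (induction t) (auto intro: assms(2) forest)
  with forest show ?thesis by blast
qed

interpretation nck_grafting: grafting "\<lambda>d F. [PNode d F]" "nck_forest_coprod :: _ \<Rightarrow> _ \<Rightarrow>\<^sub>0 'k::field" "\<lambda>F. sum_list (map ptree_size F)"
  by standard (auto simp: zero_list_def plus_list_def intro: planar_forest_induct[unfolded zero_list_def plus_list_def])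

interpretation ck_grafting: grafting "\<lambda>d F. {#RNode d F#}" "ck_forest_coprod :: _ \<Rightarrow> _ \<Rightarrow>\<^sub>0 'k::field" "\<lambda>F. sum_mset (image_mset rtree_size F)"
  by standard (auto intro: forest_induct)

interpretation nck: coordinates UNIV nck_forest_coprod "\<lambda>F. sum_list (map ptree_size F)"
  "H_NCK :: ('k::field, 'd ptree list \<Rightarrow>\<^sub>0 'k) bialg" "\<lambda>x. x"
  using monoid_bialg_coordinates[OF nck_grafting.filtered_bialg, of UNIV]
  by (simp add: H_NCK_def nck_coprod_def[abs_def])

interpretation ck: coordinates UNIV ck_forest_coprod "\<lambda>F. sum_mset (image_mset rtree_size F)"
  "H_CK :: ('k::field, 'd rtree multiset \<Rightarrow>\<^sub>0 'k) bialg" "\<lambda>x. x"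
  using monoid_bialg_coordinates[OF ck_grafting.filtered_bialg, of UNIV]
  by (simp add: H_CK_def ck_coprod_def[abs_def])

definition forget_basis :: "'d ptree list \<Rightarrow> ('d rtree multiset \<Rightarrow>\<^sub>0 'k::comm_ring_1)" where
  "forget_basis F = basis (mset (map forget_tree F))"

lemma forget_planar_eq: "forget_planar = lin_ext forget_basis"
  by (simp add: fun_eq_iff forget_planar_def forget_basis_def[abs_def])

lemma forget_basis_zero: "forget_basis 0 = 1"
  by (simp add: forget_basis_def zero_list_def)

lemma forget_basis_add: "forget_basis (F + G) = forget_basis F * forget_basis G"
  by (simp add: forget_basis_def plus_list_def mult_single)

lemma forget_planar_coprod:
  "map_tens forget_basis forget_basis (nck_forest_coprod F :: _ \<Rightarrow>\<^sub>0 'k::comm_ring_1) = lin_ext ck_forest_coprod (forget_basis F)"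
proof (induction F rule: planar_forest_induct)
  case zero
  show ?case
    by (simp add: zero_list_def map_tens_def forget_basis_def zero_prod_def) (simp flip: single_one add: zero_prod_def)
next
  case (node d F)
  have "map_tens forget_basis forget_basis (id_tensor (\<lambda>G. [PNode d G]) (nck_forest_coprod F)) =
    id_tensor (\<lambda>G. {#RNode d G#}) (map_tens forget_basis forget_basis (nck_forest_coprod F :: _ \<Rightarrow>\<^sub>0 'k))"
    by (simp add: map_tens_def id_tensor_def lin_ext_lin_ext case_prod_unfold forget_basis_def)
  moreover have "tens (forget_basis [PNode d F]) (forget_basis []) =
      (basis ({#RNode d (mset (map forget_tree F))#}, {#}) :: _ \<Rightarrow>\<^sub>0 'k)"
    unfolding forget_basis_def tens_basis by simp
  ultimately show ?case
    using node by (simp add: map_tens_add) (simp add: forget_basis_def)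
next
  case (add F G)
  have "map_tens forget_basis forget_basis (nck_forest_coprod F * nck_forest_coprod G) =
    map_tens forget_basis forget_basis (nck_forest_coprod F) *
    (map_tens forget_basis forget_basis (nck_forest_coprod G) :: _ \<Rightarrow>\<^sub>0 'k)"
    by (rule map_tens_mult) (simp_all add: forget_basis_add)
  also have "\<dots> = lin_ext ck_forest_coprod (forget_basis F) * lin_ext ck_forest_coprod (forget_basis G)"
    by (simp only: add)
  also have "\<dots> = lin_ext ck_forest_coprod (forget_basis (F + G))"
    unfolding forget_basis_add by (rule lin_ext_mult[symmetric]) simp
  finally show ?case
    by (simp add: plus_list_def)
qed

lemma carrier_H_CK: "carrier H_CK = UNIV"
  by (simp add: H_CK_def monoid_bialg_def)

lemma hopf_hom_forget_planar: "hopf_hom H_NCK H_CK (forget_planar :: ('d ptree list \<Rightarrow>\<^sub>0 'k::field) \<Rightarrow> _)"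
  by (rule hopf_hom_coordinates[OF nck.coordinates_axioms ck.coordinates_axioms, of forget_basis])
    (simp_all add: forget_basis_add forget_basis_zero forget_planar_coprod forget_planar_eq carrier_H_CK
      forget_basis_def lookup_single plus_list_def mult_single zero_list_def)

section \<open>The coproduct of the elements \<open>Y\<close>\<close>

definition splits :: "'a list \<Rightarrow> ('a list \<times> 'a list) set" where
  "splits w = {(w1, w2). w1 \<noteq> [] \<and> w2 \<noteq> [] \<and> w1 @ w2 = w}"

lemma finite_splits: "finite (splits w)"
proof (rule finite_subset)
  show "splits w \<subseteq> (\<lambda>k. (take k w, drop k w)) ` {..length w}"
  proof
    fix p assume "p \<in> splits w"
    then show "p \<in> (\<lambda>k. (take k w, drop k w)) ` {..length w}"
      by (intro image_eqI[where x = "length (fst p)"]) (auto simp: splits_def)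
  qed
qed simp

lemma length_splits:
  "(w1, w2) \<in> splits w \<Longrightarrow> length w1 < length w \<and> length w2 < length w \<and> w1 \<noteq> [] \<and> w2 \<noteq> []"
  by (auto simp: splits_def)

lemma Y_letter: "length w = 1 \<Longrightarrow> Y i w = (if w = [i] then 1 else 0)"
  by (simp add: Y.simps)

lemma Y_word: "2 \<le> length w \<Longrightarrow>
  Y i w = (\<Sum>\<alpha>\<in>UNIV. \<Sum>\<beta>\<in>UNIV. \<Sum>(w1, w2)\<in>splits w. Bplus (i, \<alpha>, \<beta>) (Y \<alpha> w1 * Y \<beta> w2))"
  by (subst Y.simps) (simp add: splits_def)

text \<open>A factorization \<open>w\<^sub>1 \<dots> w\<^sub>k = w\<close> and a word \<open>u\<^sub>1 \<dots> u\<^sub>k\<close>, zipped into the list of pairs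
  \<open>(u\<^sub>j, w\<^sub>j)\<close>. These lists index the terms of the Faa di Bruno coproduct; since they are words
  themselves, splitting \<open>u\<close> splits the factorization along with it.\<close>

definition factorizations :: "'n list \<Rightarrow> ('n \<times> 'n list) list set" where
  "factorizations w = {zs. (\<forall>z\<in>set zs. snd z \<noteq> []) \<and> concat (map snd zs) = w}"

lemma length_concat_nonempty:
  "(\<And>v. v \<in> set vs \<Longrightarrow> v \<noteq> []) \<Longrightarrow> length vs \<le> length (concat vs) \<and> (\<forall>v\<in>set vs. length v \<le> length (concat vs))"
proof (induction vs)
  case (Cons v vs)
  then have "length v \<ge> 1" by (cases v) auto
  with Cons show ?case by fastforce
qed simp

lemma length_factorization:
  assumes "zs \<in> factorizations w"
  shows "length zs \<le> length w" "z \<in> set zs \<Longrightarrow> length (snd z) \<le> length w"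
proof -
  have "length (map snd zs) \<le> length (concat (map snd zs)) \<and> (\<forall>v\<in>set (map snd zs). length v \<le> length (concat (map snd zs)))"
    by (rule length_concat_nonempty) (use assms in \<open>auto simp: factorizations_def\<close>)
  with assms show "length zs \<le> length w" "z \<in> set zs \<Longrightarrow> length (snd z) \<le> length w"
    by (auto simp: factorizations_def)
qed

lemma finite_factorizations: "finite (factorizations (w :: 'n::finite list))"
proof (rule finite_subset)
  let ?V = "(UNIV :: 'n set) \<times> {v :: 'n list. set v \<subseteq> UNIV \<and> length v \<le> length w}"
  show "factorizations w \<subseteq> {zs. set zs \<subseteq> ?V \<and> length zs \<le> length w}"
    by (auto dest: length_factorization)
  show "finite {zs. set zs \<subseteq> ?V \<and> length zs \<le> length w}"
    by (intro finite_lists_length_le finite_cartesian_product finite_UNIV)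
qed

lemma factorizations_nonempty:
  "zs \<in> factorizations w \<Longrightarrow> w \<noteq> [] \<Longrightarrow> zs \<noteq> []"
  by (auto simp: factorizations_def)

lemma factorizations_split:
  assumes "w \<noteq> []"
  shows "factorizations w = range (\<lambda>j. [(j, w)]) \<union> {zs \<in> factorizations w. 2 \<le> length zs}"
    (is "?A = ?B \<union> ?C")
proof
  show "?A \<subseteq> ?B \<union> ?C"
  proof
    fix zs assume zs: "zs \<in> ?A"
    show "zs \<in> ?B \<union> ?C"
    proof (cases "2 \<le> length zs")
      case False
      with factorizations_nonempty[OF zs assms] obtain z where "zs = [z]"
        by (cases zs rule: list.exhaust; cases "tl zs") auto
      with zs show ?thesis
        by (cases z) (auto simp: factorizations_def)
    qed (use zs in auto)
  qed
qed (use assms in \<open>auto simp: factorizations_def\<close>)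

text \<open>The factorizations with a single factor are set apart because they produce the term \<open>Y \<otimes> 1\<close> of the
  coproduct.\<close>

lemma sum_factorizations:
  fixes g :: "('n::finite \<times> 'n list) list \<Rightarrow> 'a::comm_monoid_add"
  assumes "w \<noteq> []"
  shows "sum g (factorizations w) =
    (\<Sum>j\<in>UNIV. g [(j, w)]) + sum g {zs \<in> factorizations w. 2 \<le> length zs}"
proof -
  have "sum g (factorizations w) = sum g (range (\<lambda>j. [(j, w)])) + sum g {zs \<in> factorizations w. 2 \<le> length zs}"
    by (subst factorizations_split[OF assms], rule sum.union_disjoint)
      (auto simp: finite_factorizations)
  also have "sum g (range (\<lambda>j. [(j, w)])) = (\<Sum>j\<in>UNIV. g [(j, w)])"
    by (subst sum.reindex) (auto simp: inj_on_def)
  finally show ?thesis .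
qed

text \<open>Both sides run over the pairs \<open>(z1, z2)\<close> of non-empty lists whose concatenation factorizes \<open>w\<close>; the
  left side groups them by the concatenation and the right side by the words that they spell.\<close>

lemma sum_splits_factorizations:
  fixes g :: "('n::finite \<times> 'n list) list \<Rightarrow> ('n \<times> 'n list) list \<Rightarrow> 'a::comm_monoid_add"
  shows "(\<Sum>zs\<in>{zs \<in> factorizations w. 2 \<le> length zs}. \<Sum>(z1, z2)\<in>splits zs. g z1 z2) =
    (\<Sum>(w1, w2)\<in>splits w. \<Sum>z1\<in>factorizations w1. \<Sum>z2\<in>factorizations w2. g z1 z2)"
proof -
  let ?F = "{zs \<in> factorizations w. 2 \<le> length zs}"
  let ?P = "{(z1, z2). z1 \<noteq> [] \<and> z2 \<noteq> [] \<and> z1 @ z2 \<in> factorizations w}"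
  have fin: "finite ?P"
  proof (rule finite_subset)
    show "?P \<subseteq> (\<Union>zs\<in>factorizations w. splits zs)"
      unfolding splits_def by blast
  qed (simp add: finite_factorizations finite_splits)
  have "(\<Sum>zs\<in>?F. \<Sum>p\<in>{p \<in> ?P. fst p @ snd p = zs}. case_prod g p) = sum (case_prod g) ?P"
  proof (rule sum.group[OF fin])
    show "(\<lambda>p. fst p @ snd p) ` ?P \<subseteq> ?F"
    proof clarify
      fix z1 z2 :: "('n \<times> 'n list) list"
      assume "z1 \<noteq> []" "z2 \<noteq> []" "z1 @ z2 \<in> factorizations w"
      then show "fst (z1, z2) @ snd (z1, z2) \<in> factorizations w \<and> 2 \<le> length (fst (z1, z2) @ snd (z1, z2))"
        by (cases z1; cases z2) auto
    qed
  qed (simp add: finite_factorizations)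
  also have "sum (case_prod g) ?P = (\<Sum>q\<in>splits w. \<Sum>p\<in>{p \<in> ?P. (concat (map snd (fst p)), concat (map snd (snd p))) = q}. case_prod g p)"
  proof (rule sum.group[OF fin finite_splits, symmetric])
    show "(\<lambda>p. (concat (map snd (fst p)), concat (map snd (snd p)))) ` ?P \<subseteq> splits w"
    proof clarify
      fix z1 z2 :: "('n \<times> 'n list) list"
      assume "z1 \<noteq> []" "z2 \<noteq> []" "z1 @ z2 \<in> factorizations w"
      then show "(concat (map snd (fst (z1, z2))), concat (map snd (snd (z1, z2)))) \<in> splits w"
        by (cases z1; cases z2) (auto simp: splits_def factorizations_def)
    qed
  qed
  also have "\<dots> = (\<Sum>(w1, w2)\<in>splits w. \<Sum>p\<in>factorizations w1 \<times> factorizations w2. case_prod g p)"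
  proof (rule sum.cong[OF refl])
    fix q assume "q \<in> splits w"
    then obtain w1 w2 where q: "q = (w1, w2)" and w: "w1 \<noteq> []" "w2 \<noteq> []" "w = w1 @ w2"
      by (auto simp: splits_def)
    have "p \<in> ?P \<and> (concat (map snd (fst p)), concat (map snd (snd p))) = q \<longleftrightarrow>
        p \<in> factorizations w1 \<times> factorizations w2" for p
      using w(1,2) unfolding q w(3) factorizations_def by (cases p) auto
    then have "{p \<in> ?P. (concat (map snd (fst p)), concat (map snd (snd p))) = q} = factorizations w1 \<times> factorizations w2"
      by blast
    then show "(\<Sum>p\<in>{p \<in> ?P. (concat (map snd (fst p)), concat (map snd (snd p))) = q}. case_prod g p) =
      (case q of (w1, w2) \<Rightarrow> \<Sum>p\<in>factorizations w1 \<times> factorizations w2. case_prod g p)"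
      by (simp add: q)
  qed
  also have "(\<Sum>zs\<in>?F. \<Sum>p\<in>{p \<in> ?P. fst p @ snd p = zs}. case_prod g p) = (\<Sum>zs\<in>?F. \<Sum>(z1, z2)\<in>splits zs. g z1 z2)"
    by (intro sum.cong) (auto simp: splits_def)
  finally show ?thesis
    by (simp add: sum.cartesian_product)
qed

lemma sum_splits_map:
  "(\<Sum>(u1, u2)\<in>splits (map h zs). g u1 u2) = (\<Sum>(z1, z2)\<in>splits zs. g (map h z1) (map h z2))"
proof -
  have "splits (map h zs) = (\<lambda>(z1, z2). (map h z1, map h z2)) ` splits zs"
  proof (intro equalityI subsetI)
    fix p assume p: "p \<in> splits (map h zs)"
    then have "map h (take (length (fst p)) zs) = fst p" "map h (drop (length (fst p)) zs) = snd p"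
      by (auto simp: splits_def append_eq_conv_conj take_map drop_map)
    with p show "p \<in> (\<lambda>(z1, z2). (map h z1, map h z2)) ` splits zs"
      by (intro image_eqI[where x = "(take (length (fst p)) zs, drop (length (fst p)) zs)"])
        (auto simp: splits_def)
  qed (auto simp: splits_def)
  moreover have "inj_on (\<lambda>(z1, z2). (map h z1, map h z2)) (splits zs)"
  proof (rule inj_onI)
    fix p q assume pq: "p \<in> splits zs" "q \<in> splits zs"
      "(\<lambda>(z1, z2). (map h z1, map h z2)) p = (\<lambda>(z1, z2). (map h z1, map h z2)) q"
    then have "length (fst p) = length (fst q)"
      by (auto simp: case_prod_unfold dest: map_eq_imp_length_eq)
    with pq show "p = q"
      by (auto simp: splits_def)
  qed
  ultimately show ?thesis
    by (simp add: sum.reindex case_prod_unfold)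
qed

definition Y_prod :: "('n::finite \<times> 'n list) list \<Rightarrow> (('n, 'k::comm_ring_1) planar)" where
  "Y_prod zs = prod_list (map (\<lambda>(j, v). Y j v) zs)"

lemma Y_prod_simps [simp]: "Y_prod [] = 1" "Y_prod ((j, v) # zs) = Y j v * Y_prod zs"
  "Y_prod (zs @ zs') = Y_prod zs * Y_prod zs'"
  by (simp_all add: Y_prod_def)

lemma nck_coprod_sum: "nck_coprod (sum g I) = (\<Sum>i\<in>I. nck_coprod (g i))"
  by (simp add: nck_coprod_def lin_ext_sum)

text \<open>The Faa di Bruno formula already holds before abelianization. By induction,
  \<open>\<Delta> (Y \<alpha> w1) \<Delta> (Y \<beta> w2)\<close> is a sum over factorizations \<open>z1\<close> and \<open>z2\<close>, and \<open>Id \<otimes> B\<close> only acts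
  on the right factors \<open>Y \<alpha> u1 \<cdot> Y \<beta> u2\<close>. After summation over \<open>w1\<close> and \<open>w2\<close> the trees over
  these right factors are those in the recursion for \<open>Y i (u1 u2)\<close>; this gives all factorizations
  with at least two factors. The remaining term \<open>Y i w \<otimes> 1\<close> is the one with a single factor.\<close>

lemma nck_coprod_Y:
  assumes "w \<noteq> []"
  shows "nck_coprod (Y i w :: _ \<Rightarrow>\<^sub>0 'k::comm_ring_1) = (\<Sum>zs\<in>factorizations w. tens (Y_prod zs) (Y i (map fst zs)))"
  using assms
proof (induction "length w" arbitrary: i w rule: less_induct)
  case less
  have one: "(\<Sum>j\<in>UNIV. tens (Y_prod [(j, w)]) (Y i (map fst [(j, w)]))) = tens (Y i w) (1 :: _ \<Rightarrow>\<^sub>0 'k)"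
  proof -
    have "tens (Y_prod [(j, w)]) (Y i (map fst [(j, w)])) = (if i = j then tens (Y i w) (1 :: _ \<Rightarrow>\<^sub>0 'k) else 0)" for j
      by (simp add: Y_letter tens_simps)
    then show ?thesis by simp
  qed
  show ?case
  proof (cases "2 \<le> length w")
    case False
    with less.prems obtain a where w: "w = [a]"
      by (cases w; cases "tl w") auto
    have "\<not> 2 \<le> length zs" if "zs \<in> factorizations w" for zs
      using length_factorization(1)[OF that] False by simp
    then have empty: "{zs \<in> factorizations w. 2 \<le> length zs} = {}" by auto
    have "nck_coprod (Y i w :: _ \<Rightarrow>\<^sub>0 'k) = tens (Y i w) 1"
      by (simp add: w Y_letter nck_coprod_mult tens_one tens_simps) (simp add: nck_coprod_def)
    then show ?thesis
      unfolding sum_factorizations[OF less.prems] one empty by simp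
  next
    case True
    let ?T = "\<lambda>zs j. tens (Y_prod zs) (Y j (map fst zs)) :: _ \<Rightarrow>\<^sub>0 'k"
    have IH: "nck_coprod (Y \<alpha> w1 * Y \<beta> w2 :: _ \<Rightarrow>\<^sub>0 'k) =
        (\<Sum>z1\<in>factorizations w1. \<Sum>z2\<in>factorizations w2.
          tens (Y_prod (z1 @ z2)) (Y \<alpha> (map fst z1) * Y \<beta> (map fst z2)))"
      if "(w1, w2) \<in> splits w" for \<alpha> \<beta> w1 w2
      using less.hyps[of w1 \<alpha>] less.hyps[of w2 \<beta>] length_splits[OF that]
      by (simp add: nck_coprod_mult sum_product tens_mult)
    have step: "nck_coprod (Bplus (i, \<alpha>, \<beta>) (Y \<alpha> w1 * Y \<beta> w2) :: _ \<Rightarrow>\<^sub>0 'k) =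
        tens (Bplus (i, \<alpha>, \<beta>) (Y \<alpha> w1 * Y \<beta> w2)) 1 +
        (\<Sum>z1\<in>factorizations w1. \<Sum>z2\<in>factorizations w2.
          tens (Y_prod (z1 @ z2)) (Bplus (i, \<alpha>, \<beta>) (Y \<alpha> (map fst z1) * Y \<beta> (map fst z2))))"
      if "(w1, w2) \<in> splits w" for \<alpha> \<beta> w1 w2
      unfolding nck_coprod_Bplus IH[OF that]
      by (simp add: tensor_eq_tens id_tensor_def lin_ext_sum)
        (simp add: flip: id_tensor_def id_tensor_Bplus tensor_eq_tens)
    have "nck_coprod (Y i w :: _ \<Rightarrow>\<^sub>0 'k) = (\<Sum>\<alpha>\<in>UNIV. \<Sum>\<beta>\<in>UNIV. \<Sum>(w1, w2)\<in>splits w.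
        tens (Bplus (i, \<alpha>, \<beta>) (Y \<alpha> w1 * Y \<beta> w2)) 1 +
        (\<Sum>z1\<in>factorizations w1. \<Sum>z2\<in>factorizations w2.
          tens (Y_prod (z1 @ z2)) (Bplus (i, \<alpha>, \<beta>) (Y \<alpha> (map fst z1) * Y \<beta> (map fst z2)))))"
      unfolding Y_word[OF True] nck_coprod_sum
      by (intro sum.cong refl) (auto simp: nck_coprod_sum step)
    also have "\<dots> = tens (Y i w) 1 + (\<Sum>\<alpha>\<in>UNIV. \<Sum>\<beta>\<in>UNIV. \<Sum>(w1, w2)\<in>splits w.
        (\<Sum>z1\<in>factorizations w1. \<Sum>z2\<in>factorizations w2.
          tens (Y_prod (z1 @ z2)) (Bplus (i, \<alpha>, \<beta>) (Y \<alpha> (map fst z1) * Y \<beta> (map fst z2)))))"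
      unfolding Y_word[OF True] by (simp add: sum.distrib case_prod_unfold tens_sum)
    also have "(\<Sum>\<alpha>\<in>UNIV. \<Sum>\<beta>\<in>UNIV. \<Sum>(w1, w2)\<in>splits w.
        (\<Sum>z1\<in>factorizations w1. \<Sum>z2\<in>factorizations w2.
          tens (Y_prod (z1 @ z2)) (Bplus (i, \<alpha>, \<beta>) (Y \<alpha> (map fst z1) * Y \<beta> (map fst z2) :: _ \<Rightarrow>\<^sub>0 'k)))) =
        (\<Sum>\<alpha>\<in>UNIV. \<Sum>\<beta>\<in>UNIV. \<Sum>zs\<in>{zs \<in> factorizations w. 2 \<le> length zs}. \<Sum>(z1, z2)\<in>splits zs.
          tens (Y_prod (z1 @ z2)) (Bplus (i, \<alpha>, \<beta>) (Y \<alpha> (map fst z1) * Y \<beta> (map fst z2))))"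
      by (simp only: sum_splits_factorizations)
    also have "\<dots> = (\<Sum>zs\<in>{zs \<in> factorizations w. 2 \<le> length zs}. \<Sum>\<alpha>\<in>UNIV. \<Sum>\<beta>\<in>UNIV. \<Sum>(z1, z2)\<in>splits zs.
          tens (Y_prod (z1 @ z2)) (Bplus (i, \<alpha>, \<beta>) (Y \<alpha> (map fst z1) * Y \<beta> (map fst z2))))"
      by (simp only: sum.swap[of _ "{zs \<in> factorizations w. 2 \<le> length zs}"])
    also have "\<dots> = (\<Sum>zs\<in>{zs \<in> factorizations w. 2 \<le> length zs}. ?T zs i)"
    proof (rule sum.cong[OF refl])
      fix zs assume "zs \<in> {zs \<in> factorizations w. 2 \<le> length zs}"
      then have "2 \<le> length (map fst zs)" by simp
      then have "Y i (map fst zs) = (\<Sum>\<alpha>\<in>UNIV. \<Sum>\<beta>\<in>UNIV. \<Sum>(z1, z2)\<in>splits zs.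
          Bplus (i, \<alpha>, \<beta>) (Y \<alpha> (map fst z1) * Y \<beta> (map fst z2)) :: _ \<Rightarrow>\<^sub>0 'k)"
        by (simp only: Y_word[of "map fst zs"] sum_splits_map)
      then have "?T zs i = (\<Sum>\<alpha>\<in>UNIV. \<Sum>\<beta>\<in>UNIV. \<Sum>(z1, z2)\<in>splits zs.
          tens (Y_prod zs) (Bplus (i, \<alpha>, \<beta>) (Y \<alpha> (map fst z1) * Y \<beta> (map fst z2))))"
        by (simp only: tens_sum case_prod_unfold)
      also have "\<dots> = (\<Sum>\<alpha>\<in>UNIV. \<Sum>\<beta>\<in>UNIV. \<Sum>(z1, z2)\<in>splits zs.
          tens (Y_prod (z1 @ z2)) (Bplus (i, \<alpha>, \<beta>) (Y \<alpha> (map fst z1) * Y \<beta> (map fst z2))))"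
        by (intro sum.cong refl) (auto simp: splits_def)
      finally show "(\<Sum>\<alpha>\<in>UNIV. \<Sum>\<beta>\<in>UNIV. \<Sum>(z1, z2)\<in>splits zs.
          tens (Y_prod (z1 @ z2)) (Bplus (i, \<alpha>, \<beta>) (Y \<alpha> (map fst z1) * Y \<beta> (map fst z2)))) = ?T zs i" ..
    qed
    finally show ?thesis
      unfolding sum_factorizations[OF less.prems] one .
  qed
qed

section \<open>Algebraic independence of the non-planar images\<close>

lemma forget_planar_simps:
  "forget_planar 0 = 0" "forget_planar 1 = 1"
  "forget_planar (x + y) = forget_planar x + forget_planar y"
  "forget_planar (x - y) = forget_planar x - forget_planar y"
  "forget_planar (x * y) = forget_planar x * forget_planar y"
  "forget_planar (scale c x) = scale c (forget_planar x)"
  "forget_planar (sum g I) = (\<Sum>i\<in>I. forget_planar (g i))"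
  by (simp_all add: forget_planar_eq lin_ext_add lin_ext_diff lin_ext_scale lin_ext_sum lin_ext_mult
      forget_basis_add forget_basis_zero)

lemma forget_planar_Bplus: "forget_planar (Bplus d x) = Bplus_c d (forget_planar x)"
  by (simp add: forget_planar_def Bplus_def Bplus_c_def lin_ext_lin_ext)

definition Yc :: "'n::finite \<Rightarrow> 'n list \<Rightarrow> (('n, 'k::comm_ring_1) nonplanar)" where
  "Yc i w = forget_planar (Y i w)"

lemma Yc_letter: "length w = 1 \<Longrightarrow> Yc i w = (if w = [i] then 1 else 0)"
  by (simp add: Yc_def Y_letter forget_planar_simps)

lemma Yc_word: "2 \<le> length w \<Longrightarrow>
  Yc i w = (\<Sum>\<alpha>\<in>UNIV. \<Sum>\<beta>\<in>UNIV. \<Sum>(w1, w2)\<in>splits w. Bplus_c (i, \<alpha>, \<beta>) (Yc \<alpha> w1 * Yc \<beta> w2))"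
  by (simp add: Yc_def Y_word forget_planar_simps forget_planar_Bplus case_prod_unfold)

lemma keys_Bplus_c: "keys (Bplus_c d x) \<subseteq> range (\<lambda>t. {#t#})"
  unfolding Bplus_c_def by (rule keys_lin_ext_subset) auto

lemma lookup_Bplus_c:
  "lookup (Bplus_c d x) {#RNode d' F#} = (if d = d' then lookup x F else 0)"
  unfolding Bplus_c_def
  by (induction x rule: basis_induct) (auto simp: lin_ext_add lin_ext_scale lookup_add lookup_single when_def)

lemma lookup_Bplus_c_zero: "lookup (Bplus_c d x) {#} = 0"
  using keys_Bplus_c[of d x] by (auto simp: in_keys_iff subset_iff)

lemma lookup_mult_tree:
  fixes x y :: "'t multiset \<Rightarrow>\<^sub>0 'k::comm_ring_1"
  shows "lookup (x * y) {#t#} =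
    lookup x {#t#} * lookup y {#} + lookup x {#} * lookup y {#t#}"
proof (induction x rule: basis_induct)
  case (add m c x)
  have "lookup (basis m * y) {#t#} =
    lookup (basis m) {#t#} * lookup y {#} + lookup (basis m) {#} * lookup y {#t#}"
  proof (induction y rule: basis_induct)
    case (add n d y)
    have "lookup (basis (m + n) :: _ \<Rightarrow>\<^sub>0 'k) {#t#} =
      lookup (basis m) {#t#} * lookup (basis n) {#} + lookup (basis m) {#} * lookup (basis n) {#t#}"
      by (auto simp: lookup_single when_def union_is_single)
    with add show ?case
      by (simp add: distrib_left lookup_add scale_mult mult_single algebra_simps)
  qed simp
  with add show ?case
    by (simp add: distrib_right lookup_add scale_mult algebra_simps)
qed simp

lemma lookup_mult_empty:
  fixes x y :: "'t multiset \<Rightarrow>\<^sub>0 'k::comm_ring_1"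
  shows "lookup (x * y) {#} = lookup x {#} * lookup y {#}"
  using lookup_zero_mult[of x y] by simp

lemma lookup_Yc_empty:
  assumes "w \<noteq> []"
  shows "lookup (Yc i w :: _ \<Rightarrow>\<^sub>0 'k::comm_ring_1) {#} = (if w = [i] then 1 else 0)"
proof (cases "2 \<le> length w")
  case True
  then show ?thesis
    by (auto simp: Yc_word lookup_sum lookup_Bplus_c_zero case_prod_unfold)
next
  case False
  with assms have "length w = 1" by (cases w; cases "tl w") auto
  then show ?thesis
    by (simp add: Yc_letter lookup_one)
qed

lemma keys_Yc:
  assumes "2 \<le> length w"
  shows "keys (Yc i w) \<subseteq> range (\<lambda>t. {#t#})"
  unfolding Yc_word[OF assms] case_prod_unfold by (intro keys_sum_subset keys_Bplus_c)

text \<open>For a one-letter alphabet, where no other letter exists, the value is \<open>a\<close> itself.\<close>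

definition other_letter :: "'n \<Rightarrow> 'n" where
  "other_letter a = (if \<exists>b. b \<noteq> a then SOME b. b \<noteq> a else a)"

lemma other_letter_eq: "other_letter a = a \<Longrightarrow> b = a"
  unfolding other_letter_def by (metis (mono_tags, lifting) someI)

text \<open>The tree without branching in which the letters of \<open>w\<close> are split off one by one from the left. A
  vertex with a single child, decorated by \<open>(i, a, c)\<close>, can arise from splitting off a first letter
  \<open>a\<close> or a last letter \<open>c\<close>. The decoration \<open>c\<close> of the remaining word is chosen different from \<open>a\<close> if
  the alphabet permits, so that the decoration of the child, which starts with \<open>c\<close>, excludes the
  second possibility.\<close>

fun ladder :: "'n \<Rightarrow> 'n list \<Rightarrow> ('n \<times> 'n \<times> 'n) rtree multiset" where
  "ladder i (a # b # v) =
    (let c = (if v = [] then b else other_letter a) in {#RNode (i, a, c) (ladder c (b # v))#})"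
| "ladder i w = {#}"

text \<open>The ladder of \<open>w\<close> only occurs in the element for \<open>i\<close> and \<open>w\<close>. If the alphabet has at least two
  letters, its coefficient there is 1. If it has one letter, each step can be made on either side, so
  the coefficient is a power of 2, which is not zero in characteristic zero, and words are determined
  by their length.\<close>

lemma lookup_Yc_ladder:
  fixes i :: "'n::finite"
  assumes "2 \<le> length w"
  shows "\<exists>c. c \<noteq> 0 \<and> (\<forall>j w'. w' \<noteq> [] \<longrightarrow>
    lookup (Yc j w' :: _ \<Rightarrow>\<^sub>0 'k::field_char_0) (ladder i w) = (if j = i \<and> w' = w then c else 0))"
  using assms
proof (induction w arbitrary: i rule: induct_list012)
  case (3 a b v)
  let ?b = "if v = [] then b else other_letter a"
  let ?G = "ladder ?b (b # v)"
  have lad: "ladder i (a # b # v) = {#RNode (i, a, ?b) ?G#}"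
    by (simp add: Let_def)
  have red: "lookup (Yc j w' :: _ \<Rightarrow>\<^sub>0 'k) (ladder i (a # b # v)) =
     (if j = i then \<Sum>(w1, w2)\<in>splits w'. lookup (Yc a w1 * Yc ?b w2) ?G else 0)"
    if "2 \<le> length w'" for j w'
  proof -
    have "lookup (Yc j w' :: _ \<Rightarrow>\<^sub>0 'k) (ladder i (a # b # v)) =
      (\<Sum>\<alpha>\<in>UNIV. \<Sum>\<beta>\<in>UNIV. if \<beta> = ?b then if \<alpha> = a then if j = i then
         \<Sum>(w1, w2)\<in>splits w'. lookup (Yc a w1 * Yc ?b w2) ?G else 0 else 0 else 0)"
      unfolding lad Yc_word[OF that] lookup_sum case_prod_unfold
      by (intro sum.cong refl) (auto simp: lookup_Bplus_c)
    then show ?thesis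
      by (simp only: sum.delta finite_UNIV if_True UNIV_I)
  qed
  have letter: "lookup (Yc j w' :: _ \<Rightarrow>\<^sub>0 'k) (ladder i (a # b # v)) = 0" if "length w' = 1" for j w'
    using that by (simp add: Yc_letter lookup_one Let_def)
  have main: "\<exists>c. c \<noteq> 0 \<and> (\<forall>w'. 2 \<le> length w' \<longrightarrow>
    (\<Sum>(w1, w2)\<in>splits w'. lookup (Yc a w1 * Yc ?b w2 :: _ \<Rightarrow>\<^sub>0 'k) ?G) = (if w' = a # b # v then c else 0))"
  proof (cases "v = []")
    case True
    have "(\<Sum>(w1, w2)\<in>splits w'. lookup (Yc a w1 * Yc ?b w2 :: _ \<Rightarrow>\<^sub>0 'k) ?G) = (if w' = a # b # v then 1 else 0)" for w'
    proof -
      have "(\<Sum>(w1, w2)\<in>splits w'. lookup (Yc a w1 * Yc ?b w2 :: _ \<Rightarrow>\<^sub>0 'k) ?G) =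
        (\<Sum>p\<in>splits w'. if p = ([a], [b]) then 1 else 0)"
        using True by (intro sum.cong refl) (auto simp: lookup_mult_empty lookup_Yc_empty split: if_splits dest!: length_splits)
      also have "\<dots> = (if w' = a # b # v then 1 else 0)"
        unfolding sum.delta[OF finite_splits] using True by (auto simp: splits_def)
      finally show ?thesis .
    qed
    then show ?thesis
      by (intro exI[of _ 1]) auto
  next
    case False
    then have len: "2 \<le> length (b # v)" by (cases v) auto
    obtain t where G: "?G = {#t#}"
      using False by (cases v) (auto simp: Let_def)
    obtain c :: 'k where c: "c \<noteq> 0" "\<And>j w'. w' \<noteq> [] \<Longrightarrow>
        lookup (Yc j w') ?G = (if j = ?b \<and> w' = b # v then c else 0)"
      using 3(2)[OF len, of ?b] by blast
    have sum: "(\<Sum>(w1, w2)\<in>splits w'. lookup (Yc a w1 * Yc ?b w2 :: _ \<Rightarrow>\<^sub>0 'k) ?G) =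
        (if a = ?b \<and> w' = (b # v) @ [?b] then c else 0) + (if w' = a # b # v then c else 0)" for w'
    proof -
      have "lookup (Yc a w1 * Yc ?b w2 :: _ \<Rightarrow>\<^sub>0 'k) ?G =
          (if (w1, w2) = (b # v, [?b]) then if a = ?b then c else 0 else 0) + (if (w1, w2) = ([a], b # v) then c else 0)"
        if "(w1, w2) \<in> splits w'" for w1 w2
      proof -
        have "w1 \<noteq> []" "w2 \<noteq> []"
          using length_splits[OF that] by auto
        then show ?thesis
          using c(2)[of w1 a] c(2)[of w2 ?b]
          unfolding G lookup_mult_tree by (auto simp: lookup_Yc_empty)
      qed
      note summand = this
      have "(\<Sum>(w1, w2)\<in>splits w'. lookup (Yc a w1 * Yc ?b w2 :: _ \<Rightarrow>\<^sub>0 'k) ?G) =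
        (\<Sum>p\<in>splits w'. (if p = (b # v, [?b]) then if a = ?b then c else 0 else 0) + (if p = ([a], b # v) then c else 0))"
        by (rule sum.cong[OF refl], simp only: split_paired_all prod.case, rule summand)
      also have "\<dots> = (\<Sum>p\<in>splits w'. if p = (b # v, [?b]) then if a = ?b then c else 0 else 0) + (\<Sum>p\<in>splits w'. if p = ([a], b # v) then c else 0)"
        by (rule sum.distrib)
      also have "\<dots> = (if a = ?b \<and> w' = (b # v) @ [?b] then c else 0) + (if w' = a # b # v then c else 0)"
        unfolding sum.delta[OF finite_splits] by (auto simp: splits_def)
      finally show ?thesis .
    qed
    show ?thesis
    proof (cases "a = ?b")
      case True
      \<comment> \<open>The alphabet has one letter, and both summands are attained at the same word.\<close>
      then have "other_letter a = a" using False by simp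
      then have one_letter: "x = y" for x y :: 'n
        using other_letter_eq[of a x] other_letter_eq[of a y] by simp
      have eq: "(b # v) @ [?b] = a # b # v"
        by (rule nth_equalityI) (simp, rule one_letter)
      have "a = ?b \<and> w' = (b # v) @ [?b] \<longleftrightarrow> w' = a # b # v" for w'
        unfolding eq using True by blast
      then have "(if a = ?b \<and> w' = (b # v) @ [?b] then c else 0) + (if w' = a # b # v then c else 0) =
          (if w' = a # b # v then 2 * c else 0)" for w'
        by (simp only: mult_2 split: if_split) simp
      with c(1) show ?thesis
        unfolding sum by (intro exI[of _ "2 * c"]) simp
    next
      case neq: False
      then show ?thesis
        unfolding sum using c(1) by (intro exI[of _ c]) (simp only: if_False simp_thms add_0)
    qed
  qed
  then obtain c :: 'k where c: "c \<noteq> 0" "\<And>w'. 2 \<le> length w' \<Longrightarrow>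
      (\<Sum>(w1, w2)\<in>splits w'. lookup (Yc a w1 * Yc ?b w2) ?G) = (if w' = a # b # v then c else 0)"
    by blast
  have "lookup (Yc j w' :: _ \<Rightarrow>\<^sub>0 'k) (ladder i (a # b # v)) = (if j = i \<and> w' = a # b # v then c else 0)"
    if "w' \<noteq> []" for j w'
  proof (cases "2 \<le> length w'")
    case True
    show ?thesis
      unfolding red[OF True] c(2)[OF True] by simp
  next
    case False
    with that have "length w' = 1" by (cases w'; cases "tl w'") auto
    with letter[OF this] show ?thesis by auto
  qed
  with c(1) show ?case by blast
qed simp_all

lemma lookup_Yc_ladder_nonzero:
  assumes "2 \<le> length w" "w' \<noteq> []"
  shows "lookup (Yc j w' :: _ \<Rightarrow>\<^sub>0 'k::field_char_0) (ladder i w) \<noteq> 0 \<longleftrightarrow> j = i \<and> w' = w"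
  using lookup_Yc_ladder[OF assms(1), of i, where 'k = 'k] assms(2) by (auto split: if_splits)

lemma ladder_tree: "2 \<le> length w \<Longrightarrow> \<exists>t. ladder i w = {#t#}"
  by (cases "(i, w)" rule: ladder.cases) (auto simp: Let_def)

definition ladder_coeff :: "('n::finite \<times> 'n list) \<Rightarrow> 'k::field_char_0" where
  "ladder_coeff = (\<lambda>(i, w). lookup (Yc i w) (ladder i w))"

text \<open>The retraction of the polynomial map \<open>y \<mapsto> Yc\<close>: ladders are sent to the corresponding variables,
  up to their coefficients, and all other trees to zero.\<close>

definition read_tree :: "('n::finite \<times> 'n \<times> 'n) rtree \<Rightarrow> (('n \<times> 'n list) multiset \<Rightarrow>\<^sub>0 'k::field_char_0)" where
  "read_tree t = (if \<exists>i w. 2 \<le> length w \<and> ladder i w = {#t#}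
     then let z = (SOME z. 2 \<le> length (snd z) \<and> ladder (fst z) (snd z) = {#t#})
       in Poly_Mapping.single {#z#} (inverse (ladder_coeff z))
     else 0)"

definition read_forest :: "('n::finite \<times> 'n \<times> 'n) rtree multiset \<Rightarrow> (('n \<times> 'n list) multiset \<Rightarrow>\<^sub>0 'k::field_char_0)" where
  "read_forest F = prod_mset (image_mset read_tree F)"

lemma read_forest_add: "read_forest (F + G) = read_forest F * read_forest G"
  by (simp add: read_forest_def)

lemma ladder_inj:
  fixes i j :: "'n::finite"
  assumes "2 \<le> length w" "2 \<le> length w'" "ladder i w = ladder j w'"
  shows "i = j \<and> w = w'"
proof -
  have "w \<noteq> []" using assms by auto
  then have "lookup (Yc i w :: _ \<Rightarrow>\<^sub>0 rat) (ladder i w) \<noteq> 0"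
    using lookup_Yc_ladder_nonzero[OF assms(1), of w i i] by blast
  then show ?thesis
    unfolding assms(3) using lookup_Yc_ladder_nonzero[OF assms(2) \<open>w \<noteq> []\<close>, of i j] by blast
qed

lemma read_tree_ladder:
  assumes "2 \<le> length w" "ladder i w = {#t#}"
  shows "read_tree t = Poly_Mapping.single {#(i, w)#} (inverse (ladder_coeff (i, w)))"
proof -
  have "(SOME z. 2 \<le> length (snd z) \<and> ladder (fst z) (snd z) = {#t#}) = (i, w)"
  proof (rule some_equality)
    fix z assume z: "2 \<le> length (snd z) \<and> ladder (fst z) (snd z) = {#t#}"
    with assms have "ladder (fst z) (snd z) = ladder i w" by simp
    from ladder_inj[OF _ assms(1) this] z show "z = (i, w)"
      by (simp add: prod_eq_iff)
  qed (use assms in simp)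
  moreover have "\<exists>i w. 2 \<le> length w \<and> ladder i w = {#t#}"
    using assms by blast
  ultimately show ?thesis
    by (simp only: read_tree_def if_True Let_def)
qed

text \<open>The element \<open>Yc i w\<close> is a linear combination of single trees, and \<open>ladder i w\<close> is the only one of
  them that is the ladder of some word.\<close>

lemma read_Yc:
  assumes w: "2 \<le> length w"
  shows "lin_ext read_forest (Yc i w) = (basis {#(i, w)#} :: _ \<Rightarrow>\<^sub>0 'k::field_char_0)"
proof -
  obtain t where t: "ladder i w = {#t#}"
    using ladder_tree[OF w] by blast
  have "w \<noteq> []" using w by auto
  then have nz: "lookup (Yc i w :: _ \<Rightarrow>\<^sub>0 'k) (ladder i w) \<noteq> 0"
    using lookup_Yc_ladder_nonzero[OF w, of w i i] by blast
  then have c: "(ladder_coeff (i, w) :: 'k) \<noteq> 0"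
    by (simp add: ladder_coeff_def)
  have zero: "(read_forest F :: _ \<Rightarrow>\<^sub>0 'k) = 0" if F: "F \<in> keys (Yc i w :: _ \<Rightarrow>\<^sub>0 'k)" "F \<noteq> ladder i w" for F
  proof -
    obtain s where s: "F = {#s#}"
      using keys_Yc[OF w] F by blast
    have "ladder j w' \<noteq> {#s#}" if "2 \<le> length w'" for j w'
    proof
      assume lad: "ladder j w' = {#s#}"
      have "w \<noteq> []" using w by auto
      from F(1) have "lookup (Yc i w :: _ \<Rightarrow>\<^sub>0 'k) (ladder j w') \<noteq> 0"
        by (simp add: lad s in_keys_iff)
      then have "i = j \<and> w = w'"
        using lookup_Yc_ladder_nonzero[OF that \<open>w \<noteq> []\<close>] by blast
      with F(2) lad s show False by simp
    qed
    then have "\<not> (\<exists>i w. 2 \<le> length w \<and> ladder i w = {#s#})" by blast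
    then have "read_tree s = 0"
      by (simp only: read_tree_def if_False)
    then show ?thesis
      by (simp add: s read_forest_def)
  qed
  have "lin_ext read_forest (Yc i w :: _ \<Rightarrow>\<^sub>0 'k) =
      (\<Sum>F\<in>{ladder i w}. scale (lookup (Yc i w) F) (read_forest F))"
    unfolding lin_ext_def
  proof (rule sum.mono_neutral_right)
    show "{ladder i w} \<subseteq> keys (Yc i w :: _ \<Rightarrow>\<^sub>0 'k)"
      using nz by (simp add: in_keys_iff)
    show "\<forall>F\<in>keys (Yc i w :: _ \<Rightarrow>\<^sub>0 'k) - {ladder i w}.
        scale (lookup (Yc i w :: _ \<Rightarrow>\<^sub>0 'k) F) (read_forest F) = 0"
    proof
      fix F assume "F \<in> keys (Yc i w :: _ \<Rightarrow>\<^sub>0 'k) - {ladder i w}"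
      with zero[of F] show "scale (lookup (Yc i w :: _ \<Rightarrow>\<^sub>0 'k) F) (read_forest F) = 0"
        by simp
    qed
  qed simp
  also have "\<dots> = scale (ladder_coeff (i, w)) (read_forest {#t#})"
    by (simp add: ladder_coeff_def t)
  also have "\<dots> = basis {#(i, w)#}"
    using c by (simp add: read_forest_def read_tree_ladder[OF w t] scale_single)
  finally show ?thesis .
qed

section \<open>The free Faa di Bruno Hopf algebra\<close>

definition fdb_monomials :: "('n \<times> 'n list) multiset set" where
  "fdb_monomials = {m. \<forall>(i, w)\<in>set_mset m. 2 \<le> length w}"

definition Yc_prod :: "('n::finite \<times> 'n list) multiset \<Rightarrow> (('n, 'k::comm_ring_1) nonplanar)" where
  "Yc_prod m = prod_mset (image_mset (\<lambda>(i, w). Yc i w) m)"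

abbreviation "fdb_mono_coprod m \<equiv> prod_mset (image_mset fdb_coprod_var m)"

lemma Yc_prod_simps: "Yc_prod 0 = 1" "Yc_prod (m + n) = Yc_prod m * Yc_prod n"
  by (simp_all add: Yc_prod_def)

lemma fdb_carrier_eq: "fdb_carrier = {x. keys x \<subseteq> fdb_monomials}"
  by (auto simp: fdb_carrier_def fdb_monomials_def)

lemma fdb_monomials_zero: "0 \<in> fdb_monomials"
  and fdb_monomials_add: "m + n \<in> fdb_monomials \<longleftrightarrow> m \<in> fdb_monomials \<and> n \<in> fdb_monomials"
  and fdb_monomials_add_mset: "add_mset z m \<in> fdb_monomials \<longleftrightarrow> 2 \<le> length (snd z) \<and> m \<in> fdb_monomials"
  by (auto simp: fdb_monomials_def)

lemma read_Yc_prod: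
  assumes "m \<in> fdb_monomials"
  shows "lin_ext read_forest (Yc_prod m) = (basis m :: _ \<Rightarrow>\<^sub>0 'k::field_char_0)"
  using assms
proof (induction m)
  case empty
  then show ?case by (simp add: Yc_prod_def read_forest_def)
next
  case (add z m)
  have "lin_ext read_forest (Yc_prod (add_mset z m) :: _ \<Rightarrow>\<^sub>0 'k) =
      lin_ext read_forest (Yc (fst z) (snd z)) * lin_ext read_forest (Yc_prod m)"
    by (simp add: Yc_prod_def case_prod_unfold lin_ext_mult[of read_forest, OF read_forest_add])
  also have "\<dots> = basis {#z#} * basis m"
    using add by (simp add: read_Yc fdb_monomials_add_mset)
  finally show ?case
    by (simp add: mult_single)
qed

lemma Yc_prod_fdb_y: "w \<noteq> [] \<Longrightarrow> lin_ext Yc_prod (fdb_y i w) = Yc i w"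
  by (auto simp: fdb_y_def Yc_prod_def Yc_letter)

lemma fdb_y_keys: "w \<noteq> [] \<Longrightarrow> keys (fdb_y i w) \<subseteq> fdb_monomials"
  by (cases w; cases "tl w") (auto simp: fdb_y_def fdb_monomials_def)

lemma fdb_y_prod_keys:
  assumes "\<forall>z\<in>set zs. snd z \<noteq> []"
  shows "keys (prod_list (map (\<lambda>(j, v). fdb_y j v) zs) :: _ \<Rightarrow>\<^sub>0 'k::comm_ring_1) \<subseteq> fdb_monomials"
  using assms
proof (induction zs)
  case (Cons z zs)
  obtain j v where z: "z = (j, v)" by (cases z)
  have "keys (fdb_y j v * prod_list (map (\<lambda>(j, v). fdb_y j v) zs) :: _ \<Rightarrow>\<^sub>0 'k) \<subseteq> fdb_monomials"
    using Cons by (intro keys_mult_subset fdb_y_keys) (simp_all add: z fdb_monomials_add)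
  then show ?case
    by (simp add: z)
qed (simp add: fdb_monomials_zero)

lemma fdb_coprod_var_eq:
  "fdb_coprod_var (i, w :: 'n::finite list) =
    (\<Sum>zs\<in>factorizations w. tens (prod_list (map (\<lambda>(j, v). fdb_y j v) zs)) (fdb_y i (map fst zs) :: _ \<Rightarrow>\<^sub>0 'k::comm_ring_1))"
proof -
  let ?W = "{ws. [] \<notin> set ws \<and> concat ws = w}"
  have "?W \<subseteq> map snd ` factorizations w"
  proof
    fix ws assume ws: "ws \<in> ?W"
    then have "map (Pair undefined) ws \<in> factorizations w" "ws = map snd (map (Pair undefined) ws)"
      by (auto simp: factorizations_def comp_def)
    then show "ws \<in> map snd ` factorizations w" by blast
  qed
  then have fin: "finite ?W"
    using finite_factorizations by (rule finite_surj[rotated])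
  have fin': "finite {u :: 'n list. length u = length ws}" for ws :: "'n list list"
    using finite_lists_length_eq[of "UNIV :: 'n set" "length ws"] by simp
  have "fdb_coprod_var (i, w) = (\<Sum>(ws, u)\<in>(SIGMA ws:?W. {u. length u = length ws}).
      tens (\<Prod>j<length ws. fdb_y (u ! j) (ws ! j)) (fdb_y i u) :: _ \<Rightarrow>\<^sub>0 'k)"
    unfolding fdb_coprod_var_def by (simp add: tensor_eq_tens sum.Sigma fin fin')
  also have "\<dots> = (\<Sum>zs\<in>factorizations w. tens (prod_list (map (\<lambda>(j, v). fdb_y j v) zs)) (fdb_y i (map fst zs)))"
  proof (rule sum.reindex_bij_witness[where i = "\<lambda>zs. (map snd zs, map fst zs)" and j = "\<lambda>(ws, u). zip u ws"])
    fix p assume p: "p \<in> (SIGMA ws:?W. {u :: 'n list. length u = length ws})"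
    obtain ws u where wu: "p = (ws, u)" by (cases p)
    with p have len: "length u = length ws" and ws: "[] \<notin> set ws" "concat ws = w" by auto
    show "(map snd (case p of (ws, u) \<Rightarrow> zip u ws), map fst (case p of (ws, u) \<Rightarrow> zip u ws)) = p"
      using len by (simp add: wu)
    show "(case p of (ws, u) \<Rightarrow> zip u ws) \<in> factorizations w"
      using len ws by (auto simp: wu factorizations_def dest: set_zip_rightD)
    show "tens (prod_list (map (\<lambda>(j, v). fdb_y j v) (case p of (ws, u) \<Rightarrow> zip u ws)))
        (fdb_y i (map fst (case p of (ws, u) \<Rightarrow> zip u ws))) =
      (case p of (ws, u) \<Rightarrow> (tens (\<Prod>j<length ws. fdb_y (u ! j) (ws ! j)) (fdb_y i u) :: _ \<Rightarrow>\<^sub>0 'k))"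
      using len by (simp add: wu prod.list_conv_set_nth lessThan_atLeast0)
  qed (auto simp: factorizations_def zip_map_fst_snd)
  finally show ?thesis .
qed

lemma ck_coprod_forget: "ck_coprod (forget_planar x) = map_tens forget_basis forget_basis (nck_coprod x)"
proof -
  have "ck_coprod (forget_planar x) = lin_ext (\<lambda>F. lin_ext ck_forest_coprod (forget_basis F)) x"
    by (simp add: ck_coprod_def forget_planar_eq lin_ext_lin_ext)
  also have "\<dots> = map_tens forget_basis forget_basis (nck_coprod x)"
    unfolding forget_planar_coprod[symmetric] by (simp add: map_tens_def nck_coprod_def lin_ext_lin_ext)
  finally show ?thesis .
qed

lemma forget_planar_Y_prod: "forget_planar (Y_prod zs) = prod_list (map (\<lambda>(j, v). Yc j v) zs)"
  by (induction zs) (auto simp: forget_planar_simps Yc_def)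

lemma ck_coprod_Yc:
  assumes "w \<noteq> []"
  shows "ck_coprod (Yc i w) = (\<Sum>zs\<in>factorizations w. tens (prod_list (map (\<lambda>(j, v). Yc j v) zs)) (Yc i (map fst zs)))"
  unfolding Yc_def[of i] ck_coprod_forget nck_coprod_Y[OF assms] map_tens_sum map_tens_tens
  by (simp flip: forget_planar_eq add: forget_planar_Y_prod)

text \<open>The morphism \<open>y \<mapsto> Yc\<close> respects coproducts, as both are given by the same sum.\<close>

lemma fdb_coprod_var_Yc:
  assumes "w \<noteq> []"
  shows "map_tens Yc_prod Yc_prod (fdb_coprod_var (i, w)) = ck_coprod (Yc i w)"
  unfolding fdb_coprod_var_eq map_tens_sum map_tens_tens ck_coprod_Yc[OF assms]
proof (intro sum.cong refl)
  fix zs assume zs: "zs \<in> factorizations w"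
  have "lin_ext Yc_prod (prod_list (map (\<lambda>(j, v). fdb_y j v) zs)) = prod_list (map (\<lambda>z. lin_ext Yc_prod (case z of (j, v) \<Rightarrow> fdb_y j v)) zs)"
    by (simp add: lin_ext_prod_list Yc_prod_simps comp_def)
  also have "map (\<lambda>z. lin_ext Yc_prod (case z of (j, v) \<Rightarrow> fdb_y j v)) zs = map (\<lambda>(j, v). Yc j v) zs"
    using zs by (auto simp: factorizations_def Yc_prod_fdb_y)
  finally have left: "lin_ext Yc_prod (prod_list (map (\<lambda>(j, v). fdb_y j v) zs)) = prod_list (map (\<lambda>(j, v). Yc j v) zs)" .
  have right: "lin_ext Yc_prod (fdb_y i (map fst zs)) = Yc i (map fst zs)"
    using factorizations_nonempty[OF zs assms] by (simp add: Yc_prod_fdb_y)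
  show "tens (lin_ext Yc_prod (prod_list (map (\<lambda>(j, v). fdb_y j v) zs))) (lin_ext Yc_prod (fdb_y i (map fst zs))) =
      tens (prod_list (map (\<lambda>(j, v). Yc j v) zs)) (Yc i (map fst zs))"
    by (simp only: left right)
qed

lemma fdb_mono_coprod_Yc_prod:
  assumes "m \<in> fdb_monomials"
  shows "map_tens Yc_prod Yc_prod (fdb_mono_coprod m) = (ck_coprod (Yc_prod m) :: _ \<Rightarrow>\<^sub>0 'k::comm_ring_1)"
  using assms
proof (induction m)
  case empty
  then show ?case
    by (simp add: map_tens_def zero_prod_def Yc_prod_def tens_one ck_coprod_mult)
next
  case (add z m)
  then have "snd z \<noteq> []" by (auto simp: fdb_monomials_add_mset)
  then have z: "map_tens Yc_prod Yc_prod (fdb_coprod_var z) = (ck_coprod (Yc (fst z) (snd z)) :: _ \<Rightarrow>\<^sub>0 'k)"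
    using fdb_coprod_var_Yc[of "snd z" "fst z"] by simp
  have "map_tens Yc_prod Yc_prod (fdb_mono_coprod (add_mset z m)) =
      (map_tens Yc_prod Yc_prod (fdb_coprod_var z) * map_tens Yc_prod Yc_prod (fdb_mono_coprod m) :: _ \<Rightarrow>\<^sub>0 'k)"
    by (simp add: map_tens_mult[of Yc_prod Yc_prod] Yc_prod_simps)
  also have "\<dots> = ck_coprod (Yc (fst z) (snd z) * Yc_prod m)"
    using add by (simp add: z ck_coprod_mult fdb_monomials_add_mset)
  also have "Yc (fst z) (snd z) * Yc_prod m = (Yc_prod (add_mset z m) :: _ \<Rightarrow>\<^sub>0 'k)"
    by (simp add: Yc_prod_def case_prod_unfold)
  finally show ?case .
qed

definition fdb_weight :: "('n \<times> 'n list) multiset \<Rightarrow> nat" where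
  "fdb_weight m = (\<Sum>(i, w)\<in>#m. length w - 1)"

lemma fdb_weight_y_prod:
  assumes "a \<in> keys (prod_list (map (\<lambda>(j, v). fdb_y j v) zs) :: _ \<Rightarrow>\<^sub>0 'k::comm_ring_1)"
    "\<forall>z\<in>set zs. snd z \<noteq> []"
  shows "fdb_weight a + length zs \<le> length (concat (map snd zs))"
  using assms
proof (induction zs arbitrary: a)
  case (Cons z zs)
  obtain j v where z: "z = (j, v)" by (cases z)
  from Cons.prems(1) obtain b c where bc: "a = b + c" "b \<in> keys (fdb_y j v :: _ \<Rightarrow>\<^sub>0 'k)"
      "c \<in> keys (prod_list (map (\<lambda>(j, v). fdb_y j v) zs) :: _ \<Rightarrow>\<^sub>0 'k)"
    using keys_mult[of "fdb_y j v :: _ \<Rightarrow>\<^sub>0 'k" "prod_list (map (\<lambda>(j, v). fdb_y j v) zs)"] by (auto simp: z)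
  have "v \<noteq> []" using Cons.prems(2) by (simp add: z)
  then have "fdb_weight b + 1 \<le> length v"
    using bc(2) by (auto simp: fdb_y_def fdb_weight_def Suc_le_eq split: if_splits)
  moreover have "fdb_weight c + length zs \<le> length (concat (map snd zs))"
    using Cons.IH[OF bc(3)] Cons.prems(2) by simp
  ultimately show ?case
    by (simp add: bc(1) z fdb_weight_def)
qed (simp add: fdb_weight_def)

lemma fdb_weight_coprod_var:
  assumes "2 \<le> length w"
    and "(a, b) \<in> keys (fdb_coprod_var (i, w :: 'n::finite list) - basis ({#(i, w)#}, 0) :: _ \<Rightarrow>\<^sub>0 'k::comm_ring_1)"
  shows "fdb_weight a < fdb_weight {#(i, w)#}"
proof -
  have w: "w \<noteq> []" using assms by auto
  let ?T = "\<lambda>zs. tens (prod_list (map (\<lambda>(j, v). fdb_y j v) zs)) (fdb_y i (map fst zs)) :: _ \<Rightarrow>\<^sub>0 'k"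
  have "?T [(j, w)] = (if i = j then basis ({#(i, w)#}, 0) else 0)" for j
  proof -
    have "fdb_y i [j] = (if i = j then basis 0 else 0 :: _ \<Rightarrow>\<^sub>0 'k)" "fdb_y j w = (basis {#(j, w)#} :: _ \<Rightarrow>\<^sub>0 'k)"
      using assms(1) by (simp_all add: fdb_y_def)
    then show ?thesis
      by (simp add: tens_simps del: single_one single_zero)
  qed
  then have "(\<Sum>j\<in>UNIV. ?T [(j, w)]) = basis ({#(i, w)#}, 0)"
    by simp
  then have "fdb_coprod_var (i, w) - basis ({#(i, w)#}, 0) = sum ?T {zs \<in> factorizations w. 2 \<le> length zs}"
    unfolding fdb_coprod_var_eq sum_factorizations[OF w] by simp
  with assms(2) have "(a, b) \<in> keys (sum ?T {zs \<in> factorizations w. 2 \<le> length zs})"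
    by simp
  then obtain zs where zs: "zs \<in> factorizations w" "2 \<le> length zs" "(a, b) \<in> keys (?T zs)"
    using keys_sum[of ?T "{zs \<in> factorizations w. 2 \<le> length zs}"] by blast
  then have "a \<in> keys (prod_list (map (\<lambda>(j, v). fdb_y j v) zs) :: _ \<Rightarrow>\<^sub>0 'k)"
    using keys_tens by blast
  from fdb_weight_y_prod[OF this] zs show ?thesis
    by (auto simp: factorizations_def fdb_weight_def)
qed

lemma fdb_mono_coprod_keys:
  assumes "m \<in> fdb_monomials"
  shows "keys (fdb_mono_coprod m :: _ \<Rightarrow>\<^sub>0 'k::comm_ring_1) \<subseteq> fdb_monomials \<times> fdb_monomials"
  using assms
proof (induction m)
  case (add z m)
  obtain i w where z: "z = (i, w)" by (cases z)
  have w: "w \<noteq> []" using add by (auto simp: z fdb_monomials_add_mset)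
  have "keys (fdb_coprod_var z :: _ \<Rightarrow>\<^sub>0 'k) \<subseteq> fdb_monomials \<times> fdb_monomials"
    unfolding z fdb_coprod_var_eq
  proof (rule keys_sum_subset)
    fix zs assume zs: "zs \<in> factorizations w"
    then have "keys (prod_list (map (\<lambda>(j, v). fdb_y j v) zs) :: _ \<Rightarrow>\<^sub>0 'k) \<subseteq> fdb_monomials"
      "keys (fdb_y i (map fst zs) :: _ \<Rightarrow>\<^sub>0 'k) \<subseteq> fdb_monomials"
      using factorizations_nonempty[OF zs w]
      by (intro fdb_y_prod_keys fdb_y_keys; simp add: factorizations_def)+
    then show "keys (tens (prod_list (map (\<lambda>(j, v). fdb_y j v) zs)) (fdb_y i (map fst zs)) :: _ \<Rightarrow>\<^sub>0 'k) \<subseteq> fdb_monomials \<times> fdb_monomials"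
      using keys_tens by blast
  qed
  then have "keys (fdb_coprod_var z * fdb_mono_coprod m :: _ \<Rightarrow>\<^sub>0 'k) \<subseteq> fdb_monomials \<times> fdb_monomials"
  proof (rule keys_mult_subset)
    show "keys (fdb_mono_coprod m :: _ \<Rightarrow>\<^sub>0 'k) \<subseteq> fdb_monomials \<times> fdb_monomials"
      using add by (simp add: fdb_monomials_add_mset)
  qed (auto simp: fdb_monomials_add)
  then show ?case by simp
qed (simp add: zero_prod_def fdb_monomials_def)

lemma lookup_Yc_prod_zero:
  assumes "m \<in> fdb_monomials"
  shows "lookup (Yc_prod m) 0 = (if m = 0 then 1 else 0 :: 'k::comm_ring_1)"
  using assms
proof (induction m)
  case (add z m)
  then have "snd z \<noteq> [] \<and> snd z \<noteq> [fst z]" by (auto simp: fdb_monomials_add_mset)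
  with add show ?case
    by (simp add: Yc_prod_def case_prod_unfold lookup_mult_empty lookup_Yc_empty)
qed (simp add: Yc_prod_def lookup_one)

text \<open>The Faa di Bruno algebra is embedded by \<open>Yc_prod\<close>, which has the left inverse \<open>read_forest\<close>, into the
  algebra of non-planar trees. Since the embedding respects coproducts and counits, coassociativity
  and the counit laws are inherited. The weight condition is read off from the formula for the coproduct: a
  factorization of \<open>w\<close> in \<open>k\<close> factors has left weight at most \<open>|w| - k\<close>.\<close>

lemma fdb_filtered_bialg:
  "filtered_bialg fdb_monomials (fdb_mono_coprod :: _ \<Rightarrow> _ \<Rightarrow>\<^sub>0 'k::field_char_0) fdb_weight"
proof
  fix m n :: "('n::finite \<times> 'n list) multiset"
  let ?\<delta> = "fdb_mono_coprod :: _ \<Rightarrow> _ \<Rightarrow>\<^sub>0 'k"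
  let ?Y = "Yc_prod :: _ \<Rightarrow> _ \<Rightarrow>\<^sub>0 'k" and ?R = "read_forest :: _ \<Rightarrow> _ \<Rightarrow>\<^sub>0 'k"
  show "0 \<in> fdb_monomials" by (rule fdb_monomials_zero)
  show "fdb_mono_coprod 0 = 1" by simp
  show "m + n = 0 \<Longrightarrow> m = 0 \<and> n = 0" by simp
  show "?\<delta> (m + n) = ?\<delta> m * ?\<delta> n" by simp
  {
    assume "m \<in> fdb_monomials" "n \<in> fdb_monomials"
    then show "m + n \<in> fdb_monomials" by (simp add: fdb_monomials_add)
  next
    assume "m \<in> fdb_monomials"
    then show "keys (?\<delta> m) \<subseteq> fdb_monomials \<times> fdb_monomials"
      by (rule fdb_mono_coprod_keys)
  next
    fix a b
    assume "m \<in> fdb_monomials" "(a, b) \<in> keys (?\<delta> m - basis (m, 0))"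
    then show "fdb_weight a < fdb_weight m"
    proof (induction m arbitrary: a b)
      case empty
      then show ?case by (simp add: zero_prod_def flip: single_one)
    next
      case (add z m)
      have wt: "fdb_weight (p + q) = fdb_weight p + fdb_weight q" for p q :: "('n \<times> 'n list) multiset"
        by (simp add: fdb_weight_def)
      have z: "fdb_weight a < fdb_weight {#z#}"
        if "(a, b) \<in> keys (fdb_coprod_var z - basis ({#z#}, 0) :: _ \<Rightarrow>\<^sub>0 'k)" for a b
        using fdb_weight_coprod_var[of "snd z" a b "fst z", where 'k = 'k] that add.prems(1)
        by (simp add: fdb_monomials_add_mset)
      have "fdb_weight a < fdb_weight ({#z#} + m)"
        using add by (intro low_mult[where p = "fdb_coprod_var z :: _ \<Rightarrow>\<^sub>0 'k" and q = "?\<delta> m" and b = b, OF wt z])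
          (auto simp: fdb_monomials_add_mset)
      then show ?case by simp
    qed
  next
    assume m: "m \<in> fdb_monomials"
    have keys: "a \<in> fdb_monomials" "b \<in> fdb_monomials" if "(a, b) \<in> keys (?\<delta> m)" "m \<in> fdb_monomials" for a b m
      using that fdb_mono_coprod_keys by blast+
    have comp: "map_tens ?Y ?Y (?\<delta> m) = lin_ext ck_forest_coprod (?Y m)" if "m \<in> fdb_monomials" for m
      using fdb_mono_coprod_Yc_prod[OF that] by (simp add: ck_coprod_def[abs_def])
    have read: "lin_ext ?R (lin_ext ?Y p) = p" if "keys p \<subseteq> fdb_monomials" for p
      unfolding lin_ext_lin_ext using that by (intro lin_ext_id_on read_Yc_prod) auto
    show "lin_ext (\<lambda>(a, b). if a = 0 then basis b else 0) (?\<delta> m) = basis m"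
    proof -
      have "lin_ext ?Y (lin_ext (\<lambda>(a, b). if a = 0 then basis b else 0) (?\<delta> m)) =
        lin_ext (\<lambda>(a, b). if a = 0 then ?Y b else 0) (?\<delta> m)"
        unfolding lin_ext_lin_ext by (intro lin_ext_cong) auto
      also have "\<dots> = lin_ext (\<lambda>(a, b). lin_ext (\<lambda>x. lin_ext (\<lambda>z. if x = 0 then basis z else 0) (?Y b)) (?Y a)) (?\<delta> m)"
      proof (rule lin_ext_cong_tens)
        fix a b assume ab: "(a, b) \<in> keys (?\<delta> m)"
        show "(if a = 0 then ?Y b else 0) = lin_ext (\<lambda>x. lin_ext (\<lambda>z. if x = 0 then basis z else 0) (?Y b)) (?Y a)"
          by (simp only: lin_ext_counit_left lookup_Yc_prod_zero[OF keys(1)[OF ab m]]) simp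
      qed
      also have "\<dots> = lin_ext (\<lambda>(x, z). if x = 0 then basis z else 0) (lin_ext ck_forest_coprod (?Y m))"
        unfolding comp[OF m, symmetric] lin_ext_map_tens ..
      also have "\<dots> = ?Y m"
        unfolding lin_ext_lin_ext by (intro lin_ext_id_on ck_grafting.counit_left)
      finally have "lin_ext ?R (lin_ext ?Y (lin_ext (\<lambda>(a, b). if a = 0 then basis b else 0) (?\<delta> m))) = lin_ext ?R (?Y m)"
        by simp
      moreover have "keys (lin_ext (\<lambda>(a, b). if a = 0 then basis b else 0) (?\<delta> m)) \<subseteq> fdb_monomials"
        using keys m by (intro keys_lin_ext_subset) (auto split: if_splits)
      ultimately show ?thesis
        by (simp add: read read_Yc_prod m)
    qed
    show "lin_ext (\<lambda>(a, b). if b = 0 then basis a else 0) (?\<delta> m) = basis m"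
    proof -
      have "lin_ext ?Y (lin_ext (\<lambda>(a, b). if b = 0 then basis a else 0) (?\<delta> m)) =
        lin_ext (\<lambda>(a, b). if b = 0 then ?Y a else 0) (?\<delta> m)"
        unfolding lin_ext_lin_ext by (intro lin_ext_cong) auto
      also have "\<dots> = lin_ext (\<lambda>(a, b). lin_ext (\<lambda>x. lin_ext (\<lambda>z. if z = 0 then basis x else 0) (?Y b)) (?Y a)) (?\<delta> m)"
      proof (rule lin_ext_cong_tens)
        fix a b assume ab: "(a, b) \<in> keys (?\<delta> m)"
        show "(if b = 0 then ?Y a else 0) = lin_ext (\<lambda>x. lin_ext (\<lambda>z. if z = 0 then basis x else 0) (?Y b)) (?Y a)"
          by (simp only: lin_ext_counit_right lookup_Yc_prod_zero[OF keys(2)[OF ab m]]) simp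
      qed
      also have "\<dots> = lin_ext (\<lambda>(x, z). if z = 0 then basis x else 0) (lin_ext ck_forest_coprod (?Y m))"
        unfolding comp[OF m, symmetric] lin_ext_map_tens ..
      also have "\<dots> = ?Y m"
        unfolding lin_ext_lin_ext by (intro lin_ext_id_on ck_grafting.counit_right)
      finally have "lin_ext ?R (lin_ext ?Y (lin_ext (\<lambda>(a, b). if b = 0 then basis a else 0) (?\<delta> m))) = lin_ext ?R (?Y m)"
        by simp
      moreover have "keys (lin_ext (\<lambda>(a, b). if b = 0 then basis a else 0) (?\<delta> m)) \<subseteq> fdb_monomials"
        using keys m by (intro keys_lin_ext_subset) (auto split: if_splits)
      ultimately show ?thesis
        by (simp add: read read_Yc_prod m)
    qed
    let ?l = "comult_left ?\<delta> m"
    let ?r = "comult_right ?\<delta> m"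
    let ?Y2 = "\<lambda>(b, c). tens (?Y b) (?Y c)" and ?R2 = "\<lambda>(b, c). tens (?R b) (?R c)"
    show "?l = ?r"
    proof -
      have eq: "map_tens ?Y ?Y2 t = lin_ext (\<lambda>(a, b, c). tens (?Y a) (tens (?Y b) (?Y c))) t" for t
        unfolding map_tens_def by (rule lin_ext_cong) auto
      have "map_tens ?Y ?Y2 ?l = map_tens ?Y ?Y2 ?r"
        unfolding eq
      proof (rule coassoc_transport[where d = ck_forest_coprod and M = UNIV and A = fdb_monomials])
        fix a :: "('n \<times> 'n list) multiset" assume a: "a \<in> fdb_monomials"
        then show "keys (?\<delta> a) \<subseteq> fdb_monomials \<times> fdb_monomials"
          by (rule fdb_mono_coprod_keys)
        show "lin_ext (\<lambda>(b, c). tens (?Y b) (?Y c)) (?\<delta> a) = lin_ext ck_forest_coprod (?Y a)"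
          using comp[OF a] by (simp add: map_tens_def)
      qed (simp_all add: m ck_grafting.coassoc)
      then have "map_tens ?R ?R2 (map_tens ?Y ?Y2 ?l) = map_tens ?R ?R2 (map_tens ?Y ?Y2 ?r)"
        by simp
      moreover have "map_tens ?R ?R2 (map_tens ?Y ?Y2 t) = t"
        if "keys t \<subseteq> fdb_monomials \<times> fdb_monomials \<times> fdb_monomials" for t
        unfolding map_tens_map_tens
      proof (rule map_tens_id_on, intro conjI)
        fix a p assume "(a, p) \<in> keys t"
        moreover obtain b c where p: "p = (b, c)" by (cases p)
        ultimately have abc: "a \<in> fdb_monomials" "b \<in> fdb_monomials" "c \<in> fdb_monomials"
          using that by auto
        show "lin_ext ?R (?Y a) = basis a"
          using abc by (simp add: read_Yc_prod)
        have "lin_ext ?R2 (?Y2 p) = map_tens ?R ?R (tens (?Y b) (?Y c))"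
          by (simp add: p map_tens_def)
        also have "\<dots> = basis p"
          using abc by (simp add: p map_tens_tens read_Yc_prod)
        finally show "lin_ext ?R2 (?Y2 p) = basis p" .
      qed
      moreover have "keys ?l \<subseteq> fdb_monomials \<times> fdb_monomials \<times> fdb_monomials"
        "keys ?r \<subseteq> fdb_monomials \<times> fdb_monomials \<times> fdb_monomials"
        using keys[OF _ m] keys by (auto intro!: keys_lin_ext_subset split: if_splits) blast+
      ultimately show ?thesis by metis
    qed
  }
qed

interpretation fdb: coordinates fdb_monomials fdb_mono_coprod fdb_weight
  "H_FdB :: ('k::field_char_0, ('n::finite \<times> 'n list) multiset \<Rightarrow>\<^sub>0 'k) bialg" "\<lambda>x. x"
  using monoid_bialg_coordinates[OF fdb_filtered_bialg fdb_carrier_eq]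
  by (simp add: H_FdB_def fdb_coprod_def[abs_def])

section \<open>The subalgebra generated by the elements \<open>Y\<close>\<close>

lemma H_NCK_simps [simp]:
  "carrier H_NCK = UNIV" "x \<otimes>\<^bsub>H_NCK\<^esub> y = x * y" "\<one>\<^bsub>H_NCK\<^esub> = 1" "\<zero>\<^bsub>H_NCK\<^esub> = 0"
  "x \<oplus>\<^bsub>H_NCK\<^esub> y = x + y" "c \<odot>\<^bsub>H_NCK\<^esub> x = scale c x" "counit H_NCK x = lookup x 0"
  by (simp_all add: H_NCK_def monoid_bialg_def)

lemma H_CK_simps [simp]:
  "carrier H_CK = UNIV" "x \<otimes>\<^bsub>H_CK\<^esub> y = x * y" "\<one>\<^bsub>H_CK\<^esub> = 1" "\<zero>\<^bsub>H_CK\<^esub> = 0"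
  "x \<oplus>\<^bsub>H_CK\<^esub> y = x + y" "c \<odot>\<^bsub>H_CK\<^esub> x = scale c x"
  by (simp_all add: H_CK_def monoid_bialg_def)

lemma scale_diff: "scale c (x - y) = scale c x - scale c y"
  by (rule poly_mapping_eqI) (simp add: lookup_minus algebra_simps)

lemma scale_minus_one: "scale (- 1) x = - x"
  by (rule poly_mapping_eqI) simp

lemma k_subalgebra_iff:
  assumes ring: "ring H" and H: "carrier H = UNIV" "\<And>x y. x \<otimes>\<^bsub>H\<^esub> y = x * y" "\<one>\<^bsub>H\<^esub> = 1" "\<zero>\<^bsub>H\<^esub> = 0"
    "\<And>x y. x \<oplus>\<^bsub>H\<^esub> y = x + y" "\<And>c x. c \<odot>\<^bsub>H\<^esub> x = scale c x"
  fixes A :: "('m::monoid_add \<Rightarrow>\<^sub>0 'k::field) set"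
  shows "k_subalgebra H A \<longleftrightarrow> 1 \<in> A \<and> (\<forall>x\<in>A. \<forall>y\<in>A. x + y \<in> A \<and> x * y \<in> A) \<and> (\<forall>c. \<forall>x\<in>A. scale c x \<in> A)"
    (is "_ \<longleftrightarrow> ?R")
proof
  assume "k_subalgebra H A"
  then have "subring A H" and s: "\<forall>c. \<forall>x\<in>A. scale c x \<in> A"
    by (simp_all add: k_subalgebra_def H)
  from subringE[OF this(1)] s show ?R by (simp add: H)
next
  assume R: ?R
  have "\<ominus>\<^bsub>H\<^esub> x = - x" for x
    using abelian_group.minus_equality[OF ring.is_abelian_group[OF ring], of "- x" x] by (simp add: H)
  moreover have "- x \<in> A" if "x \<in> A" for x
    using R that scale_minus_one[of x] by metis
  ultimately have "subring A H"
    using R by (intro ring.subringI[OF ring]) (simp_all add: H)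
  with R show "k_subalgebra H A"
    by (simp add: k_subalgebra_def H)
qed

lemma k_subalgebra_NCK:
  "k_subalgebra H_NCK A \<longleftrightarrow> 1 \<in> A \<and> (\<forall>x\<in>A. \<forall>y\<in>A. x + y \<in> A \<and> x * y \<in> A) \<and> (\<forall>c. \<forall>x\<in>A. scale c x \<in> A)"
  by (rule k_subalgebra_iff[OF nck.ring_H]) simp_all

lemma k_subalgebra_CK:
  "k_subalgebra H_CK A \<longleftrightarrow> 1 \<in> A \<and> (\<forall>x\<in>A. \<forall>y\<in>A. x + y \<in> A \<and> x * y \<in> A) \<and> (\<forall>c. \<forall>x\<in>A. scale c x \<in> A)"
  by (rule k_subalgebra_iff[OF ck.ring_H]) simp_all

definition Y_algebra :: "(('n::finite, 'k::field) planar) set" where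
  "Y_algebra = generated_subalgebra H_NCK {Y i w | i w. w \<noteq> []}"

lemma k_subalgebra_Y_algebra: "k_subalgebra H_NCK Y_algebra"
  unfolding k_subalgebra_NCK Y_algebra_def generated_subalgebra_def by blast

lemma
  shows Y_algebra_one: "1 \<in> Y_algebra"
    and Y_algebra_add: "\<lbrakk>x \<in> Y_algebra; y \<in> Y_algebra\<rbrakk> \<Longrightarrow> x + y \<in> Y_algebra"
    and Y_algebra_mult: "\<lbrakk>x \<in> Y_algebra; y \<in> Y_algebra\<rbrakk> \<Longrightarrow> x * y \<in> Y_algebra"
    and Y_algebra_scale: "x \<in> Y_algebra \<Longrightarrow> scale c x \<in> Y_algebra"
  using k_subalgebra_Y_algebra unfolding k_subalgebra_NCK by blast+

lemma Y_algebra_zero: "0 \<in> Y_algebra"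
  using Y_algebra_scale[OF Y_algebra_one, of 0] by simp

lemma Y_algebra_minus: "x \<in> Y_algebra \<Longrightarrow> - x \<in> Y_algebra"
  using Y_algebra_scale[of x "- 1"] by (simp add: scale_minus_one)

lemma Y_algebra_diff: "\<lbrakk>x \<in> Y_algebra; y \<in> Y_algebra\<rbrakk> \<Longrightarrow> x - y \<in> Y_algebra"
  using Y_algebra_add[of x "- y"] by (simp add: Y_algebra_minus)

lemma Y_algebra_sum: "(\<And>i. i \<in> I \<Longrightarrow> g i \<in> Y_algebra) \<Longrightarrow> sum g I \<in> Y_algebra"
  by (induction I rule: infinite_finite_induct) (auto intro: Y_algebra_add Y_algebra_zero)

lemma Y_algebra_lin_ext: "(\<And>m. m \<in> keys p \<Longrightarrow> g m \<in> Y_algebra) \<Longrightarrow> lin_ext g p \<in> Y_algebra"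
  unfolding lin_ext_def by (intro Y_algebra_sum Y_algebra_scale)

lemma Y_algebra_Y: "w \<noteq> [] \<Longrightarrow> Y i w \<in> Y_algebra"
  unfolding Y_algebra_def generated_subalgebra_def by blast

lemma Y_algebra_Y_prod: "\<forall>z\<in>set zs. snd z \<noteq> [] \<Longrightarrow> Y_prod zs \<in> Y_algebra"
  by (induction zs) (auto intro!: Y_algebra_one Y_algebra_mult Y_algebra_Y)

lemma Y_algebra_induct [consumes 1, case_names Y one add mult scale]:
  assumes "a \<in> Y_algebra"
    and "\<And>i w. w \<noteq> [] \<Longrightarrow> P (Y i w)" and "P 1"
    and "\<And>x y. \<lbrakk>x \<in> Y_algebra; y \<in> Y_algebra; P x; P y\<rbrakk> \<Longrightarrow> P (x + y)"
    and "\<And>x y. \<lbrakk>x \<in> Y_algebra; y \<in> Y_algebra; P x; P y\<rbrakk> \<Longrightarrow> P (x * y)"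
    and "\<And>c x. \<lbrakk>x \<in> Y_algebra; P x\<rbrakk> \<Longrightarrow> P (scale c x)"
  shows "P a"
proof -
  let ?A = "{a \<in> Y_algebra. P a}"
  have "k_subalgebra H_NCK ?A"
    unfolding k_subalgebra_NCK using assms(3-) by (auto intro: Y_algebra_one Y_algebra_add Y_algebra_mult Y_algebra_scale)
  moreover have "{Y i w | i w. w \<noteq> []} \<subseteq> ?A"
    using assms(2) by (auto intro: Y_algebra_Y)
  ultimately have "Y_algebra \<subseteq> ?A"
    unfolding Y_algebra_def generated_subalgebra_def by blast
  with assms(1) show ?thesis by blast
qed

lemma nck_coprod_eq: "lin_ext nck_forest_coprod = nck_coprod"
  by (simp add: fun_eq_iff nck_coprod_def)

lemma nck_ev2: "nck.ev2 = lin_ext (\<lambda>(a, b). tens a b)"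
  by (simp add: nck.ev2_def)

text \<open>The representatives with factors in the subalgebra are closed under the operations, and
  \<open>nck_coprod_Y\<close> provides them for the generators.\<close>

lemma Y_algebra_coprod:
  assumes "a \<in> Y_algebra"
  shows "\<exists>t. keys t \<subseteq> Y_algebra \<times> Y_algebra \<and> teq2 H_NCK (comult H_NCK a) t"
proof -
  have "\<exists>t. keys t \<subseteq> Y_algebra \<times> Y_algebra \<and> nck.ev2 t = nck_coprod a"
    using assms
  proof (induction a rule: Y_algebra_induct)
    case (Y i w)
    let ?t = "\<Sum>zs\<in>factorizations w. basis (Y_prod zs, Y i (map fst zs))"
    have "Y_prod zs \<in> Y_algebra" "Y i (map fst zs) \<in> Y_algebra" if "zs \<in> factorizations w" for zs
      using that factorizations_nonempty[OF that Y]
      by (auto intro!: Y_algebra_Y_prod Y_algebra_Y simp: factorizations_def)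
    then have "keys ?t \<subseteq> Y_algebra \<times> Y_algebra"
      by (intro keys_sum_subset) auto
    moreover have "nck.ev2 ?t = nck_coprod (Y i w)"
      by (simp add: nck_ev2 lin_ext_sum nck_coprod_Y[OF Y])
    ultimately show ?case by blast
  next
    case one
    show ?case
      by (intro exI[of _ "basis (1, 1)"]) (simp add: nck_ev2 Y_algebra_one tens_one nck_coprod_mult)
  next
    case (add x y)
    then obtain s t where "keys s \<subseteq> Y_algebra \<times> Y_algebra" "nck.ev2 s = nck_coprod x"
      "keys t \<subseteq> Y_algebra \<times> Y_algebra" "nck.ev2 t = nck_coprod y" by blast
    then show ?case
      by (intro exI[of _ "s + t"]) (simp add: nck_ev2 lin_ext_add nck_coprod_def keys_add_subset)
  next
    case (mult x y)
    then obtain s t where st: "keys s \<subseteq> Y_algebra \<times> Y_algebra" "nck.ev2 s = nck_coprod x"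
      "keys t \<subseteq> Y_algebra \<times> Y_algebra" "nck.ev2 t = nck_coprod y" by blast
    have "a * c \<in> Y_algebra" "b * d \<in> Y_algebra"
      if "(a, b) \<in> keys s" "(c, d) \<in> keys t" for a b c d
      using that st by (blast intro: Y_algebra_mult)+
    then have "keys (tmult H_NCK s t) \<subseteq> Y_algebra \<times> Y_algebra"
      unfolding tmult_def by (intro keys_lin_ext_subset) (auto dest!: subsetD[OF keys_lin_ext])
    moreover have "nck.ev2 (tmult H_NCK s t) = nck_coprod (x * y)"
      using st by (simp add: nck.ev2_tmult nck_coprod_mult)
    ultimately show ?case by blast
  next
    case (scale c x)
    then obtain t where "keys t \<subseteq> Y_algebra \<times> Y_algebra" "nck.ev2 t = nck_coprod x" by blast
    then show ?case
      using keys_scale[of c t]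
      by (intro exI[of _ "scale c t"]) (auto simp: nck_ev2 lin_ext_scale nck_coprod_def)
  qed
  then obtain t where "keys t \<subseteq> Y_algebra \<times> Y_algebra" "nck.ev2 t = nck_coprod a" by blast
  then show ?thesis
    by (intro exI[of _ t] conjI nck.ev2_imp_teq2) (auto simp: nck.ev2_comult nck_coprod_eq)
qed

abbreviation nck_antipode :: "('d ptree list \<Rightarrow>\<^sub>0 'k::field) \<Rightarrow> ('d ptree list \<Rightarrow>\<^sub>0 'k)" where
  "nck_antipode \<equiv> lin_ext nck.antipode"

lemma nck_antipode_mult: "nck_antipode (x * y) = nck_antipode y * nck_antipode x"
proof (induction x rule: basis_induct)
  case (add m c x)
  have "nck_antipode (basis m * y) = nck_antipode y * nck_antipode (basis m)"
    by (induction y rule: basis_induct)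
      (simp_all add: distrib_left distrib_right lin_ext_add lin_ext_scale scale_mult mult_single nck.antipode_add)
  with add show ?case
    by (simp add: distrib_left distrib_right lin_ext_add lin_ext_scale scale_mult)
qed simp

lemma factorization_shorter:
  assumes "zs \<in> factorizations w" "2 \<le> length zs" "z \<in> set zs"
  shows "length (snd z) < length w"
proof -
  obtain xs ys where zs: "zs = xs @ z # ys"
    using split_list[OF assms(3)] by blast
  have "xs \<in> factorizations (concat (map snd xs))" "ys \<in> factorizations (concat (map snd ys))"
    using assms(1) by (auto simp: factorizations_def zs)
  from this[THEN length_factorization(1)]
  have "length xs + length ys \<le> length (concat (map snd xs)) + length (concat (map snd ys))"
    by simp
  moreover have "1 \<le> length xs + length ys" "w = concat (map snd xs) @ snd z @ concat (map snd ys)"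
    using assms(1,2) by (simp_all add: zs factorizations_def)
  then have "1 \<le> length xs + length ys" "length w = length (concat (map snd xs)) + (length (snd z) + length (concat (map snd ys)))"
    by (simp_all only: length_append)
  ultimately show ?thesis by linarith
qed

text \<open>In \<open>\<Sum> S(x') x'' = \<epsilon>(x) 1\<close> for \<open>x = Y i w\<close>, the factorization with one factor contributes
  \<open>S (Y i w)\<close>. All others contribute products of values of \<open>S\<close> on shorter words and of generators,
  because \<open>S\<close> reverses products.\<close>

lemma nck_antipode_Y:
  fixes i :: "'n::finite"
  assumes "w \<noteq> []"
  shows "nck_antipode (Y i w :: _ \<Rightarrow>\<^sub>0 'k::field) \<in> Y_algebra"
  using assms
proof (induction "length w" arbitrary: i w rule: less_induct)
  case less
  let ?T = "\<lambda>zs. nck_antipode (Y_prod zs) * Y i (map fst zs) :: _ \<Rightarrow>\<^sub>0 'k"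
  let ?L = "{zs \<in> factorizations w. 2 \<le> length zs}"
  have prod: "nck_antipode (Y_prod zs :: _ \<Rightarrow>\<^sub>0 'k) \<in> Y_algebra"
    if "\<And>z. z \<in> set zs \<Longrightarrow> snd z \<noteq> [] \<and> length (snd z) < length w" for zs :: "('n \<times> 'n list) list"
    using that
  proof (induction zs)
    case Nil
    then show ?case by (simp add: nck.antipode_zero Y_algebra_one)
  next
    case (Cons z zs)
    obtain j v where z: "z = (j, v)" by (cases z)
    have "nck_antipode (Y j v :: _ \<Rightarrow>\<^sub>0 'k) \<in> Y_algebra"
      using Cons.prems[of z] by (intro less.hyps) (simp_all add: z)
    with Cons show ?case
      by (auto simp: z nck_antipode_mult intro: Y_algebra_mult)
  qed
  have "scale (lookup (Y i w) 0) 1 = lin_ext (\<lambda>(a, b). nck.antipode a * basis b) (lin_ext nck_forest_coprod (Y i w :: _ \<Rightarrow>\<^sub>0 'k))"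
    by (rule nck.lin_ext_antipode[symmetric]) (simp_all add: nck.antipode_left)
  also have "\<dots> = sum ?T (factorizations w)"
    unfolding nck_coprod_eq nck_coprod_Y[OF less.prems] lin_ext_sum lin_ext_tens
    by (simp add: lin_ext_mult_left lin_ext_mult_right lin_ext_basis)
  also have "\<dots> = (\<Sum>j\<in>UNIV. ?T [(j, w)]) + sum ?T ?L"
    by (rule sum_factorizations[OF less.prems])
  also have "(\<Sum>j\<in>UNIV. ?T [(j, w)]) = nck_antipode (Y i w)"
  proof -
    have "?T [(j, w)] = (if i = j then nck_antipode (Y i w) else 0)" for j
      by (simp add: Y_letter)
    then show ?thesis by simp
  qed
  finally have "nck_antipode (Y i w) = scale (lookup (Y i w) 0) 1 - sum ?T ?L"
    by (simp add: algebra_simps)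
  moreover have "sum ?T ?L \<in> Y_algebra"
  proof (intro Y_algebra_sum Y_algebra_mult prod Y_algebra_Y)
    fix zs assume zs: "zs \<in> ?L"
    then show "map fst zs \<noteq> []" by auto
    fix z assume "z \<in> set zs"
    moreover have "zs \<in> factorizations w" "2 \<le> length zs"
      using zs by auto
    ultimately show "snd z \<noteq> [] \<and> length (snd z) < length w"
      using factorization_shorter[of zs w z] unfolding factorizations_def by blast
  qed
  ultimately show ?case
    by (simp add: Y_algebra_diff Y_algebra_scale Y_algebra_one)
qed

lemma nck_antipode_Y_algebra: "a \<in> Y_algebra \<Longrightarrow> nck_antipode a \<in> Y_algebra"
  by (induction a rule: Y_algebra_induct)
    (auto simp: nck_antipode_Y nck.antipode_zero lin_ext_add lin_ext_scale nck_antipode_mult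
      intro: Y_algebra_one Y_algebra_add Y_algebra_mult Y_algebra_scale)

lemma hopf_subalgebra_Y_algebra:
  "hopf_subalgebra H_NCK (Y_algebra :: (('n::finite, 'k::field) planar) set)"
proof -
  have "nck.h x = x" for x :: "('n, 'k) planar"
    using nck.h_f[of x] by simp
  then have eq: "(\<lambda>x. nck.h (nck_antipode x)) = (nck_antipode :: (('n, 'k) planar) \<Rightarrow> _)"
    by simp
  have "is_antipode H_NCK (\<lambda>x :: ('n, 'k) planar. nck.h (nck_antipode x))"
    by (rule nck.is_antipode_H)
  then have "is_antipode H_NCK (nck_antipode :: (('n, 'k) planar) \<Rightarrow> _)"
    by (simp only: eq)
  then show ?thesis
    unfolding hopf_subalgebra_def
    using nck.hopf_algebra_H k_subalgebra_Y_algebra Y_algebra_coprod nck_antipode_Y_algebra by blast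
qed

section \<open>The commutator ideal\<close>

abbreviation Y_bialg :: "('k::field, ('n::finite, 'k) planar) bialg" where
  "Y_bialg \<equiv> sub_bialg H_NCK Y_algebra"

lemma Y_bialg_simps [simp]:
  "carrier Y_bialg = Y_algebra" "x \<otimes>\<^bsub>Y_bialg\<^esub> y = x * y" "\<one>\<^bsub>Y_bialg\<^esub> = 1" "\<zero>\<^bsub>Y_bialg\<^esub> = 0"
  "x \<oplus>\<^bsub>Y_bialg\<^esub> y = x + y" "c \<odot>\<^bsub>Y_bialg\<^esub> x = scale c x" "counit Y_bialg x = lookup x 0"
  by (simp_all add: sub_bialg_def)

lemma Y_bialg_comult:
  assumes "a \<in> Y_algebra"
  shows "keys (comult Y_bialg a) \<subseteq> Y_algebra \<times> Y_algebra"
    and "lin_ext (\<lambda>(b, c). tens b c) (comult Y_bialg a) = nck_coprod a"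
proof -
  have *: "keys (comult Y_bialg a) \<subseteq> Y_algebra \<times> Y_algebra \<and> teq2 H_NCK (comult H_NCK a) (comult Y_bialg a)"
    using someI_ex[OF Y_algebra_coprod[OF assms]] by (simp add: sub_bialg_def)
  then show "keys (comult Y_bialg a) \<subseteq> Y_algebra \<times> Y_algebra" by simp
  from * have "nck.ev2 (comult H_NCK a) = nck.ev2 (comult Y_bialg a)"
    by (intro nck.teq2_imp_ev2) simp
  then show "lin_ext (\<lambda>(b, c). tens b c) (comult Y_bialg a) = nck_coprod a"
    by (simp add: nck.ev2_comult nck_coprod_eq) (simp add: nck_ev2)
qed

interpretation Yb: ring Y_bialg
proof (rule ringI)
  show "abelian_group Y_bialg"
  proof (rule abelian_groupI)
    fix x :: "('n::finite, 'k::field) planar" assume "x \<in> carrier Y_bialg"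
    then show "\<exists>y\<in>carrier Y_bialg. y \<oplus>\<^bsub>Y_bialg\<^esub> x = \<zero>\<^bsub>Y_bialg\<^esub>"
      by (intro bexI[of _ "- x"]) (simp_all add: Y_algebra_minus)
  qed (simp_all add: Y_algebra_zero Y_algebra_add add.assoc add.commute)
  show "monoid Y_bialg"
    by (rule monoidI) (simp_all add: Y_algebra_one Y_algebra_mult mult.assoc)
qed (simp_all add: distrib_left distrib_right)

lemma Y_bialg_uminus:
  assumes "x \<in> Y_algebra"
  shows "\<ominus>\<^bsub>Y_bialg\<^esub> x = - x"
proof (rule Yb.minus_equality)
  show "- x \<oplus>\<^bsub>Y_bialg\<^esub> x = \<zero>\<^bsub>Y_bialg\<^esub>" by simp
  show "x \<in> carrier Y_bialg" "- x \<in> carrier Y_bialg"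
    using assms by (simp_all add: Y_algebra_minus)
qed

lemma Y_bialg_minus:
  assumes "y \<in> Y_algebra"
  shows "x \<ominus>\<^bsub>Y_bialg\<^esub> y = x - y"
  unfolding a_minus_def Y_bialg_uminus[OF assms] by simp

definition Y_comm_ideal :: "(('n::finite, 'k::field) planar) set" where
  "Y_comm_ideal = commutator_ideal Y_bialg"

lemma Y_comm_ideal_eq:
  "(Y_comm_ideal :: (('n::finite, 'b::field) planar) set) = genideal Y_bialg {x * y - y * x | x y. x \<in> Y_algebra \<and> y \<in> Y_algebra}"
proof -
  have "{x \<otimes>\<^bsub>Y_bialg\<^esub> y \<ominus>\<^bsub>Y_bialg\<^esub> y \<otimes>\<^bsub>Y_bialg\<^esub> x | x y. x \<in> carrier Y_bialg \<and> y \<in> carrier Y_bialg} =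
      {x * y - y * x | x y :: (('n, 'b) planar). x \<in> Y_algebra \<and> y \<in> Y_algebra}"
    unfolding Y_bialg_simps by (intro Collect_cong ex_cong1) (metis Y_bialg_minus Y_algebra_mult)
  then show ?thesis
    by (simp only: Y_comm_ideal_def commutator_ideal_def)
qed

lemma commutators_in_Y_algebra:
  "{x * y - y * x | x y. x \<in> Y_algebra \<and> y \<in> Y_algebra} \<subseteq> carrier Y_bialg"
  unfolding Y_bialg_simps by (blast intro: Y_algebra_mult Y_algebra_diff)

lemma ideal_Y_comm_ideal: "ideal Y_comm_ideal Y_bialg"
  unfolding Y_comm_ideal_eq by (rule Yb.genideal_ideal[OF commutators_in_Y_algebra])

lemma commutator_in_ideal: "x \<in> Y_algebra \<Longrightarrow> y \<in> Y_algebra \<Longrightarrow> x * y - y * x \<in> Y_comm_ideal"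
  unfolding Y_comm_ideal_eq by (rule subsetD[OF Yb.genideal_self[OF commutators_in_Y_algebra]]) blast

lemma ideal_subset: "x \<in> Y_comm_ideal \<Longrightarrow> x \<in> Y_algebra"
  using ideal.Icarr[OF ideal_Y_comm_ideal] by simp

lemma ideal_zero: "0 \<in> Y_comm_ideal"
  using additive_subgroup.zero_closed[OF ideal.axioms(1)[OF ideal_Y_comm_ideal]] by simp

lemma ideal_add: "x \<in> Y_comm_ideal \<Longrightarrow> y \<in> Y_comm_ideal \<Longrightarrow> x + y \<in> Y_comm_ideal"
  using additive_subgroup.a_closed[OF ideal.axioms(1)[OF ideal_Y_comm_ideal]] by simp

lemma ideal_mult:
  "x \<in> Y_comm_ideal \<Longrightarrow> y \<in> Y_algebra \<Longrightarrow> y * x \<in> Y_comm_ideal"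
  "x \<in> Y_comm_ideal \<Longrightarrow> y \<in> Y_algebra \<Longrightarrow> x * y \<in> Y_comm_ideal"
  using ideal.I_l_closed[OF ideal_Y_comm_ideal, of x y] ideal.I_r_closed[OF ideal_Y_comm_ideal, of x y] by simp_all

lemma ideal_scale: "x \<in> Y_comm_ideal \<Longrightarrow> scale c x \<in> Y_comm_ideal"
  using ideal_mult(1)[of x "scale c 1"] by (simp add: Y_algebra_scale Y_algebra_one scale_mult)

lemma ideal_diff: "x \<in> Y_comm_ideal \<Longrightarrow> y \<in> Y_comm_ideal \<Longrightarrow> x - y \<in> Y_comm_ideal"
  using ideal_add[of x "- y"] ideal_scale[of y "- 1"] by (simp add: scale_minus_one)

text \<open>The elements that vanish after forgetting the planar structure form an ideal containing the
  commutators.\<close>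

lemma forget_planar_ideal:
  assumes "x \<in> (Y_comm_ideal :: (('n::finite, 'b::field) planar) set)"
  shows "forget_planar x = 0"
proof -
  let ?J = "{a :: ('n, 'b) planar. a \<in> Y_algebra \<and> forget_planar a = 0}"
  have "ideal ?J Y_bialg"
  proof (rule idealI)
    show "subgroup ?J (add_monoid Y_bialg)"
    proof (rule Yb.add.subgroupI)
      show "?J \<noteq> {}"
        using Y_algebra_zero forget_planar_simps(1) by blast
      fix a assume "a \<in> ?J"
      then show "\<ominus>\<^bsub>Y_bialg\<^esub> a \<in> ?J"
        by (simp add: Y_bialg_uminus Y_algebra_minus forget_planar_eq lin_ext_neg)
    next
      show "?J \<subseteq> carrier Y_bialg" by auto
    next
      fix a b assume "a \<in> ?J" "b \<in> ?J"
      then show "a \<oplus>\<^bsub>Y_bialg\<^esub> b \<in> ?J"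
        by (simp add: forget_planar_simps Y_algebra_add)
    qed
  next
    fix a x :: "('n, 'b) planar" assume "a \<in> ?J" "x \<in> carrier Y_bialg"
    then show "x \<otimes>\<^bsub>Y_bialg\<^esub> a \<in> ?J" "a \<otimes>\<^bsub>Y_bialg\<^esub> x \<in> ?J"
      by (simp_all add: forget_planar_simps Y_algebra_mult)
  qed (rule Yb.ring_axioms)
  moreover have "x * y - y * x \<in> ?J" if "x \<in> Y_algebra" "y \<in> Y_algebra" for x y :: "('n, 'b) planar"
  proof -
    have "forget_planar (x * y - y * x) = 0"
      unfolding forget_planar_simps using mult.commute[of "forget_planar x" "forget_planar y"] by simp
    with that show ?thesis
      by (simp add: Y_algebra_mult Y_algebra_diff)
  qed
  then have "{x * y - y * x | x y. x \<in> Y_algebra \<and> y \<in> Y_algebra} \<subseteq> ?J"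
    by blast
  ultimately have "Y_comm_ideal \<subseteq> ?J"
    unfolding Y_comm_ideal_eq by (rule Yb.genideal_minimal)
  with assms show ?thesis by blast
qed

abbreviation read :: "(('n::finite, 'k::field_char_0) planar) \<Rightarrow> (('n \<times> 'n list) multiset \<Rightarrow>\<^sub>0 'k)" where
  "read a \<equiv> lin_ext read_forest (forget_planar a)"

lemma read_Yc_prod_lin:
  assumes "keys p \<subseteq> fdb_monomials"
  shows "lin_ext read_forest (lin_ext Yc_prod p) = (p :: _ \<Rightarrow>\<^sub>0 'k::field_char_0)"
  unfolding lin_ext_lin_ext using assms by (intro lin_ext_id_on read_Yc_prod) auto

lemma
  assumes "a \<in> Y_algebra"
  shows read_keys: "keys (read a) \<subseteq> fdb_monomials"
    and Yc_prod_read: "lin_ext Yc_prod (read a) = (forget_planar a :: _ \<Rightarrow>\<^sub>0 'k::field_char_0)"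
proof -
  have "\<exists>p. keys p \<subseteq> fdb_monomials \<and> lin_ext Yc_prod p = (forget_planar a :: _ \<Rightarrow>\<^sub>0 'k)"
    using assms
  proof (induction a rule: Y_algebra_induct)
    case (Y i w)
    then show ?case
      by (intro exI[of _ "fdb_y i w"]) (simp add: fdb_y_keys Yc_prod_fdb_y Yc_def)
  next
    case one
    show ?case
      by (intro exI[of _ 1]) (simp add: fdb_monomials_def Yc_prod_def forget_planar_simps)
  next
    case (add x y)
    then obtain p q where "keys p \<subseteq> fdb_monomials" "lin_ext Yc_prod p = forget_planar x"
      "keys q \<subseteq> fdb_monomials" "lin_ext Yc_prod q = forget_planar y" by blast
    then show ?case
      by (intro exI[of _ "p + q"]) (simp add: keys_add_subset lin_ext_add forget_planar_simps)
  next
    case (mult x y)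
    then obtain p q where "keys p \<subseteq> fdb_monomials" "lin_ext Yc_prod p = forget_planar x"
      "keys q \<subseteq> fdb_monomials" "lin_ext Yc_prod q = forget_planar y" by blast
    moreover from this have "keys (p * q) \<subseteq> fdb_monomials"
      by (intro keys_mult_subset) (simp_all add: fdb_monomials_add)
    ultimately show ?case
      by (intro exI[of _ "p * q"]) (simp add: lin_ext_mult[of Yc_prod] Yc_prod_simps forget_planar_simps)
  next
    case (scale c x)
    then obtain p where "keys p \<subseteq> fdb_monomials" "lin_ext Yc_prod p = forget_planar x" by blast
    then show ?case
      by (intro exI[of _ "scale c p"]) (simp add: lin_ext_scale forget_planar_simps order.trans[OF keys_scale])
  qed
  then obtain p where "keys p \<subseteq> fdb_monomials" "lin_ext Yc_prod p = forget_planar a" by blast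
  then show "keys (read a) \<subseteq> fdb_monomials" "lin_ext Yc_prod (read a) = forget_planar a"
    using read_Yc_prod_lin[of p] by auto
qed

text \<open>The difference is written with commutators of elements of the subalgebra itself; the ideal is
  generated inside it, not inside the algebra of all planar forests.\<close>

lemma Y_prod_permute:
  assumes "mset zs = mset zs'" "\<forall>z\<in>set zs. snd z \<noteq> []"
  shows "Y_prod zs - Y_prod zs' \<in> (Y_comm_ideal :: (_ \<Rightarrow>\<^sub>0 'k::field) set)"
  using assms
proof (induction zs arbitrary: zs')
  case Nil
  then show ?case by (simp add: ideal_zero)
next
  case (Cons z zs)
  have "z \<in> set zs'"
    using Cons.prems(1) by (metis list.set_intros(1) set_mset_mset)
  then obtain us vs where zs': "zs' = us @ z # vs"
    by (auto dest: split_list)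
  have set: "set zs' = set (z # zs)"
    using Cons.prems(1) by (metis set_mset_mset)
  obtain j v where z: "z = (j, v)" by (cases z)
  have "Y_prod zs - Y_prod (us @ vs) \<in> (Y_comm_ideal :: (_ \<Rightarrow>\<^sub>0 'k) set)"
    using Cons.prems by (intro Cons.IH) (simp_all add: zs')
  moreover have "Y j v \<in> (Y_algebra :: (_ \<Rightarrow>\<^sub>0 'k) set)" "Y_prod us \<in> (Y_algebra :: (_ \<Rightarrow>\<^sub>0 'k) set)" "Y_prod vs \<in> (Y_algebra :: (_ \<Rightarrow>\<^sub>0 'k) set)"
  proof -
    have "\<forall>z\<in>set zs'. snd z \<noteq> []"
      using Cons.prems(2) set by blast
    then show "Y j v \<in> (Y_algebra :: (_ \<Rightarrow>\<^sub>0 'k) set)" "Y_prod us \<in> (Y_algebra :: (_ \<Rightarrow>\<^sub>0 'k) set)"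
        "Y_prod vs \<in> (Y_algebra :: (_ \<Rightarrow>\<^sub>0 'k) set)"
      by (simp_all add: z zs' Y_algebra_Y Y_algebra_Y_prod)
  qed
  ultimately have "Y j v * (Y_prod zs - Y_prod (us @ vs)) + (Y j v * Y_prod us - Y_prod us * Y j v) * Y_prod vs \<in> (Y_comm_ideal :: (_ \<Rightarrow>\<^sub>0 'k) set)"
    by (intro ideal_add ideal_mult commutator_in_ideal)
  then show ?case
    by (simp add: z zs' algebra_simps)
qed

text \<open>Some ordering of a commutative monomial; by \<open>Y_prod_permute\<close> the choice is immaterial modulo the
  commutator ideal.\<close>

definition order_factors :: "'a multiset \<Rightarrow> 'a list" where
  "order_factors m = (SOME zs. mset zs = m)"

lemma mset_order_factors: "mset (order_factors m) = m"
  unfolding order_factors_def by (rule someI_ex) (rule ex_mset)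

definition Y_poly :: "(('n::finite \<times> 'n list) multiset \<Rightarrow>\<^sub>0 'k) \<Rightarrow> (('n, 'k::field) planar)" where
  "Y_poly = lin_ext (\<lambda>m. Y_prod (order_factors m))"

lemma Y_poly_add: "Y_poly (p + q) = Y_poly p + Y_poly q"
  by (simp add: Y_poly_def lin_ext_add)

lemma Y_poly_single: "Y_poly (Poly_Mapping.single m c) = scale c (Y_prod (order_factors m))"
  by (simp add: Y_poly_def)

lemma Y_poly_scale: "Y_poly (scale c p) = scale c (Y_poly p)"
  by (simp add: Y_poly_def lin_ext_scale)

lemma Y_poly_zero: "Y_poly 0 = 0"
  by (simp add: Y_poly_def)

lemma fdb_monomials_nonempty: "m \<in> fdb_monomials \<Longrightarrow> z \<in># m \<Longrightarrow> snd z \<noteq> []"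
  by (force simp: fdb_monomials_def)

lemma Y_prod_order_factors: "m \<in> fdb_monomials \<Longrightarrow> Y_prod (order_factors m) \<in> Y_algebra"
  by (rule Y_algebra_Y_prod) (metis fdb_monomials_nonempty mset_order_factors set_mset_mset)

lemma Y_poly_in: "keys p \<subseteq> fdb_monomials \<Longrightarrow> Y_poly p \<in> Y_algebra"
  unfolding Y_poly_def by (rule Y_algebra_lin_ext) (auto intro: Y_prod_order_factors)

lemma forget_planar_Y_poly:
  fixes p :: "('n::finite \<times> 'n list) multiset \<Rightarrow>\<^sub>0 'k::field"
  shows "forget_planar (Y_poly p) = lin_ext Yc_prod p"
proof -
  have "forget_planar (Y_prod (order_factors m) :: _ \<Rightarrow>\<^sub>0 'k) = Yc_prod m" for m :: "('n \<times> 'n list) multiset"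
  proof -
    have "forget_planar (Y_prod (order_factors m) :: _ \<Rightarrow>\<^sub>0 'k) = prod_mset (mset (map (\<lambda>(j, v). Yc j v) (order_factors m)))"
      by (simp only: forget_planar_Y_prod prod_mset_prod_list)
    also have "\<dots> = Yc_prod m"
      by (simp only: mset_map mset_order_factors Yc_prod_def)
    finally show ?thesis .
  qed
  then show ?thesis
    unfolding Y_poly_def forget_planar_eq lin_ext_lin_ext by (intro lin_ext_cong)
qed

lemma Y_poly_mult:
  assumes "keys p \<subseteq> fdb_monomials" "keys q \<subseteq> fdb_monomials"
  shows "Y_poly p * Y_poly q - Y_poly (p * q) \<in> (Y_comm_ideal :: (_ \<Rightarrow>\<^sub>0 'k::field) set)"
  using assms(1)
proof (induction p rule: lin_combination_induct_on)
  case zero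
  then show ?case by (simp add: Y_poly_def ideal_zero)
next
  case (add m c p)
  have basis: "Y_prod (order_factors m) * Y_poly q - Y_poly (basis m * q) \<in> (Y_comm_ideal :: (_ \<Rightarrow>\<^sub>0 'k) set)"
    using assms(2)
  proof (induction q rule: lin_combination_induct_on)
    case zero
    then show ?case by (simp add: Y_poly_zero ideal_zero)
  next
    case (add n d q)
    have "\<forall>z\<in>set (order_factors m @ order_factors n). snd z \<noteq> []"
      using fdb_monomials_nonempty[OF \<open>m \<in> fdb_monomials\<close>] fdb_monomials_nonempty[OF \<open>n \<in> fdb_monomials\<close>]
      by (metis Un_iff mset_order_factors set_append set_mset_mset)
    then have perm: "Y_prod (order_factors m @ order_factors n) - Y_prod (order_factors (m + n)) \<in> (Y_comm_ideal :: (_ \<Rightarrow>\<^sub>0 'k) set)"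
      by (intro Y_prod_permute) (simp_all add: mset_order_factors)
    have "Y_prod (order_factors m) * Y_poly (Poly_Mapping.single n d + q) - Y_poly (basis m * (Poly_Mapping.single n d + q)) =
      scale d (Y_prod (order_factors m @ order_factors n) - Y_prod (order_factors (m + n))) +
      (Y_prod (order_factors m) * Y_poly q - Y_poly (basis m * q) :: _ \<Rightarrow>\<^sub>0 'k)"
      by (simp add: Y_poly_add Y_poly_single distrib_left mult_single scale_mult scale_diff add_diff_add)
    then show ?case
      using ideal_add[OF ideal_scale[OF perm, of d] add.IH] by (simp only:)
  qed
  have "Y_poly (Poly_Mapping.single m c + p) * Y_poly q - Y_poly ((Poly_Mapping.single m c + p) * q) =
    scale c (Y_prod (order_factors m) * Y_poly q - Y_poly (basis m * q)) + (Y_poly p * Y_poly q - Y_poly (p * q) :: _ \<Rightarrow>\<^sub>0 'k)"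
  proof -
    have "Poly_Mapping.single m c * q = scale c (basis m * q)"
      by (metis mult.right_neutral scale_mult(1) scale_single)
    then show ?thesis
      by (simp only: distrib_right Y_poly_add Y_poly_single Y_poly_scale scale_mult scale_diff add_diff_add)
  qed
  then show ?case
    using ideal_add[OF ideal_scale[OF basis, of c] add.IH] by (simp only:)
qed

text \<open>Modulo commutators an element of the subalgebra is a commutative polynomial in the generators. This
  polynomial is unique and can be recovered by \<open>read\<close>, because the images of the generators under
  forgetting the planar structure are algebraically independent.\<close>

lemma diff_Y_poly_read:
  assumes "a \<in> Y_algebra"
  shows "a - Y_poly (read a) \<in> (Y_comm_ideal :: (_ \<Rightarrow>\<^sub>0 'k::field_char_0) set)"
  using assms
proof (induction a rule: Y_algebra_induct)
  case (Y i w)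
  have "read (Y i w) = (fdb_y i w :: _ \<Rightarrow>\<^sub>0 'k)"
    using read_Yc_prod_lin[OF fdb_y_keys[OF Y]] by (simp add: Yc_prod_fdb_y[OF Y] Yc_def)
  moreover have "Y_poly (fdb_y i w) = (Y i w :: _ \<Rightarrow>\<^sub>0 'k)"
  proof -
    have "order_factors {#z#} = [z]" for z :: "'a \<times> 'a list"
      using mset_order_factors[of "{#z#}"] by simp
    moreover have "order_factors {#} = ([] :: ('a \<times> 'a list) list)"
      using mset_order_factors[of "{#}"] by simp
    ultimately show ?thesis
      by (simp add: Y_poly_def fdb_y_def Y_letter)
  qed
  ultimately show ?case by (simp add: ideal_zero)
next
  case one
  have "order_factors {#} = ([] :: ('a \<times> 'a list) list)"
    using mset_order_factors[of "{#}"] by simp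
  then show ?case
    by (simp add: forget_planar_simps read_forest_def Y_poly_def ideal_zero)
next
  case (add x y)
  from ideal_add[OF add.IH] show ?case
    by (simp only: forget_planar_simps lin_ext_add Y_poly_add add_diff_add)
next
  case (mult x y)
  note keys = read_keys[OF mult.hyps(1)] read_keys[OF mult.hyps(2)]
  have "(x - Y_poly (read x)) * y + Y_poly (read x) * (y - Y_poly (read y)) +
      (Y_poly (read x) * Y_poly (read y) - Y_poly (read x * read y)) \<in> Y_comm_ideal"
    using mult keys by (intro ideal_add ideal_mult Y_poly_mult Y_poly_in)
  then show ?case
    by (simp only: forget_planar_simps lin_ext_mult[of read_forest, OF read_forest_add])
      (simp add: left_diff_distrib right_diff_distrib)
next
  case (scale c x)
  from ideal_scale[OF scale.IH] show ?case
    by (simp only: forget_planar_simps lin_ext_scale Y_poly_scale scale_diff)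
qed

text \<open>The step that identifies the abelianization with a subalgebra of non-planar trees.\<close>

lemma ideal_iff_forget_planar:
  assumes "a \<in> Y_algebra"
  shows "a \<in> (Y_comm_ideal :: (_ \<Rightarrow>\<^sub>0 'k::field_char_0) set) \<longleftrightarrow> forget_planar a = 0"
  using forget_planar_ideal diff_Y_poly_read[OF assms] by (auto simp: Y_poly_def)

section \<open>The abelianization\<close>

abbreviation Y_ab :: "('k::field, (('n::finite, 'k) planar) set) bialg" where
  "Y_ab \<equiv> abelianization Y_bialg"

definition coset :: "(('n::finite, 'k::field) planar) \<Rightarrow> (('n, 'k) planar) set" where
  "coset a = Y_comm_ideal +>\<^bsub>Y_bialg\<^esub> a"

lemma coset_iff: "x \<in> coset a \<longleftrightarrow> x - a \<in> Y_comm_ideal"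
proof -
  have "coset a = (\<lambda>i. i + a) ` Y_comm_ideal"
    by (auto simp: coset_def a_r_coset_def')
  then show ?thesis
    by (metis (no_types, lifting) add_diff_cancel_right' diff_add_cancel image_iff)
qed

lemma coset_eqI:
  assumes *: "a - b \<in> Y_comm_ideal"
  shows "coset a = coset b"
proof -
  have "x \<in> coset a \<longleftrightarrow> x \<in> coset b" for x
    unfolding coset_iff using ideal_add[of "x - a" "a - b"] ideal_diff[of "x - b" "a - b"] * by auto
  then show ?thesis by blast
qed

text \<open>The choice made in the operations of the quotient.\<close>

definition representative :: "(('n::finite, 'k::field) planar) set \<Rightarrow> (('n, 'k) planar)" where
  "representative Z = (SOME x. x \<in> Z)"

lemma representative_coset: "representative (coset a) - a \<in> Y_comm_ideal"
proof -
  have "a \<in> coset a" by (simp add: coset_iff ideal_zero)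
  then have "representative (coset a) \<in> coset a"
    unfolding representative_def by (rule someI)
  then show ?thesis by (simp add: coset_iff)
qed

lemma representative_in: "a \<in> Y_algebra \<Longrightarrow> representative (coset a) \<in> Y_algebra"
  using Y_algebra_add[OF ideal_subset[OF representative_coset[of a]], of a] by simp

lemma forget_representative: "forget_planar (representative (coset a)) = forget_planar a"
  using forget_planar_ideal[OF representative_coset[of a]] by (simp add: forget_planar_simps)

lemma Y_ab_carrier: "carrier Y_ab = coset ` Y_algebra"
  by (auto simp: abelianization_def quotient_bialg_def FactRing_def A_RCOSETS_def' coset_def Y_comm_ideal_def)

lemma Y_ab_simps:
  fixes a b :: "('n::finite, 'k::field) planar"
  shows "\<zero>\<^bsub>Y_ab\<^esub> = coset (0 :: ('n, 'k) planar)"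
  "\<one>\<^bsub>Y_ab\<^esub> = coset (1 :: ('n, 'k) planar)"
  "a \<in> Y_algebra \<Longrightarrow> b \<in> Y_algebra \<Longrightarrow> coset a \<oplus>\<^bsub>Y_ab\<^esub> coset b = coset (a + b)"
  "a \<in> Y_algebra \<Longrightarrow> b \<in> Y_algebra \<Longrightarrow> coset a \<otimes>\<^bsub>Y_ab\<^esub> coset b = coset (a * b)"
  "c \<odot>\<^bsub>Y_ab\<^esub> coset a = coset (scale c a)"
proof -
  have "coset 0 = (Y_comm_ideal :: (('n, 'k) planar) set)"
    by (auto simp: coset_iff)
  then show "\<zero>\<^bsub>Y_ab\<^esub> = coset (0 :: ('n, 'k) planar)"
    by (simp add: abelianization_def quotient_bialg_def FactRing_def Y_comm_ideal_def)
  show "\<one>\<^bsub>Y_ab\<^esub> = coset (1 :: ('n, 'k) planar)"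
    by (simp add: abelianization_def quotient_bialg_def FactRing_def coset_def Y_comm_ideal_def)
  show "coset a \<oplus>\<^bsub>Y_ab\<^esub> coset b = coset (a + b)" if "a \<in> Y_algebra" "b \<in> Y_algebra"
    using abelian_subgroup.a_rcos_sum[OF abelian_subgroupI3[OF ideal.axioms(1)[OF ideal_Y_comm_ideal] Yb.is_abelian_group], of a b] that
    by (simp add: abelianization_def quotient_bialg_def FactRing_def coset_def Y_comm_ideal_def)
  show "coset a \<otimes>\<^bsub>Y_ab\<^esub> coset b = coset (a * b)" if "a \<in> Y_algebra" "b \<in> Y_algebra"
    using ideal.rcoset_mult_add[OF ideal_Y_comm_ideal, of a b] that
    by (simp add: abelianization_def quotient_bialg_def FactRing_def coset_def Y_comm_ideal_def)
  have "c \<odot>\<^bsub>Y_ab\<^esub> coset a = coset (scale c (representative (coset a)))"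
    by (simp add: abelianization_def quotient_bialg_def coset_def Y_comm_ideal_def representative_def)
  also have "\<dots> = coset (scale c a)"
    using ideal_scale[OF representative_coset[of a], of c] by (intro coset_eqI) (simp add: scale_diff)
  finally show "c \<odot>\<^bsub>Y_ab\<^esub> coset a = coset (scale c a)" .
qed

lemma Y_ab_comult: "comult Y_ab (coset a) = tmap coset coset (comult Y_bialg (representative (coset a)))"
  and Y_ab_counit: "counit Y_ab (coset a) = lookup (representative (coset a)) 0"
  by (simp_all add: abelianization_def quotient_bialg_def coset_def[abs_def] Y_comm_ideal_def representative_def)

definition read_coset :: "(('n::finite, 'k::field_char_0) planar) set \<Rightarrow> (('n \<times> 'n list) multiset \<Rightarrow>\<^sub>0 'k)" where
  "read_coset Z = read (representative Z)"

lemma read_coset: "read_coset (coset a) = read a"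
  by (simp add: read_coset_def forget_representative)

lemma read_coset_bij:
  "bij_betw read_coset (coset ` Y_algebra) {x :: ('n::finite \<times> 'n list) multiset \<Rightarrow>\<^sub>0 'k::field_char_0. keys x \<subseteq> fdb_monomials}"
  unfolding bij_betw_def
proof (intro conjI inj_onI)
  fix Z Z' :: "(('n, 'k) planar) set"
  assume "Z \<in> coset ` Y_algebra" "Z' \<in> coset ` Y_algebra" and eq: "read_coset Z = read_coset Z'"
  then obtain a b where a: "a \<in> Y_algebra" "Z = coset a" and b: "b \<in> Y_algebra" "Z' = coset b" by blast
  then have "forget_planar a = forget_planar b"
    using eq by (metis Yc_prod_read read_coset)
  then have "a - b \<in> Y_comm_ideal"
    using a b by (simp add: ideal_iff_forget_planar Y_algebra_diff forget_planar_simps)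
  then show "Z = Z'"
    unfolding a b by (rule coset_eqI)
next
  show "read_coset ` coset ` Y_algebra = {x :: ('n \<times> 'n list) multiset \<Rightarrow>\<^sub>0 'k. keys x \<subseteq> fdb_monomials}"
  proof (intro equalityI subsetI)
    fix p :: "('n \<times> 'n list) multiset \<Rightarrow>\<^sub>0 'k" assume "p \<in> {x. keys x \<subseteq> fdb_monomials}"
    then have p: "keys p \<subseteq> fdb_monomials" by simp
    then have "read_coset (coset (Y_poly p)) = p"
      by (simp add: read_coset forget_planar_Y_poly read_Yc_prod_lin)
    then show "p \<in> read_coset ` coset ` Y_algebra"
      using Y_poly_in[OF p] by (metis image_eqI)
  next
    fix p :: "('n \<times> 'n list) multiset \<Rightarrow>\<^sub>0 'k" assume "p \<in> read_coset ` coset ` Y_algebra"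
    then obtain a where "a \<in> Y_algebra" "p = read_coset (coset a)" by blast
    then show "p \<in> {x. keys x \<subseteq> fdb_monomials}"
      using read_keys[of a] by (simp add: read_coset)
  qed
qed

lemma ck_coprod_Yc_prod_lin:
  assumes "keys p \<subseteq> fdb_monomials"
  shows "ck_coprod (lin_ext Yc_prod p) = map_tens Yc_prod Yc_prod (lin_ext fdb_mono_coprod p)"
proof -
  have "ck_coprod (lin_ext Yc_prod p) = lin_ext (\<lambda>m. ck_coprod (Yc_prod m)) p"
    by (simp add: ck_coprod_def lin_ext_lin_ext)
  also have "\<dots> = lin_ext (\<lambda>m. map_tens Yc_prod Yc_prod (fdb_mono_coprod m)) p"
    using assms by (intro lin_ext_cong fdb_mono_coprod_Yc_prod[symmetric]) blast
  also have "\<dots> = map_tens Yc_prod Yc_prod (lin_ext fdb_mono_coprod p)"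
    by (simp add: map_tens_def lin_ext_lin_ext)
  finally show ?thesis .
qed

lemma fdb_coprod_read:
  assumes "a \<in> Y_algebra"
  shows "map_tens (\<lambda>F. lin_ext read_forest (forget_basis F)) (\<lambda>F. lin_ext read_forest (forget_basis F)) (nck_coprod a) =
    (lin_ext fdb_mono_coprod (read a) :: _ \<Rightarrow>\<^sub>0 'k::field_char_0)"
proof -
  let ?Y = "Yc_prod :: _ \<Rightarrow> _ \<Rightarrow>\<^sub>0 'k" and ?R = "read_forest :: _ \<Rightarrow> _ \<Rightarrow>\<^sub>0 'k"
  have "map_tens (\<lambda>F. lin_ext ?R (forget_basis F)) (\<lambda>F. lin_ext ?R (forget_basis F)) (nck_coprod a) =
      map_tens ?R ?R (ck_coprod (lin_ext ?Y (read a)))"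
    unfolding map_tens_map_tens[symmetric] ck_coprod_forget[symmetric] Yc_prod_read[OF assms] ..
  also have "ck_coprod (lin_ext ?Y (read a)) = map_tens ?Y ?Y (lin_ext fdb_mono_coprod (read a))"
    by (rule ck_coprod_Yc_prod_lin[OF read_keys[OF assms]])
  also have "map_tens ?R ?R \<dots> = map_tens (\<lambda>m. lin_ext ?R (?Y m)) (\<lambda>m. lin_ext ?R (?Y m)) (lin_ext fdb_mono_coprod (read a))"
    by (rule map_tens_map_tens)
  also have "\<dots> = lin_ext fdb_mono_coprod (read a)"
  proof (rule map_tens_id_on)
    fix m n assume "(m, n) \<in> keys (lin_ext fdb_mono_coprod (read a) :: _ \<Rightarrow>\<^sub>0 'k)"
    then have "m \<in> fdb_monomials" "n \<in> fdb_monomials"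
      using read_keys[OF assms] fdb_mono_coprod_keys[where 'k = 'k] by (blast dest: subsetD[OF keys_lin_ext])+
    then show "lin_ext ?R (?Y m) = basis m \<and> lin_ext ?R (?Y n) = basis n"
      by (simp add: read_Yc_prod)
  qed
  finally show ?thesis .
qed

text \<open>The polynomial in the generators attached to a coset provides coordinates on the abelianization, in
  which its coproduct is that of the Faa di Bruno algebra. In particular the abelianization is a Hopf
  algebra.\<close>

lemma Y_ab_coordinates:
  "coordinates fdb_monomials fdb_mono_coprod fdb_weight
    (Y_ab :: ('k::field_char_0, (('n::finite, 'k) planar) set) bialg) read_coset"
proof (rule coordinates.intro[OF fdb_filtered_bialg], rule coordinates_axioms.intro)
  let ?Q = "Y_ab :: ('k, (('n, 'k) planar) set) bialg"
  show "bij_betw read_coset (carrier ?Q) {x. keys x \<subseteq> fdb_monomials}"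
    unfolding Y_ab_carrier by (rule read_coset_bij)
  show "\<zero>\<^bsub>?Q\<^esub> \<in> carrier ?Q" "\<one>\<^bsub>?Q\<^esub> \<in> carrier ?Q"
    by (simp_all add: Y_ab_carrier Y_ab_simps Y_algebra_zero Y_algebra_one)
  show "read_coset \<zero>\<^bsub>?Q\<^esub> = 0" "read_coset \<one>\<^bsub>?Q\<^esub> = 1"
    by (simp_all add: Y_ab_simps read_coset forget_planar_simps read_forest_def)
  {
    fix Z Z' assume "Z \<in> carrier ?Q" "Z' \<in> carrier ?Q"
    then obtain a b where [simp]: "Z = coset a" "Z' = coset b" and ab: "a \<in> Y_algebra" "b \<in> Y_algebra"
      unfolding Y_ab_carrier by blast
    show "Z \<oplus>\<^bsub>?Q\<^esub> Z' \<in> carrier ?Q" "Z \<otimes>\<^bsub>?Q\<^esub> Z' \<in> carrier ?Q"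
      using ab by (simp_all add: Y_ab_simps Y_ab_carrier Y_algebra_add Y_algebra_mult)
    show "read_coset (Z \<oplus>\<^bsub>?Q\<^esub> Z') = read_coset Z + read_coset Z'"
      using ab by (simp add: Y_ab_simps read_coset forget_planar_simps lin_ext_add)
    show "read_coset (Z \<otimes>\<^bsub>?Q\<^esub> Z') = read_coset Z * read_coset Z'"
      using ab by (simp add: Y_ab_simps read_coset forget_planar_simps lin_ext_mult[of read_forest, OF read_forest_add])
  next
    fix Z c assume "Z \<in> carrier ?Q"
    then obtain a where [simp]: "Z = coset a" and a: "a \<in> Y_algebra"
      unfolding Y_ab_carrier by blast
    show "c \<odot>\<^bsub>?Q\<^esub> Z \<in> carrier ?Q"
      using a by (simp add: Y_ab_simps Y_ab_carrier Y_algebra_scale)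
    show "read_coset (c \<odot>\<^bsub>?Q\<^esub> Z) = scale c (read_coset Z)"
      by (simp add: Y_ab_simps read_coset forget_planar_simps lin_ext_scale)
    let ?x = "representative (coset a)"
    have x: "?x \<in> Y_algebra" by (rule representative_in[OF a])
    have fx: "forget_planar ?x = forget_planar a" by (rule forget_representative)
    show "keys (comult ?Q Z) \<subseteq> carrier ?Q \<times> carrier ?Q"
      unfolding Y_ab_carrier using Y_bialg_comult(1)[OF x]
      by (auto simp: Y_ab_comult tmap_def dest!: subsetD[OF keys_lin_ext])
    let ?g = "\<lambda>F. lin_ext read_forest (forget_basis F) :: _ \<Rightarrow>\<^sub>0 'k"
    have g: "read b = lin_ext ?g b" for b
      by (simp add: forget_planar_eq lin_ext_lin_ext)
    have "lin_ext (\<lambda>(b, c). tens (read_coset b) (read_coset c)) (comult ?Q Z) =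
        lin_ext (\<lambda>(b, c). tens (lin_ext ?g b) (lin_ext ?g c)) (comult Y_bialg ?x)"
      by (simp add: Y_ab_comult tmap_def lin_ext_lin_ext case_prod_unfold read_coset g)
    also have "\<dots> = map_tens ?g ?g (lin_ext (\<lambda>(b, c). tens b c) (comult Y_bialg ?x))"
      unfolding map_tens_tens[symmetric] by (simp add: map_tens_def lin_ext_lin_ext case_prod_unfold)
    also have "\<dots> = map_tens ?g ?g (nck_coprod ?x)"
      by (simp only: Y_bialg_comult(2)[OF x])
    also have "\<dots> = lin_ext fdb_mono_coprod (read ?x)"
      by (rule fdb_coprod_read[OF x])
    finally show "lin_ext (\<lambda>(b, c). tens (read_coset b) (read_coset c)) (comult ?Q Z) = lin_ext fdb_mono_coprod (read_coset Z)"
      by (simp add: read_coset fx)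
    have "lookup ?x 0 = lookup (forget_planar ?x) 0"
    proof -
      have "lookup y 0 = lookup (forget_planar y) 0" for y :: "('n, 'k) planar"
        by (induction y rule: basis_induct)
          (simp_all add: forget_planar_simps lookup_add, simp add: forget_planar_eq forget_basis_def lookup_single zero_list_def)
      then show ?thesis .
    qed
    also have "\<dots> = lookup (lin_ext Yc_prod (read a)) 0"
      by (simp add: fx Yc_prod_read[OF a])
    also have "\<dots> = lookup (read a) 0"
    proof -
      have "lookup (lin_ext Yc_prod p) 0 = lookup p 0"
        if "keys p \<subseteq> fdb_monomials" for p :: "('n \<times> 'n list) multiset \<Rightarrow>\<^sub>0 'k"
        using that
      proof (induction p rule: lin_combination_induct_on)
        case (add m c p)
        have "lookup (Yc_prod m :: _ \<Rightarrow>\<^sub>0 'k) 0 = (if m = 0 then 1 else 0)"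
          using add(1) by (rule lookup_Yc_prod_zero)
        with add(3) show ?case
          by (simp add: lin_ext_add lookup_add lookup_single)
      qed simp
      then show ?thesis using read_keys[OF a] .
    qed
    finally show "counit ?Q Z = lookup (read_coset Z) 0"
      by (simp add: Y_ab_counit read_coset)
  }
qed

theorem mainTheorem7:
  fixes A :: "(('n::finite \<times> 'n \<times> 'n) ptree list \<Rightarrow>\<^sub>0 'k::field_char_0) set"
  assumes A: "A = generated_subalgebra H_NCK {Y i w | i w. w \<noteq> []}"
  shows "hopf_subalgebra H_NCK A \<and>
    hopf_hom H_NCK H_CK (forget_planar ::
      (('n \<times> 'n \<times> 'n) ptree list \<Rightarrow>\<^sub>0 'k) \<Rightarrow> (('n \<times> 'n \<times> 'n) rtree multiset \<Rightarrow>\<^sub>0 'k)) \<and>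
    (let B = sub_bialg H_NCK A in
      (\<exists>\<iota>. hopf_hom (abelianization B) H_CK \<iota> \<and>
           inj_on \<iota> (carrier (abelianization B)) \<and>
           (\<forall>a\<in>A. \<iota> (commutator_ideal B +>\<^bsub>B\<^esub> a) = forget_planar a) \<and>
           k_subalgebra H_CK (\<iota> ` carrier (abelianization B))) \<and>
      hopf_isomorphic (abelianization B)
        (H_FdB :: ('k, ('n \<times> 'n list) multiset \<Rightarrow>\<^sub>0 'k) bialg))"
proof -
  have A: "A = Y_algebra"
    by (simp add: A Y_algebra_def)
  let ?Q = "Y_ab :: ('k, (('n, 'k) planar) set) bialg"
  let ?\<iota> = "\<lambda>Z. lin_ext Yc_prod (read_coset Z) :: ('n, 'k) nonplanar"
  have \<iota>: "?\<iota> (coset a) = forget_planar a" if "a \<in> Y_algebra" for a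
    using that by (simp add: read_coset Yc_prod_read)
  have 1: "hopf_hom ?Q H_CK ?\<iota>"
    by (rule hopf_hom_coordinates[OF Y_ab_coordinates ck.coordinates_axioms, of Yc_prod])
      (simp_all add: Yc_prod_simps lookup_Yc_prod_zero fdb_mono_coprod_Yc_prod flip: ck_coprod_def)
  have 2: "inj_on ?\<iota> (carrier ?Q)"
  proof (rule inj_onI)
    fix Z Z' assume Z: "Z \<in> carrier ?Q" "Z' \<in> carrier ?Q" and eq: "?\<iota> Z = ?\<iota> Z'"
    then have "keys (read_coset Z) \<subseteq> fdb_monomials" "keys (read_coset Z') \<subseteq> fdb_monomials"
      using read_coset_bij[where 'n = 'n and 'k = 'k] by (auto simp: Y_ab_carrier dest!: bij_betwE)
    then have "read_coset Z = read_coset Z'"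
      using eq by (metis read_Yc_prod_lin)
    with Z show "Z = Z'"
      using read_coset_bij[where 'n = 'n and 'k = 'k] unfolding Y_ab_carrier by (auto simp: bij_betw_def dest: inj_onD)
  qed
  have image: "?\<iota> ` carrier ?Q = forget_planar ` Y_algebra"
    unfolding Y_ab_carrier image_image by (intro image_cong refl \<iota>)
  have 3: "k_subalgebra H_CK (?\<iota> ` carrier ?Q)"
    unfolding k_subalgebra_CK image
    by (auto simp flip: forget_planar_simps intro!: imageI Y_algebra_one Y_algebra_add Y_algebra_mult Y_algebra_scale)
  have "hopf_hom ?Q H_FdB read_coset"
  proof (rule hopf_hom_coordinates[OF Y_ab_coordinates fdb.coordinates_axioms, of basis])
    fix m :: "('n \<times> 'n list) multiset" assume m: "m \<in> fdb_monomials"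
    show "map_tens basis basis (fdb_mono_coprod m) = lin_ext fdb_mono_coprod (basis m :: _ \<Rightarrow>\<^sub>0 'k)"
      by (simp add: map_tens_id_on)
  next
    fix Z assume "Z \<in> carrier ?Q"
    then show "read_coset Z \<in> carrier H_FdB"
      using read_coset_bij[where 'n = 'n and 'k = 'k]
      by (auto simp: Y_ab_carrier H_FdB_def monoid_bialg_def fdb_carrier_eq dest!: bij_betwE)
  qed (simp_all add: mult_single lookup_single lin_ext_basis)
  moreover have "bij_betw read_coset (carrier ?Q) (carrier H_FdB)"
    using read_coset_bij by (simp add: Y_ab_carrier H_FdB_def monoid_bialg_def fdb_carrier_eq)
  ultimately have 4: "hopf_isomorphic ?Q (H_FdB :: ('k, ('n \<times> 'n list) multiset \<Rightarrow>\<^sub>0 'k) bialg)"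
    unfolding hopf_isomorphic_def by blast
  have 5: "\<forall>a\<in>Y_algebra. ?\<iota> (commutator_ideal Y_bialg +>\<^bsub>Y_bialg\<^esub> a) = forget_planar a"
    using \<iota> by (simp add: coset_def Y_comm_ideal_def)
  show ?thesis
    unfolding A Let_def
    using hopf_subalgebra_Y_algebra hopf_hom_forget_planar 1 2 3 4 5 by blast
qed

end
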